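(* Let $T>0$. Assume that for some $M\ge0$: $\|F(0)\|\le M$ and $\|F(x)-F(y)\|\le M\|x-y\|_{-1}$ for all $x,y\in H$; $\|G(x)-G(y)\|\le M\|x-y\|_{-1}$ for all $x,y\in H$; $\|G(x)\|\le M$ for all $x\in H$. Assume also $\int_H\|z\|^2e^{K\|z\|}\nu(dz)<+\infty$ for every $K>0$. Let $g\in{\rm Lip}_b(H_{-1})$, and let $$v(t,x)=\sup_{u(\cdot)\in M_t}\Big\{\int_t^T-L_0(u(s))\,ds+g(X(T))\Big\},\qquad (t,x)\in[0,T]\times H,$$ where $X$ is the mild solution of $X'(s)=-AX(s)+F(X(s))+G(X(s))u(s)$, $X(t)=x$. Then there exist a constant $D_1$ and, for every $R>0$, a modulus $\omega_R$ such that $$|v(t,x)-v(s,y)|\le D_1\|x-y\|_{-1}+\omega_R(|t-s|)\quad\text{for }x,y\in H,\ \|x\|,\|y\|\le R,\ t,s\in[0,T].$$ Moreover $v$ is a viscosity solution of the Hamilton–Jacobi–Bellman equation $$v_t+\langle-Ax+F(x),Dv\rangle+H_0(G^*(x)Dv)=0\ \text{ in }(0,T)\times H,\qquad v(T,x)=g(x).$$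
   Context: $H$ is a real separable Hilbert space; $L(H)$ is the space of bounded linear operators on $H$; $F:H\to H$, $G:H\to L(H)$, $G^*(x)=G(x)^*$. $A$ is a linear, densely defined, maximal monotone operator in $H$; $S(\cdot)$ is the contraction $C_0$-semigroup generated by $-A$. $B$ is a bounded, linear, (strictly) positive, self-adjoint operator on $H$ such that $A^*B$ is bounded and $\langle(A^*B+c_0B)x,x\rangle\ge0$ for all $x\in H$, for some $c_0\ge0$. $\|x\|_{-1}=\|B^{1/2}x\|$, $H_{-1}$ is the completion of $H$ under this norm, and ${\rm Lip}_b(H_{-1})$ is the set of bounded Lipschitz functions on $H_{-1}$. $\nu$ is a Borel measure on $H$ with $\nu(\{0\})=0$ and $\int_H\|z\|^2\nu(dz)<\infty$. $$H_0(p)=\int_H[e^{\langle p,z\rangle}-1-\langle p,z\rangle]\nu(dz),\qquad L_0(z)=\sup_{y\in H}\{\langle z,y\rangle-H_0(y)\}\in[0,+\infty].$$ $M_t=\{u:[t,T]\to H:\ u\text{ strongly measurable}\}$; a control with $\int_t^TL_0(u(s))ds=+\infty$ has payoff $-\infty$ (if the integral is finite, $u$ is integrable). Mild solution: $X\in C([t,T];H)$ with $X(s)=S(s-t)x+\int_t^sS(s-\tau)[F(X(\tau))+G(X(\tau))u(\tau)]d\tau$. A modulus is a nondecreasing continuous $\omega:[0,\infty)\to[0,\infty)$ with $\omega(0)=0$. $B$-semicontinuity: $u:\Omega\to\mathbb{R}$, $\Omega\subset[0,T]\times H$, is $B$-upper (resp. $B$-lower) semicontinuous if whenever $t_k\to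 t$, $x_k\rightharpoonup x$ weakly, $Bx_k\to Bx$, $(t,x)\in\Omega$ (with $(t_k,x_k)\in\Omega$), then $\limsup u(t_k,x_k)\le u(t,x)$ (resp. $\liminf u(t_k,x_k)\ge u(t,x)$). Test functions (first order equation): $\varphi\in C^1((0,T)\times H)$, $B$-lower semicontinuous, with $\varphi,\varphi_t,D\varphi,A^*D\varphi$ uniformly continuous on $[\epsilon,T-\epsilon]\times H$ for every $\epsilon>0$ and $\varphi$ bounded on every set $[\epsilon,T-\epsilon]\times\{\|x\|_{-1}\le r\}$; and $h\in C^1([0,\infty))$ with $h'(0)=0$, $h'(r)\ge0$ for $r>0$, $h,h'$ uniformly continuous on $[0,\infty)$. A locally bounded $B$-upper semicontinuous $u:(0,T)\times H\to\mathbb{R}$ is a viscosity subsolution if whenever $u-\varphi-h(\|\cdot\|)$ has a maximum over $(0,T)\times H$ at $(t,x)$ for some test functions, then with $\psi=\varphi+h(\|\cdot\|)$, $\psi_t(t,x)-\langle x,A^*D\varphi(t,x)\rangle+\langle F(x),D\psi(t,x)\rangle+H_0(G^*(x)D\psi(t,x))\ge0$. A locally bounded $B$-lower semicontinuous $u$ is a viscosity supersolution if whenever $u+\varphi+h(\|\cdot\|)$ has a minimum over $(0,T)\times H$ at $(t,x)$, then with $\psi=-\varphi-h(\|\cdot\|)$, $\psi_t(t,x)+\langle x,A^*D\varphi(t,x)\rangle+\langle F(x),D\psi(t,x)\rangle+H_0(G^*(x)D\psi(t,x))\le0$. A viscosity solution is both. *)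

theory Defs
  imports "HOL-Analysis.Analysis"
begin

text \<open>
  An unbounded operator is given by its domain \<open>D\<close> together with a total function \<open>A\<close> of which
  only the values on \<open>D\<close> are relevant.
\<close>

definition linear_operator_on :: "'a::real_vector set \<Rightarrow> ('a \<Rightarrow> 'a) \<Rightarrow> bool" where
  "linear_operator_on D A \<longleftrightarrow> subspace D \<and>
     (\<forall>x\<in>D. \<forall>y\<in>D. A (x + y) = A x + A y) \<and> (\<forall>c. \<forall>x\<in>D. A (c *\<^sub>R x) = c *\<^sub>R A x)"

definition monotone_graph :: "('a::real_inner \<times> 'a) set \<Rightarrow> bool" where
  "monotone_graph \<Gamma> \<longleftrightarrow> (\<forall>(x, y)\<in>\<Gamma>. \<forall>(x', y')\<in>\<Gamma>. 0 \<le> (y - y') \<bullet> (x - x'))"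

definition maximal_monotone :: "'a::real_inner set \<Rightarrow> ('a \<Rightarrow> 'a) \<Rightarrow> bool" where
  "maximal_monotone D A \<longleftrightarrow> monotone_graph ((\<lambda>x. (x, A x)) ` D) \<and>
     (\<forall>\<Gamma>. monotone_graph \<Gamma> \<longrightarrow> (\<lambda>x. (x, A x)) ` D \<subseteq> \<Gamma> \<longrightarrow> \<Gamma> = (\<lambda>x. (x, A x)) ` D)"

definition adj_domain :: "'a::real_inner set \<Rightarrow> ('a \<Rightarrow> 'a) \<Rightarrow> 'a set" where
  "adj_domain D A = {y. \<exists>z. \<forall>x\<in>D. A x \<bullet> y = x \<bullet> z}"

text \<open>For dense \<open>D\<close> the element below exists and is unique for every \<open>y \<in> adj_domain D A\<close>.\<close>

definition adj_op :: "'a::real_inner set \<Rightarrow> ('a \<Rightarrow> 'a) \<Rightarrow> 'a \<Rightarrow> 'a" where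
  "adj_op D A y = (THE z. \<forall>x\<in>D. A x \<bullet> y = x \<bullet> z)"

definition contraction_C0_semigroup :: "(real \<Rightarrow> 'a::real_normed_vector \<Rightarrow>\<^sub>L 'a) \<Rightarrow> bool" where
  "contraction_C0_semigroup S \<longleftrightarrow> S 0 = id_blinfun \<and>
     (\<forall>s\<ge>0. \<forall>t\<ge>0. S (s + t) = S s o\<^sub>L S t) \<and>
     (\<forall>x. ((\<lambda>t. S t x) \<longlongrightarrow> x) (at_right 0)) \<and>
     (\<forall>t\<ge>0. norm (S t) \<le> 1)"

definition generator_of ::
    "(real \<Rightarrow> 'a::real_normed_vector \<Rightarrow>\<^sub>L 'a) \<Rightarrow> 'a set \<Rightarrow> ('a \<Rightarrow> 'a) \<Rightarrow> bool" where
  "generator_of S D C \<longleftrightarrow>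
     D = {x. \<exists>y. ((\<lambda>h. (S h x - x) /\<^sub>R h) \<longlongrightarrow> y) (at_right 0)} \<and>
     (\<forall>x\<in>D. ((\<lambda>h. (S h x - x) /\<^sub>R h) \<longlongrightarrow> C x) (at_right 0))"

definition self_adjoint :: "('a::real_inner \<Rightarrow>\<^sub>L 'a) \<Rightarrow> bool" where
  "self_adjoint B \<longleftrightarrow> (\<forall>x y. B x \<bullet> y = x \<bullet> B y)"

definition strictly_positive :: "('a::real_inner \<Rightarrow>\<^sub>L 'a) \<Rightarrow> bool" where
  "strictly_positive B \<longleftrightarrow> (\<forall>x. x \<noteq> 0 \<longrightarrow> 0 < B x \<bullet> x)"

definition sqrt_op :: "('a::real_inner \<Rightarrow>\<^sub>L 'a) \<Rightarrow> 'a \<Rightarrow>\<^sub>L 'a" where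
  "sqrt_op B = (THE R. self_adjoint R \<and> (\<forall>x. 0 \<le> R x \<bullet> x) \<and> R o\<^sub>L R = B)"

definition norm_m1 :: "('a::real_inner \<Rightarrow>\<^sub>L 'a) \<Rightarrow> 'a \<Rightarrow> real" where
  "norm_m1 B x = norm (sqrt_op B x)"

text \<open>
  The Banach space \<open>'b\<close>, with the embedding \<open>J\<close>, is a completion of \<open>'a\<close> under the norm \<open>N\<close>.
\<close>

definition is_completion :: "('a::real_vector \<Rightarrow> real) \<Rightarrow> ('a \<Rightarrow> 'b::banach) \<Rightarrow> bool" where
  "is_completion N J \<longleftrightarrow> linear J \<and> (\<forall>x. norm (J x) = N x) \<and> closure (range J) = UNIV"

definition Lip_b :: "('b::metric_space \<Rightarrow> real) set" where
  "Lip_b = {g. bounded (range g) \<and> (\<exists>C. C-lipschitz_on UNIV g)}"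

definition H0 :: "'a::real_inner measure \<Rightarrow> 'a \<Rightarrow> real" where
  "H0 \<nu> p = (\<integral>z. (exp (p \<bullet> z) - 1 - p \<bullet> z) \<partial>\<nu>)"

definition L0 :: "'a::real_inner measure \<Rightarrow> 'a \<Rightarrow> ereal" where
  "L0 \<nu> z = (SUP y. ereal (z \<bullet> y - H0 \<nu> y))"

text \<open>
  The state space is separable, so strong measurability is Borel measurability with respect to the
  Lebesgue sets of \<open>[t, T]\<close>.  The values of a control outside \<open>[t, T]\<close> are never used.
\<close>

definition controls :: "real \<Rightarrow> real \<Rightarrow> (real \<Rightarrow> 'a::{real_inner, banach, second_countable_topology}) set" where
  "controls T t = {u. set_borel_measurable lebesgue {t..T} u}"

definition mild_solution ::
    "(real \<Rightarrow> 'a \<Rightarrow>\<^sub>L 'a) \<Rightarrow> ('a \<Rightarrow> 'a) \<Rightarrow> ('a \<Rightarrow> 'a \<Rightarrow>\<^sub>L 'a) \<Rightarrow> real \<Rightarrow> real \<Rightarrow> 'a \<Rightarrow>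
     (real \<Rightarrow> 'a) \<Rightarrow> (real \<Rightarrow> 'a::{real_inner, banach, second_countable_topology}) \<Rightarrow> bool" where
  "mild_solution S F G T t x u X \<longleftrightarrow> continuous_on {t..T} X \<and>
     (\<forall>s\<in>{t..T}.
        set_integrable lebesgue {t..s} (\<lambda>\<tau>. S (s - \<tau>) (F (X \<tau>) + G (X \<tau>) (u \<tau>))) \<and>
        X s = S (s - t) x + (LINT \<tau>:{t..s}|lebesgue. S (s - \<tau>) (F (X \<tau>) + G (X \<tau>) (u \<tau>))))"

text \<open>Functions on \<open>[t, T]\<close> are made unique by the extensionality convention of \<open>FuncSet\<close>.\<close>

definition the_mild_solution ::
    "(real \<Rightarrow> 'a \<Rightarrow>\<^sub>L 'a) \<Rightarrow> ('a \<Rightarrow> 'a) \<Rightarrow> ('a \<Rightarrow> 'a \<Rightarrow>\<^sub>L 'a) \<Rightarrow> real \<Rightarrow> real \<Rightarrow> 'a \<Rightarrow>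
     (real \<Rightarrow> 'a) \<Rightarrow> real \<Rightarrow> 'a::{real_inner, banach, second_countable_topology}" where
  "the_mild_solution S F G T t x u =
     (THE X. X \<in> extensional {t..T} \<and> mild_solution S F G T t x u X)"

definition running_cost ::
    "'a::{real_inner, banach, second_countable_topology} measure \<Rightarrow> real \<Rightarrow> real \<Rightarrow> (real \<Rightarrow> 'a) \<Rightarrow> ennreal" where
  "running_cost \<nu> T t u = (\<integral>\<^sup>+s\<in>{t..T}. e2ennreal (L0 \<nu> (u s)) \<partial>lebesgue)"

definition payoff ::
    "'a measure \<Rightarrow> (real \<Rightarrow> 'a \<Rightarrow>\<^sub>L 'a) \<Rightarrow> ('a \<Rightarrow> 'a) \<Rightarrow> ('a \<Rightarrow> 'a \<Rightarrow>\<^sub>L 'a) \<Rightarrow> ('a \<Rightarrow> real) \<Rightarrow>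
     real \<Rightarrow> real \<Rightarrow> 'a \<Rightarrow> (real \<Rightarrow> 'a::{real_inner, banach, second_countable_topology}) \<Rightarrow> ereal" where
  "payoff \<nu> S F G g T t x u =
     (if running_cost \<nu> T t u = \<infinity> then - \<infinity>
      else ereal (- enn2real (running_cost \<nu> T t u) + g (the_mild_solution S F G T t x u T)))"

definition value_function ::
    "'a measure \<Rightarrow> (real \<Rightarrow> 'a \<Rightarrow>\<^sub>L 'a) \<Rightarrow> ('a \<Rightarrow> 'a) \<Rightarrow> ('a \<Rightarrow> 'a \<Rightarrow>\<^sub>L 'a) \<Rightarrow> ('a \<Rightarrow> real) \<Rightarrow>
     real \<Rightarrow> real \<Rightarrow> 'a::{real_inner, banach, second_countable_topology} \<Rightarrow> ereal" where
  "value_function \<nu> S F G g T t x = (SUP u\<in>controls T t. payoff \<nu> S F G g T t x u)"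

definition is_modulus :: "(real \<Rightarrow> real) \<Rightarrow> bool" where
  "is_modulus \<omega> \<longleftrightarrow> mono_on {0..} \<omega> \<and> continuous_on {0..} \<omega> \<and> (\<forall>r\<ge>0. 0 \<le> \<omega> r) \<and> \<omega> 0 = 0"

definition weakly_converges :: "(nat \<Rightarrow> 'a::real_inner) \<Rightarrow> 'a \<Rightarrow> bool" where
  "weakly_converges xs x \<longleftrightarrow> (\<forall>y. (\<lambda>k. xs k \<bullet> y) \<longlonglongrightarrow> x \<bullet> y)"

definition B_usc :: "('a::real_inner \<Rightarrow>\<^sub>L 'a) \<Rightarrow> (real \<times> 'a) set \<Rightarrow> (real \<times> 'a \<Rightarrow> real) \<Rightarrow> bool" where
  "B_usc B \<Omega> u \<longleftrightarrow> (\<forall>ts xs t x.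
     (\<forall>k. (ts k, xs k) \<in> \<Omega>) \<longrightarrow> (t, x) \<in> \<Omega> \<longrightarrow>
     ts \<longlonglongrightarrow> t \<longrightarrow> weakly_converges xs x \<longrightarrow> (\<lambda>k. B (xs k)) \<longlonglongrightarrow> B x \<longrightarrow>
     limsup (\<lambda>k. ereal (u (ts k, xs k))) \<le> ereal (u (t, x)))"

definition B_lsc :: "('a::real_inner \<Rightarrow>\<^sub>L 'a) \<Rightarrow> (real \<times> 'a) set \<Rightarrow> (real \<times> 'a \<Rightarrow> real) \<Rightarrow> bool" where
  "B_lsc B \<Omega> u \<longleftrightarrow> (\<forall>ts xs t x.
     (\<forall>k. (ts k, xs k) \<in> \<Omega>) \<longrightarrow> (t, x) \<in> \<Omega> \<longrightarrow>
     ts \<longlonglongrightarrow> t \<longrightarrow> weakly_converges xs x \<longrightarrow> (\<lambda>k. B (xs k)) \<longlonglongrightarrow> B x \<longrightarrow>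
     ereal (u (t, x)) \<le> liminf (\<lambda>k. ereal (u (ts k, xs k))))"

definition locally_bounded_on :: "'c::topological_space set \<Rightarrow> ('c \<Rightarrow> real) \<Rightarrow> bool" where
  "locally_bounded_on \<Omega> u \<longleftrightarrow> (\<forall>z\<in>\<Omega>. \<exists>U. open U \<and> z \<in> U \<and> bounded (u ` (U \<inter> \<Omega>)))"

definition time_deriv :: "(real \<times> 'a \<Rightarrow> real) \<Rightarrow> real \<times> 'a \<Rightarrow> real" where
  "time_deriv \<phi> = (\<lambda>(t, x). deriv (\<lambda>s. \<phi> (s, x)) t)"

definition space_grad :: "(real \<times> 'a::real_inner \<Rightarrow> real) \<Rightarrow> real \<times> 'a \<Rightarrow> 'a" where
  "space_grad \<phi> = (\<lambda>(t, x). THE p. GDERIV (\<lambda>y. \<phi> (t, y)) x :> p)"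

definition C1_on_cylinder :: "real \<Rightarrow> (real \<times> 'a::real_inner \<Rightarrow> real) \<Rightarrow> bool" where
  "C1_on_cylinder T \<phi> \<longleftrightarrow>
     (\<forall>z\<in>{0<..<T} \<times> UNIV. \<phi> differentiable (at z)) \<and>
     continuous_on ({0<..<T} \<times> UNIV) (time_deriv \<phi>) \<and>
     continuous_on ({0<..<T} \<times> UNIV) (space_grad \<phi>)"

definition test_phi ::
    "'a::real_inner set \<Rightarrow> ('a \<Rightarrow> 'a) \<Rightarrow> ('a \<Rightarrow>\<^sub>L 'a) \<Rightarrow> real \<Rightarrow> (real \<times> 'a \<Rightarrow> real) \<Rightarrow> bool" where
  "test_phi D A B T \<phi> \<longleftrightarrow>
     C1_on_cylinder T \<phi> \<and> B_lsc B ({0<..<T} \<times> UNIV) \<phi> \<and>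
     (\<forall>z\<in>{0<..<T} \<times> UNIV. space_grad \<phi> z \<in> adj_domain D A) \<and>
     (\<forall>\<epsilon>>0. uniformly_continuous_on ({\<epsilon>..T - \<epsilon>} \<times> UNIV) \<phi> \<and>
            uniformly_continuous_on ({\<epsilon>..T - \<epsilon>} \<times> UNIV) (time_deriv \<phi>) \<and>
            uniformly_continuous_on ({\<epsilon>..T - \<epsilon>} \<times> UNIV) (space_grad \<phi>) \<and>
            uniformly_continuous_on ({\<epsilon>..T - \<epsilon>} \<times> UNIV) (\<lambda>z. adj_op D A (space_grad \<phi> z)) \<and>
            (\<forall>r. bounded (\<phi> ` ({\<epsilon>..T - \<epsilon>} \<times> {x. norm_m1 B x \<le> r}))))"

definition test_h :: "(real \<Rightarrow> real) \<Rightarrow> bool" where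
  "test_h h \<longleftrightarrow> (\<exists>h'.
     (\<forall>r\<ge>0. (h has_real_derivative h' r) (at r within {0..})) \<and> continuous_on {0..} h' \<and>
     h' 0 = 0 \<and> (\<forall>r>0. 0 \<le> h' r) \<and>
     uniformly_continuous_on {0..} h \<and> uniformly_continuous_on {0..} h')"

definition viscosity_subsolution ::
    "'a set \<Rightarrow> ('a \<Rightarrow> 'a) \<Rightarrow> ('a \<Rightarrow>\<^sub>L 'a) \<Rightarrow> 'a measure \<Rightarrow> ('a \<Rightarrow> 'a) \<Rightarrow> ('a \<Rightarrow> 'a \<Rightarrow>\<^sub>L 'a) \<Rightarrow>
     real \<Rightarrow> (real \<times> 'a::real_inner \<Rightarrow> real) \<Rightarrow> bool" where
  "viscosity_subsolution D A B \<nu> F G T u \<longleftrightarrow>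
     locally_bounded_on ({0<..<T} \<times> UNIV) u \<and> B_usc B ({0<..<T} \<times> UNIV) u \<and>
     (\<forall>\<phi> h t x. test_phi D A B T \<phi> \<longrightarrow> test_h h \<longrightarrow> t \<in> {0<..<T} \<longrightarrow>
        (\<forall>s\<in>{0<..<T}. \<forall>y. u (s, y) - \<phi> (s, y) - h (norm y) \<le> u (t, x) - \<phi> (t, x) - h (norm x)) \<longrightarrow>
        (let \<psi> = (\<lambda>(s, y). \<phi> (s, y) + h (norm y)) in
           time_deriv \<psi> (t, x) - x \<bullet> adj_op D A (space_grad \<phi> (t, x))
           + F x \<bullet> space_grad \<psi> (t, x)
           + H0 \<nu> (adjoint (blinfun_apply (G x)) (space_grad \<psi> (t, x))) \<ge> 0))"

definition viscosity_supersolution ::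
    "'a set \<Rightarrow> ('a \<Rightarrow> 'a) \<Rightarrow> ('a \<Rightarrow>\<^sub>L 'a) \<Rightarrow> 'a measure \<Rightarrow> ('a \<Rightarrow> 'a) \<Rightarrow> ('a \<Rightarrow> 'a \<Rightarrow>\<^sub>L 'a) \<Rightarrow>
     real \<Rightarrow> (real \<times> 'a::real_inner \<Rightarrow> real) \<Rightarrow> bool" where
  "viscosity_supersolution D A B \<nu> F G T u \<longleftrightarrow>
     locally_bounded_on ({0<..<T} \<times> UNIV) u \<and> B_lsc B ({0<..<T} \<times> UNIV) u \<and>
     (\<forall>\<phi> h t x. test_phi D A B T \<phi> \<longrightarrow> test_h h \<longrightarrow> t \<in> {0<..<T} \<longrightarrow>
        (\<forall>s\<in>{0<..<T}. \<forall>y. u (t, x) + \<phi> (t, x) + h (norm x) \<le> u (s, y) + \<phi> (s, y) + h (norm y)) \<longrightarrow>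
        (let \<psi> = (\<lambda>(s, y). - \<phi> (s, y) - h (norm y)) in
           time_deriv \<psi> (t, x) + x \<bullet> adj_op D A (space_grad \<phi> (t, x))
           + F x \<bullet> space_grad \<psi> (t, x)
           + H0 \<nu> (adjoint (blinfun_apply (G x)) (space_grad \<psi> (t, x))) \<le> 0))"

definition viscosity_solution ::
    "'a set \<Rightarrow> ('a \<Rightarrow> 'a) \<Rightarrow> ('a \<Rightarrow>\<^sub>L 'a) \<Rightarrow> 'a measure \<Rightarrow> ('a \<Rightarrow> 'a) \<Rightarrow> ('a \<Rightarrow> 'a \<Rightarrow>\<^sub>L 'a) \<Rightarrow>
     real \<Rightarrow> (real \<times> 'a::real_inner \<Rightarrow> real) \<Rightarrow> bool" where
  "viscosity_solution D A B \<nu> F G T u \<longleftrightarrow>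
     viscosity_subsolution D A B \<nu> F G T u \<and> viscosity_supersolution D A B \<nu> F G T u"

end

theory Submission
  imports Defs
begin

text \<open>
  Since \<open>L0\<close> dominates \<open>R |u| - C\<^sub>R\<close> for every \<open>R\<close>, near-optimal controls are uniformly integrable.  Together
  with the weak \<open>B\<close>-condition, which gives \<open>|S(r)x|\<^sub>-\<^sub>1 \<le> e\<^bsup>c0 r\<^esup> |x|\<^sub>-\<^sub>1\<close> and
  \<open>|S(r)x - x|\<^sub>-\<^sub>1 = O(r\<^bsup>1/2\<^esup>)\<close> on bounded sets, and with Gronwall's inequality for an integrable kernel this yields
  the modulus of continuity of the value function.

  For the viscosity property a single short time step suffices.  The mean value theorem replaces
  \<open>\<phi>(t + \<epsilon>, X(t + \<epsilon>)) - \<phi>(t, x)\<close> by a pairing with a gradient \<open>q\<close> in the domain of \<open>A\<^sup>*\<close>, for which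
  \<open>\<langle>S(\<epsilon>)x - x, q\<rangle>\<close> is of order \<open>\<epsilon>\<close> for every \<open>x\<close>; contractivity of the semigroup takes care of the radial part.
  Then Fenchel's inequality \<open>\<langle>u, w\<rangle> \<le> L0(u) + H0(w)\<close>, applied pointwise along a near-optimal control, gives the
  subsolution inequality, and the constant control \<open>\<nabla>H0(p)\<close>, for which it is an equality, gives the
  supersolution inequality.
\<close>

subsection \<open>Operators on real Hilbert spaces\<close>

lemma Cauchy_of_near_minimal_norm:
  fixes X :: "nat \<Rightarrow> 'a::real_inner"
  assumes "convex C" and in_C: "\<And>n. X n \<in> C"
    and lower: "\<And>y. y \<in> C \<Longrightarrow> m \<le> (norm y)\<^sup>2"
    and near: "\<And>n. (norm (X n))\<^sup>2 < m + inverse (real (Suc n))"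
  shows "Cauchy X"
proof (rule metric_CauchyI)
  fix e :: real assume "e > 0"
  then obtain N where N: "inverse (real (Suc N)) < e\<^sup>2 / 4"
    using reals_Archimedean[of "e\<^sup>2 / 4"] by auto
  have "dist (X i) (X j) < e" if "N \<le> i" "N \<le> j" for i j
  proof -
    have "(1/2) *\<^sub>R X i + (1/2) *\<^sub>R X j \<in> C"
      using \<open>convex C\<close> in_C by (intro convexD) auto
    from lower[OF this] have "4 * m \<le> (norm (X i + X j))\<^sup>2"
      by (simp add: power_divide flip: scaleR_add_right)
    moreover have "(norm (X i - X j))\<^sup>2 + (norm (X i + X j))\<^sup>2 = 2 * (norm (X i))\<^sup>2 + 2 * (norm (X j))\<^sup>2"
      by (simp add: power2_norm_eq_inner inner_simps inner_commute)
    moreover have "inverse (real (Suc i)) \<le> inverse (real (Suc N))" "inverse (real (Suc j)) \<le> inverse (real (Suc N))"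
      using that by (simp_all add: field_simps)
    ultimately have "(norm (X i - X j))\<^sup>2 < e\<^sup>2"
      using near[of i] near[of j] N by linarith
    then show ?thesis
      using \<open>e > 0\<close> by (simp add: dist_norm power_less_imp_less_base)
  qed
  then show "\<exists>N. \<forall>i\<ge>N. \<forall>j\<ge>N. dist (X i) (X j) < e" by blast
qed

lemma closed_convex_minimal_norm:
  fixes C :: "'a::{real_inner, banach} set"
  assumes "closed C" "convex C" "C \<noteq> {}"
  obtains x where "x \<in> C" "\<And>y. y \<in> C \<Longrightarrow> norm x \<le> norm y"
proof -
  define m where "m = (INF y\<in>C. (norm y)\<^sup>2)"
  have bdd: "bdd_below ((\<lambda>y. (norm y)\<^sup>2) ` C)" by (intro bdd_belowI[of _ 0]) auto
  have lower: "m \<le> (norm y)\<^sup>2" if "y \<in> C" for y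
    unfolding m_def using that bdd by (intro cINF_lower)
  have "\<exists>y\<in>C. (norm y)\<^sup>2 < m + inverse (real (Suc n))" for n
    using cINF_less_iff[OF \<open>C \<noteq> {}\<close> bdd, of "m + inverse (real (Suc n))"] by (simp add: m_def)
  then obtain X where X: "\<And>n. X n \<in> C" "\<And>n. (norm (X n))\<^sup>2 < m + inverse (real (Suc n))" by metis
  then obtain x where lim: "X \<longlonglongrightarrow> x"
    using Cauchy_of_near_minimal_norm[OF \<open>convex C\<close> _ lower] Cauchy_convergent convergent_def by blast
  have lim_le: "(norm x)\<^sup>2 \<le> m"
  proof (rule LIMSEQ_le)
    show "(\<lambda>n. (norm (X n))\<^sup>2) \<longlonglongrightarrow> (norm x)\<^sup>2" by (intro tendsto_intros lim)
    show "(\<lambda>n. m + inverse (real (Suc n))) \<longlonglongrightarrow> m" by (rule LIMSEQ_inverse_real_of_nat_add)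
  qed (use X(2) less_imp_le in blast)
  have "norm x \<le> norm y" if "y \<in> C" for y
    using order_trans[OF lim_le lower[OF that]] by (rule power2_le_imp_le) simp
  moreover have "x \<in> C" using \<open>closed C\<close> X(1) lim by (rule closed_sequentially)
  ultimately show ?thesis using that by blast
qed

lemma inner_eq_0_of_minimal_norm:
  fixes x y :: "'a::real_inner"
  assumes "\<And>s. norm x \<le> norm (x - s *\<^sub>R y)"
  shows "x \<bullet> y = 0"
proof (cases "y = 0")
  case False
  define s where "s = (x \<bullet> y) / (y \<bullet> y)"
  have "(norm x)\<^sup>2 \<le> (norm (x - s *\<^sub>R y))\<^sup>2" by (intro power_mono assms) simp
  also have "\<dots> = (norm x)\<^sup>2 - (x \<bullet> y)\<^sup>2 / (y \<bullet> y)"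
    using False unfolding s_def
    by (simp add: power2_norm_eq_inner inner_simps inner_commute) (simp add: field_simps power2_eq_square)
  finally have "(x \<bullet> y)\<^sup>2 / (y \<bullet> y) \<le> 0" by simp
  moreover have "0 < y \<bullet> y" using False by simp
  ultimately show ?thesis by (simp add: divide_le_0_iff)
qed simp

lemma Riesz_representation:
  fixes f :: "'a::{real_inner, banach} \<Rightarrow> real"
  assumes "bounded_linear f"
  shows "\<exists>p. \<forall>x. f x = x \<bullet> p"
proof (cases "\<forall>x. f x = 0")
  case True
  then show ?thesis by (intro exI[of _ 0]) simp
next
  case False
  interpret bounded_linear f by fact
  define V where "V = {x. f x = 1}"
  obtain z where "f z \<noteq> 0" using False by blast
  then have "z /\<^sub>R f z \<in> V" by (simp add: V_def scaleR)
  moreover have "closed V"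
    unfolding V_def by (intro closed_Collect_eq continuous_on continuous_intros)
  moreover have "convex V"
    unfolding convex_def V_def by (simp add: add scaleR)
  ultimately obtain x where x: "x \<in> V" and minimal: "\<And>y. y \<in> V \<Longrightarrow> norm x \<le> norm y"
    using closed_convex_minimal_norm by blast
  have orthogonal: "x \<bullet> y = 0" if "f y = 0" for y
    using x that by (intro inner_eq_0_of_minimal_norm minimal) (simp add: V_def diff scaleR)
  have "f y = y \<bullet> (x /\<^sub>R (x \<bullet> x))" for y
  proof -
    have "x \<bullet> (y - f y *\<^sub>R x) = 0" using x by (intro orthogonal) (simp add: V_def diff scaleR)
    moreover have "x \<noteq> 0" using x zero by (auto simp: V_def)
    ultimately show ?thesis by (simp add: inner_simps inner_commute field_simps)
  qed
  then show ?thesis by blast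
qed

lemma inner_adjoint_blinfun:
  fixes L :: "'a::{real_inner, banach} \<Rightarrow>\<^sub>L 'b::real_inner"
  shows "x \<bullet> adjoint L y = L x \<bullet> y"
proof -
  have "\<exists>p. \<forall>x. L x \<bullet> y = x \<bullet> p" for y
    by (intro Riesz_representation bounded_linear_compose[OF bounded_linear_inner_left] blinfun.bounded_linear_right)
  then obtain f where f: "\<And>x y. L x \<bullet> y = x \<bullet> f y" by metis
  then have "adjoint L = f" by (intro adjoint_unique) simp
  then show ?thesis using f by simp
qed

lemma norm_adjoint_blinfun_le:
  fixes L :: "'a::{real_inner, banach} \<Rightarrow>\<^sub>L 'b::real_inner"
  shows "norm (adjoint L y) \<le> norm L * norm y"
proof -
  let ?a = "adjoint L y"
  have "norm ?a * norm ?a = L ?a \<bullet> y"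
    by (metis inner_adjoint_blinfun power2_eq_square power2_norm_eq_inner)
  also have "\<dots> \<le> norm (L ?a) * norm y" by (rule norm_cauchy_schwarz)
  also have "\<dots> \<le> norm L * norm ?a * norm y" by (intro mult_right_mono norm_blinfun) simp
  finally have "norm ?a * norm ?a \<le> (norm L * norm y) * norm ?a" by (simp add: mult_ac)
  then show ?thesis by (cases "norm ?a = 0") (auto simp: mult_le_cancel_right)
qed

lemma adjoint_blinfun_diff_right:
  fixes L :: "'a::{real_inner, banach} \<Rightarrow>\<^sub>L 'b::real_inner"
  shows "adjoint L (x - y) = adjoint L x - adjoint L y"
  by (subst vector_eq_ldot[symmetric]) (simp add: inner_adjoint_blinfun inner_diff_right)

lemma adjoint_blinfun_diff_left:
  fixes K L :: "'a::{real_inner, banach} \<Rightarrow>\<^sub>L 'b::real_inner"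
  shows "adjoint (K - L) y = adjoint K y - adjoint L y"
  by (subst vector_eq_ldot[symmetric])
     (simp add: inner_adjoint_blinfun inner_diff_right inner_diff_left blinfun.diff_left)

lemma adj_op_eq:
  assumes "closure D = UNIV" "w \<in> adj_domain D A" "x \<in> D"
  shows "A x \<bullet> w = x \<bullet> adj_op D A w"
proof -
  obtain z where z: "\<forall>x\<in>D. A x \<bullet> w = x \<bullet> z" using assms(2) by (auto simp: adj_domain_def)
  have "z' = z" if "\<forall>x\<in>D. A x \<bullet> w = x \<bullet> z'" for z'
  proof -
    have "D \<subseteq> {y. y \<bullet> z' = y \<bullet> z}" using z that by auto
    moreover have "closed {y. y \<bullet> z' = y \<bullet> z}" by (intro closed_Collect_eq continuous_intros)
    ultimately have "closure D \<subseteq> {y. y \<bullet> z' = y \<bullet> z}" by (rule closure_minimal)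
    then have "\<forall>y. y \<bullet> z' = y \<bullet> z" using assms(1) by auto
    then show "z' = z" by (simp only: vector_eq_ldot)
  qed
  with z have "\<forall>x\<in>D. A x \<bullet> w = x \<bullet> adj_op D A w"
    unfolding adj_op_def by (rule theI)
  then show ?thesis using assms(3) by blast
qed

lemma inner_blinfun_apply_le:
  fixes L :: "'a::real_inner \<Rightarrow>\<^sub>L 'a"
  shows "L x \<bullet> x \<le> norm L * (x \<bullet> x)"
proof -
  have "L x \<bullet> x \<le> norm L * norm x * norm x"
    by (rule order_trans[OF norm_cauchy_schwarz]) (intro mult_right_mono norm_blinfun; simp)
  then show ?thesis by (simp add: dot_square_norm power2_eq_square mult.assoc)
qed

definition psd_op :: "('a::real_inner \<Rightarrow>\<^sub>L 'a) \<Rightarrow> bool" where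
  "psd_op R \<longleftrightarrow> self_adjoint R \<and> (\<forall>x. 0 \<le> R x \<bullet> x)"

lemma discriminant_le_of_nonneg_quadratic:
  fixes a b c :: real
  assumes "\<And>s. 0 \<le> a - 2 * s * b + s\<^sup>2 * c" "0 \<le> c"
  shows "b\<^sup>2 \<le> a * c"
proof (cases "c = 0")
  case True
  have "b = 0"
  proof (rule ccontr)
    assume "b \<noteq> 0"
    then show False using assms(1)[of "(a + 1) / (2 * b)"] True by simp
  qed
  then show ?thesis using True by simp
next
  case False
  then have "0 \<le> c * (a - 2 * (b / c) * b + (b / c)\<^sup>2 * c)"
    using assms(2) by (intro mult_nonneg_nonneg assms(1))
  also have "\<dots> = a * c - b\<^sup>2" using False by (simp add: power2_eq_square field_simps)
  finally show ?thesis by simp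
qed

lemma psd_op_Cauchy_Schwarz:
  assumes "psd_op R"
  shows "(R x \<bullet> y)\<^sup>2 \<le> (R x \<bullet> x) * (R y \<bullet> y)"
proof (rule discriminant_le_of_nonneg_quadratic)
  show "0 \<le> R y \<bullet> y" using assms by (simp add: psd_op_def)
  fix s :: real
  have "R y \<bullet> x = R x \<bullet> y" using assms by (simp add: psd_op_def self_adjoint_def inner_commute)
  then have "R (x - s *\<^sub>R y) \<bullet> (x - s *\<^sub>R y) = R x \<bullet> x - 2 * s * (R x \<bullet> y) + s\<^sup>2 * (R y \<bullet> y)"
    by (simp add: blinfun.diff_right blinfun.scaleR_right inner_simps power2_eq_square algebra_simps)
  then show "0 \<le> R x \<bullet> x - 2 * s * (R x \<bullet> y) + s\<^sup>2 * (R y \<bullet> y)"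
    using assms by (metis psd_op_def)
qed

lemma psd_op_apply_eq_0:
  assumes "psd_op R" "R x \<bullet> x = 0"
  shows "R x = 0"
  using psd_op_Cauchy_Schwarz[OF assms(1), of x "R x"] assms(2) by simp

lemma norm_psd_op_le_1:
  assumes "psd_op R" "\<And>x. R x \<bullet> x \<le> x \<bullet> x"
  shows "norm R \<le> 1"
proof (rule norm_blinfun_bound)
  fix x
  have "(R x \<bullet> R x) * (R x \<bullet> R x) \<le> (R x \<bullet> x) * (R (R x) \<bullet> R x)"
    using psd_op_Cauchy_Schwarz[OF assms(1), of x "R x"] by (simp add: power2_eq_square)
  also have "\<dots> \<le> (x \<bullet> x) * (R x \<bullet> R x)"
    using assms by (intro mult_mono) (auto simp: psd_op_def)
  finally have "R x \<bullet> R x \<le> x \<bullet> x"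
    by (cases "R x = 0") (auto simp: mult_le_cancel_right)
  then show "norm (R x) \<le> 1 * norm x" by (simp add: norm_le)
qed simp

text \<open>A root of \<open>1 - Q\<close> is \<open>1 - Y\<close> where \<open>Y = (Q + Y\<^sup>2) / 2\<close>; the iteration for \<open>Y\<close> is
  majorised by the same iteration for the number \<open>1\<close>, hence converges in operator norm.\<close>

primrec sqrt_iter :: "('a::real_normed_vector \<Rightarrow>\<^sub>L 'a) \<Rightarrow> nat \<Rightarrow> 'a \<Rightarrow>\<^sub>L 'a" where
  "sqrt_iter Q 0 = 0"
| "sqrt_iter Q (Suc n) = (1/2) *\<^sub>R (Q + (sqrt_iter Q n o\<^sub>L sqrt_iter Q n))"

primrec sqrt_iter_real :: "nat \<Rightarrow> real" where
  "sqrt_iter_real 0 = 0"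
| "sqrt_iter_real (Suc n) = (1 + sqrt_iter_real n * sqrt_iter_real n) / 2"

lemma sqrt_iter_real_bounds: "0 \<le> sqrt_iter_real n \<and> sqrt_iter_real n \<le> 1"
proof (induction n)
  case (Suc n)
  then have "sqrt_iter_real n * sqrt_iter_real n \<le> 1 * 1" by (intro mult_mono) auto
  then show ?case using Suc by simp
qed simp

lemma incseq_sqrt_iter_real: "incseq sqrt_iter_real"
proof (rule incseq_SucI)
  fix n
  have "0 \<le> (1 - sqrt_iter_real n) * (1 - sqrt_iter_real n)" by simp
  then show "sqrt_iter_real n \<le> sqrt_iter_real (Suc n)" by (simp add: algebra_simps)
qed

lemma norm_sqrt_iter_le:
  assumes "norm Q \<le> 1"
  shows "norm (sqrt_iter Q n) \<le> sqrt_iter_real n"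
proof (induction n)
  case (Suc n)
  have "norm (Q + (sqrt_iter Q n o\<^sub>L sqrt_iter Q n)) \<le> 1 + sqrt_iter_real n * sqrt_iter_real n"
    by (intro norm_triangle_mono assms order_trans[OF norm_blinfun_compose] mult_mono Suc)
       (use sqrt_iter_real_bounds in auto)
  then show ?case by simp
qed simp

lemma norm_sqrt_iter_Suc_diff_le:
  assumes "norm Q \<le> 1"
  shows "norm (sqrt_iter Q (Suc n) - sqrt_iter Q n) \<le> sqrt_iter_real (Suc n) - sqrt_iter_real n"
proof (induction n)
  case 0
  then show ?case using assms by simp
next
  case (Suc n)
  let ?Y = "sqrt_iter Q" and ?y = "sqrt_iter_real"
  let ?\<Delta> = "?Y (Suc n) - ?Y n"
  have "?Y (Suc (Suc n)) - ?Y (Suc n)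
      = (1/2) *\<^sub>R (Q + (?Y (Suc n) o\<^sub>L ?Y (Suc n))) - (1/2) *\<^sub>R (Q + (?Y n o\<^sub>L ?Y n))"
    by (simp only: sqrt_iter.simps(2))
  also have "\<dots> = (1/2) *\<^sub>R ((?Y (Suc n) o\<^sub>L ?\<Delta>) + (?\<Delta> o\<^sub>L ?Y n))"
    by (rule blinfun_eqI)
       (simp del: sqrt_iter.simps add: blinfun.add_left blinfun.diff_left blinfun.diff_right
         blinfun.scaleR_left flip: scaleR_diff_right scaleR_add_right)
  finally have factored: "?Y (Suc (Suc n)) - ?Y (Suc n)
      = (1/2) *\<^sub>R ((?Y (Suc n) o\<^sub>L ?\<Delta>) + (?\<Delta> o\<^sub>L ?Y n))" .
  have "norm ((?Y (Suc n) o\<^sub>L ?\<Delta>) + (?\<Delta> o\<^sub>L ?Y n))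
      \<le> ?y (Suc n) * (?y (Suc n) - ?y n) + (?y (Suc n) - ?y n) * ?y n"
    by (intro norm_triangle_mono order_trans[OF norm_blinfun_compose] mult_mono Suc norm_sqrt_iter_le assms)
       (use sqrt_iter_real_bounds[of n] sqrt_iter_real_bounds[of "Suc n"]
         incseq_SucD[OF incseq_sqrt_iter_real, of n] in auto)
  then have "norm (?Y (Suc (Suc n)) - ?Y (Suc n))
      \<le> (?y (Suc n) * (?y (Suc n) - ?y n) + (?y (Suc n) - ?y n) * ?y n) / 2"
    unfolding factored by simp
  also have "\<dots> = (1 + ?y (Suc n) * ?y (Suc n)) / 2 - (1 + ?y n * ?y n) / 2"
    by (simp add: field_simps del: sqrt_iter_real.simps)
  also have "\<dots> = ?y (Suc (Suc n)) - ?y (Suc n)" by simp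
  finally show ?case .
qed

lemma convergent_sqrt_iter:
  fixes Q :: "'a::banach \<Rightarrow>\<^sub>L 'a"
  assumes "norm Q \<le> 1"
  shows "convergent (sqrt_iter Q)"
proof -
  have "convergent sqrt_iter_real"
    using sqrt_iter_real_bounds incseq_sqrt_iter_real
    by (intro Bseq_monoseq_convergent BseqI'[of _ 1]) (auto simp: incseq_imp_monoseq)
  then have "summable (\<lambda>n. sqrt_iter_real (Suc n) - sqrt_iter_real n)"
    by (metis convergent_def sums_summable telescope_sums)
  then have "summable (\<lambda>n. sqrt_iter Q (Suc n) - sqrt_iter Q n)"
    by (rule summable_comparison_test') (rule norm_sqrt_iter_Suc_diff_le[OF assms])
  then have "convergent (\<lambda>n. \<Sum>i<n. sqrt_iter Q (Suc i) - sqrt_iter Q i)"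
    by (simp add: summable_iff_convergent)
  then show ?thesis by (simp only: sum_lessThan_telescope) simp
qed

lemma self_adjoint_sqrt_iter:
  assumes "self_adjoint Q"
  shows "self_adjoint (sqrt_iter Q n)"
  by (induction n)
     (use assms in \<open>auto simp: self_adjoint_def blinfun.scaleR_left blinfun.add_left inner_simps\<close>)

lemma sqrt_iter_commute:
  fixes C Q :: "'a::real_normed_vector \<Rightarrow>\<^sub>L 'a"
  assumes "\<And>x. C (Q x) = Q (C x)"
  shows "C (sqrt_iter Q n x) = sqrt_iter Q n (C x)"
  by (induction n arbitrary: x)
     (simp_all add: assms blinfun.scaleR_left blinfun.scaleR_right blinfun.add_left blinfun.add_right)

lemma self_adjoint_quadratic_fixpoint:
  fixes Q :: "'a::{real_inner, banach} \<Rightarrow>\<^sub>L 'a"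
  assumes "self_adjoint Q" "norm Q \<le> 1"
  obtains Y where "self_adjoint Y" "norm Y \<le> 1" "\<And>x. 2 *\<^sub>R Y x = Q x + Y (Y x)"
    "\<And>C :: 'a \<Rightarrow>\<^sub>L 'a. (\<And>x. C (Q x) = Q (C x)) \<Longrightarrow> (\<And>x. C (Y x) = Y (C x))"
proof -
  obtain Y where lim: "sqrt_iter Q \<longlonglongrightarrow> Y"
    using convergent_sqrt_iter[OF assms(2)] by (auto simp: convergent_def)
  have lim_app: "(\<lambda>n. sqrt_iter Q n x) \<longlonglongrightarrow> Y x" for x
    by (rule blinfun.tendsto[OF lim tendsto_const])
  have "self_adjoint Y"
    unfolding self_adjoint_def
  proof (intro allI)
    fix x y
    have "(\<lambda>n. sqrt_iter Q n x \<bullet> y) \<longlonglongrightarrow> Y x \<bullet> y" by (intro tendsto_intros lim_app)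
    moreover have "(\<lambda>n. x \<bullet> sqrt_iter Q n y) \<longlonglongrightarrow> x \<bullet> Y y" by (intro tendsto_intros lim_app)
    ultimately show "Y x \<bullet> y = x \<bullet> Y y"
      using self_adjoint_sqrt_iter[OF assms(1)] by (simp add: self_adjoint_def LIMSEQ_unique)
  qed
  moreover have "norm Y \<le> 1"
    by (rule LIMSEQ_le_const2[OF tendsto_norm[OF lim]])
       (use norm_sqrt_iter_le[OF assms(2)] sqrt_iter_real_bounds in \<open>meson order_trans\<close>)
  moreover have "2 *\<^sub>R Y x = Q x + Y (Y x)" for x
  proof (rule LIMSEQ_unique)
    show "(\<lambda>n. 2 *\<^sub>R sqrt_iter Q (Suc n) x) \<longlonglongrightarrow> 2 *\<^sub>R Y x"
      by (intro tendsto_intros LIMSEQ_Suc[OF lim_app])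
    show "(\<lambda>n. 2 *\<^sub>R sqrt_iter Q (Suc n) x) \<longlonglongrightarrow> Q x + Y (Y x)"
      by (simp add: blinfun.add_left blinfun.scaleR_left) (intro tendsto_intros blinfun.tendsto lim lim_app)
  qed
  moreover have "C (Y x) = Y (C x)" if "\<And>x. C (Q x) = Q (C x)" for C :: "'a \<Rightarrow>\<^sub>L 'a" and x
  proof (rule LIMSEQ_unique)
    show "(\<lambda>n. C (sqrt_iter Q n x)) \<longlonglongrightarrow> C (Y x)" by (intro tendsto_intros lim_app)
    show "(\<lambda>n. C (sqrt_iter Q n x)) \<longlonglongrightarrow> Y (C x)"
      unfolding sqrt_iter_commute[OF that] by (rule lim_app)
  qed
  ultimately show ?thesis using that by blast
qed

lemma psd_op_sqrt_exists:
  fixes B :: "'a::{real_inner, banach} \<Rightarrow>\<^sub>L 'a"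
  assumes "psd_op B"
  obtains R where "psd_op R" "R o\<^sub>L R = B" "\<And>C. C o\<^sub>L B = B o\<^sub>L C \<Longrightarrow> C o\<^sub>L R = R o\<^sub>L C"
proof -
  define b where "b = norm B + 1"
  have b: "b > 0" by (simp add: b_def add_nonneg_pos)
  define Q where "Q = id_blinfun - (1/b) *\<^sub>R B"
  have Q_app: "Q x = x - (1/b) *\<^sub>R B x" for x
    by (simp add: Q_def blinfun.diff_left blinfun.scaleR_left)
  have B_le: "B x \<bullet> x \<le> b * (x \<bullet> x)" for x
    by (rule order_trans[OF inner_blinfun_apply_le]) (simp add: b_def mult_right_mono)
  have psd_Q: "psd_op Q"
    using assms B_le b by (auto simp: psd_op_def self_adjoint_def Q_app inner_simps field_simps)
  have "norm Q \<le> 1"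
    using assms b by (intro norm_psd_op_le_1 psd_Q) (auto simp: psd_op_def Q_app inner_simps)
  then obtain Y where Y: "self_adjoint Y" "norm Y \<le> 1" "\<And>x. 2 *\<^sub>R Y x = Q x + Y (Y x)"
    and Y_commute: "\<And>(C :: 'a \<Rightarrow>\<^sub>L 'a) x. (\<And>x. C (Q x) = Q (C x)) \<Longrightarrow> C (Y x) = Y (C x)"
    using self_adjoint_quadratic_fixpoint psd_Q unfolding psd_op_def by metis
  define R where "R = sqrt b *\<^sub>R (id_blinfun - Y)"
  have R_app: "R x = sqrt b *\<^sub>R (x - Y x)" for x
    by (simp add: R_def blinfun.diff_left blinfun.scaleR_left)
  have "Y x \<bullet> x \<le> x \<bullet> x" for x
    using inner_blinfun_apply_le[of Y x] mult_right_mono[OF Y(2), of "x \<bullet> x"] by simp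
  then have "psd_op R"
    using Y(1) b by (auto simp: psd_op_def self_adjoint_def R_app inner_simps)
  moreover have "R o\<^sub>L R = B"
  proof (rule blinfun_eqI)
    fix x
    have "(R o\<^sub>L R) x = b *\<^sub>R (x - 2 *\<^sub>R Y x + Y (Y x))"
      using b by (simp add: R_app blinfun.scaleR_right blinfun.diff_right scaleR_2 algebra_simps)
    also have "\<dots> = B x" using b by (simp add: Y(3) Q_app)
    finally show "(R o\<^sub>L R) x = B x" .
  qed
  moreover have "C o\<^sub>L R = R o\<^sub>L C" if "C o\<^sub>L B = B o\<^sub>L C" for C :: "'a \<Rightarrow>\<^sub>L 'a"
  proof -
    have "C (B x) = B (C x)" for x using that by (metis blinfun_apply_blinfun_compose)
    then have "C (Y x) = Y (C x)" for x
      by (intro Y_commute) (simp add: Q_app blinfun.diff_right blinfun.scaleR_right)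
    then show ?thesis
      by (intro blinfun_eqI) (simp add: R_app blinfun.diff_right blinfun.scaleR_right)
  qed
  ultimately show ?thesis using that by blast
qed

lemma psd_op_sqrt_unique:
  assumes psd: "psd_op R" "psd_op U" and squares: "U o\<^sub>L U = R o\<^sub>L R" and commute: "U o\<^sub>L R = R o\<^sub>L U"
  shows "U = R"
proof (rule blinfun_eqI)
  fix x
  have UU: "U (U z) = R (R z)" and UR: "U (R z) = R (U z)" for z
    using arg_cong[OF squares, of "\<lambda>L. L z"] arg_cong[OF commute, of "\<lambda>L. L z"] by simp_all
  define y where "y = R x - U x"
  have "R y + U y = 0" by (simp add: y_def blinfun.diff_right UU UR)
  then have "R y \<bullet> y + U y \<bullet> y = 0" by (metis inner_add_left inner_zero_left)
  moreover have "0 \<le> R y \<bullet> y" "0 \<le> U y \<bullet> y" using psd by (auto simp: psd_op_def)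
  ultimately have "R y \<bullet> y = 0" "U y \<bullet> y = 0" by linarith+
  then have "R y = 0" "U y = 0" using psd psd_op_apply_eq_0 by blast+
  moreover have "y \<bullet> y = x \<bullet> R y - x \<bullet> U y"
    unfolding y_def using psd
    by (simp add: psd_op_def self_adjoint_def blinfun.diff_right inner_diff_left inner_diff_right UR)
  ultimately show "U x = R x" by (simp add: y_def)
qed

lemma sqrt_op:
  fixes B :: "'a::{real_inner, banach} \<Rightarrow>\<^sub>L 'a"
  assumes "psd_op B"
  shows "psd_op (sqrt_op B)" "sqrt_op B o\<^sub>L sqrt_op B = B"
proof -
  obtain R where R: "psd_op R" "R o\<^sub>L R = B" and commute: "\<And>C. C o\<^sub>L B = B o\<^sub>L C \<Longrightarrow> C o\<^sub>L R = R o\<^sub>L C"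
    using psd_op_sqrt_exists[OF assms] by metis
  have unique: "U = R" if "self_adjoint U \<and> (\<forall>x. 0 \<le> U x \<bullet> x) \<and> U o\<^sub>L U = B" for U
  proof (rule psd_op_sqrt_unique[OF R(1)])
    show "psd_op U" using that by (simp add: psd_op_def)
    show "U o\<^sub>L U = R o\<^sub>L R" using that R(2) by simp
    have "U o\<^sub>L B = B o\<^sub>L U" by (rule blinfun_eqI) (simp flip: that[THEN conjunct2, THEN conjunct2])
    then show "U o\<^sub>L R = R o\<^sub>L U" by (rule commute)
  qed
  have "self_adjoint R \<and> (\<forall>x. 0 \<le> R x \<bullet> x) \<and> R o\<^sub>L R = B" using R by (simp add: psd_op_def)
  from theI[of "\<lambda>R. self_adjoint R \<and> (\<forall>x. 0 \<le> R x \<bullet> x) \<and> R o\<^sub>L R = B", OF this unique]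
  have "self_adjoint (sqrt_op B) \<and> (\<forall>x. 0 \<le> sqrt_op B x \<bullet> x) \<and> sqrt_op B o\<^sub>L sqrt_op B = B"
    unfolding sqrt_op_def .
  then show "psd_op (sqrt_op B)" "sqrt_op B o\<^sub>L sqrt_op B = B" by (auto simp: psd_op_def)
qed

lemma norm_m1_power2:
  fixes B :: "'a::{real_inner, banach} \<Rightarrow>\<^sub>L 'a"
  assumes "psd_op B"
  shows "(norm_m1 B x)\<^sup>2 = B x \<bullet> x"
proof -
  have "(norm_m1 B x)\<^sup>2 = sqrt_op B (sqrt_op B x) \<bullet> x"
    using sqrt_op(1)[OF assms] by (simp add: norm_m1_def power2_norm_eq_inner psd_op_def self_adjoint_def)
  then show ?thesis using sqrt_op(2)[OF assms] by (simp flip: blinfun_apply_blinfun_compose)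
qed

lemma norm_m1_nonneg [simp]: "0 \<le> norm_m1 B x"
  by (simp add: norm_m1_def)

lemma norm_m1_le: "norm_m1 B x \<le> norm (sqrt_op B) * norm x"
  by (simp add: norm_m1_def norm_blinfun)

lemma norm_m1_triangle: "norm_m1 B (x + y) \<le> norm_m1 B x + norm_m1 B y"
  by (simp add: norm_m1_def blinfun.add_right norm_triangle_ineq)

lemma norm_m1_minus_commute: "norm_m1 B (x - y) = norm_m1 B (y - x)"
  by (simp add: norm_m1_def blinfun.diff_right norm_minus_commute)

lemma norm_blinfun_le_of_bounded_on_ball:
  fixes L :: "'a::real_normed_vector \<Rightarrow>\<^sub>L 'b::real_normed_vector"
  assumes "r > 0" and bound: "\<And>x. x \<in> ball a r \<Longrightarrow> norm (L x) \<le> C"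
  shows "norm L \<le> 4 * C / r"
proof (rule norm_blinfun_bound)
  have "0 \<le> C" using bound[of a] \<open>r > 0\<close> order_trans[OF norm_ge_zero] by simp
  then show "0 \<le> 4 * C / r" using \<open>r > 0\<close> by simp
  fix x
  show "norm (L x) \<le> 4 * C / r * norm x"
  proof (cases "x = 0")
    case False
    define h where "h = (r / (2 * norm x)) *\<^sub>R x"
    have "norm h < r" using False \<open>r > 0\<close> by (simp add: h_def)
    then have "norm (L (a + h)) \<le> C" "norm (L a) \<le> C" using \<open>r > 0\<close> by (auto intro!: bound simp: dist_norm)
    then have "norm (L h) \<le> 2 * C"
      using norm_triangle_ineq4[of "L (a + h)" "L a"] by (simp add: blinfun.add_right)
    then show ?thesis
      using False \<open>r > 0\<close> by (simp add: h_def blinfun.scaleR_right field_simps)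
  qed simp
qed

lemma uniform_boundedness:
  fixes L :: "'i \<Rightarrow> 'a::banach \<Rightarrow>\<^sub>L 'b::real_normed_vector"
  assumes "\<And>x. bounded (range (\<lambda>i. L i x))"
  shows "bounded (range L)"
proof -
  define V where "V n = {x. \<forall>i. norm (L i x) \<le> real n}" for n
  have "closed (V n)" for n
    unfolding V_def by (intro closed_Collect_all closed_Collect_le continuous_intros)
  have "x \<in> \<Union>(range V)" for x
  proof -
    obtain C where "\<And>i. norm (L i x) \<le> C" using assms[of x] by (auto simp: bounded_iff)
    moreover obtain n where "C \<le> real n" using real_arch_simple by blast
    ultimately show ?thesis by (auto simp: V_def intro: order_trans)
  qed
  then have "interior (\<Union>(range V)) \<noteq> {}" by (metis UNIV_eq_I interior_UNIV UNIV_not_empty)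
  then obtain n where "interior (V n) \<noteq> {}"
    using Baire_category_alt[of "euclidean :: 'a topology" "range V"] \<open>\<And>n. closed (V n)\<close>
    by (auto simp: completely_metrizable_space_euclidean)
  then obtain a r where "r > 0" "ball a r \<subseteq> V n" by (auto simp: mem_interior)
  then have "norm (L i) \<le> 4 * real n / r" for i
    by (intro norm_blinfun_le_of_bounded_on_ball) (auto simp: V_def)
  then show ?thesis by (auto simp: bounded_iff)
qed

lemma weakly_converges_bounded:
  fixes xs :: "nat \<Rightarrow> 'a::{real_inner, banach}"
  assumes "weakly_converges xs x"
  shows "\<exists>C. \<forall>k. norm (xs k) \<le> C"
proof -
  have "bounded (range (\<lambda>k. blinfun_inner_right (xs k) y))" for y
    using assms by (auto simp: weakly_converges_def intro: convergent_imp_bounded)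
  from uniform_boundedness[OF this] obtain C where C: "\<And>k. norm (blinfun_inner_right (xs k)) \<le> C"
    by (auto simp: bounded_iff)
  have "norm (xs k) \<le> C" for k
  proof (cases "xs k = 0")
    case False
    have "norm (xs k) * norm (xs k) \<le> norm (blinfun_inner_right (xs k)) * norm (xs k)"
      using norm_blinfun[of "blinfun_inner_right (xs k)" "xs k"] by (simp add: dot_square_norm power2_eq_square)
    then show ?thesis using C[of k] False by simp
  qed (use order_trans[OF norm_ge_zero C] in simp)
  then show ?thesis by blast
qed

lemma norm_m1_tendsto_0:
  fixes B :: "'a::{real_inner, banach} \<Rightarrow>\<^sub>L 'a"
  assumes "psd_op B" "weakly_converges xs x" and Bxs: "(\<lambda>k. B (xs k)) \<longlonglongrightarrow> B x"
  shows "(\<lambda>k. norm_m1 B (xs k - x)) \<longlonglongrightarrow> 0"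
proof -
  obtain C where C: "\<And>k. norm (xs k) \<le> C" using weakly_converges_bounded[OF assms(2)] by blast
  have "(\<lambda>k. (norm_m1 B (xs k - x))\<^sup>2) \<longlonglongrightarrow> 0"
  proof (rule Lim_null_comparison)
    have "(norm_m1 B (xs k - x))\<^sup>2 \<le> norm (B (xs k) - B x) * (C + norm x)" for k
    proof -
      have "(norm_m1 B (xs k - x))\<^sup>2 = B (xs k - x) \<bullet> (xs k - x)" by (rule norm_m1_power2[OF assms(1)])
      also have "\<dots> \<le> norm (B (xs k - x)) * norm (xs k - x)" by (rule norm_cauchy_schwarz)
      also have "\<dots> \<le> norm (B (xs k) - B x) * (C + norm x)"
        using norm_triangle_ineq4[of "xs k" x] C[of k] by (intro mult_mono) (auto simp: blinfun.diff_right)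
      finally show ?thesis .
    qed
    then show "\<forall>\<^sub>F k in sequentially. norm ((norm_m1 B (xs k - x))\<^sup>2) \<le> norm (B (xs k) - B x) * (C + norm x)"
      by simp
    show "(\<lambda>k. norm (B (xs k) - B x) * (C + norm x)) \<longlonglongrightarrow> 0"
      using Bxs by (intro tendsto_mult_left_zero tendsto_norm_zero LIM_zero)
  qed
  from tendsto_real_sqrt[OF this] show ?thesis by simp
qed

subsection \<open>Integrals over intervals and Volterra equations with integrable kernel\<close>

lemma small_scale_exists:
  fixes c \<eta> :: real
  assumes "\<eta> > 0"
  obtains \<kappa> where "\<kappa> > 0" "\<kappa> \<le> 1" "c * \<kappa> \<le> \<eta>"
proof -
  have "c * (\<eta> / (\<bar>c\<bar> + 1)) \<le> (\<bar>c\<bar> + 1) * (\<eta> / (\<bar>c\<bar> + 1))"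
    using assms by (intro mult_right_mono) auto
  then have scaled: "c * (\<eta> / (\<bar>c\<bar> + 1)) \<le> \<eta>" by simp
  define \<kappa> where "\<kappa> = min 1 (\<eta> / (\<bar>c\<bar> + 1))"
  have "c * \<kappa> \<le> \<eta>"
  proof (cases "0 \<le> c")
    case True
    then have "c * \<kappa> \<le> c * (\<eta> / (\<bar>c\<bar> + 1))" by (intro mult_left_mono) (auto simp: \<kappa>_def)
    then show ?thesis using scaled by simp
  next
    case False
    then have "c * \<kappa> \<le> 0" using assms by (intro mult_nonpos_nonneg) (auto simp: \<kappa>_def)
    then show ?thesis using assms by simp
  qed
  then show ?thesis using that[of \<kappa>] assms by (auto simp: \<kappa>_def)
qed

lemma AE_lebesgue_neq: "AE x in lebesgue. x \<noteq> (c :: 'a::euclidean_space)"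
  by (rule AE_completion[OF AE_lborel_singleton])

lemma set_borel_measurable_iff_lebesgue_on:
  fixes f :: "real \<Rightarrow> 'b::real_normed_vector"
  shows "set_borel_measurable lebesgue {a..b} f \<longleftrightarrow> f \<in> borel_measurable (lebesgue_on {a..b})"
  unfolding set_borel_measurable_def by (subst borel_measurable_restrict_space_iff) auto

lemma set_borel_measurable_of_integrable:
  fixes f :: "'a \<Rightarrow> 'b::{banach, second_countable_topology}"
  assumes "set_integrable M A f"
  shows "set_borel_measurable M A f"
  using assms unfolding set_integrable_def set_borel_measurable_def by (rule borel_measurable_integrable)

lemma set_borel_measurable_continuous:
  fixes f :: "real \<Rightarrow> 'b::{banach, second_countable_topology}"
  assumes "continuous_on {a..b} f"
  shows "set_borel_measurable lebesgue {a..b} f"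
  unfolding set_borel_measurable_iff_lebesgue_on
  using assms by (intro continuous_imp_measurable_on_sets_lebesgue) auto

lemma set_integrable_dominated:
  fixes f :: "'a \<Rightarrow> 'b::{banach, second_countable_topology}" and w :: "'a \<Rightarrow> real"
  assumes "set_integrable M A w" "set_borel_measurable M A f"
    and "\<And>x. x \<in> A \<Longrightarrow> norm (f x) \<le> w x"
  shows "set_integrable M A f"
  by (rule set_integrable_bound[OF assms(1,2)]) (auto intro!: AE_I2 order_trans[OF assms(3)])

lemma set_integrable_continuous_interval:
  fixes f :: "real \<Rightarrow> 'b::{banach, second_countable_topology}"
  assumes "continuous_on {a..b} f"
  shows "set_integrable lebesgue {a..b} f"
  using borel_integrable_atLeastAtMost'[OF assms] unfolding set_integrable_def
  by (subst integrable_completion) auto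

lemma set_integrable_mult_continuous:
  fixes k f :: "real \<Rightarrow> real"
  assumes k: "set_integrable lebesgue {a..b} k" and f: "continuous_on {a..b} f"
  shows "set_integrable lebesgue {a..b} (\<lambda>x. k x * f x)"
proof -
  have "compact (f ` {a..b})" using f by (intro compact_continuous_image) auto
  then obtain C where C: "\<And>x. x \<in> {a..b} \<Longrightarrow> \<bar>f x\<bar> \<le> C"
    using compact_imp_bounded by (fastforce simp: bounded_iff)
  show ?thesis
  proof (rule set_integrable_dominated)
    show "set_integrable lebesgue {a..b} (\<lambda>x. C * \<bar>k x\<bar>)"
      using set_integrable_abs[OF k] by simp
    show "set_borel_measurable lebesgue {a..b} (\<lambda>x. k x * f x)"
      using set_borel_measurable_of_integrable[OF k] set_borel_measurable_continuous[OF f]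
      unfolding set_borel_measurable_iff_lebesgue_on by measurable
    show "norm (k x * f x) \<le> C * \<bar>k x\<bar>" if "x \<in> {a..b}" for x
      using mult_right_mono[OF C[OF that], of "\<bar>k x\<bar>"] by (simp add: abs_mult mult.commute)
  qed
qed

lemma set_integrable_subinterval:
  fixes f :: "real \<Rightarrow> 'b::{banach, second_countable_topology}"
  assumes "set_integrable lebesgue {a..b} f" "a \<le> c" "d \<le> b"
  shows "set_integrable lebesgue {c..d} f"
  by (rule set_integrable_subset[OF assms(1)]) (use assms in auto)

lemma set_integral_interval_split:
  fixes f :: "real \<Rightarrow> 'b::{banach, second_countable_topology}"
  assumes "set_integrable lebesgue {a..c} f" "a \<le> b" "b \<le> c"
  shows "(LINT x:{a..c}|lebesgue. f x) = (LINT x:{a..b}|lebesgue. f x) + (LINT x:{b..c}|lebesgue. f x)"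
proof -
  have disjoint: "AE x in lebesgue. \<not> (x \<in> {a..b} \<and> x \<in> {b..c})"
    using AE_lebesgue_neq[of b] by eventually_elim auto
  have "{a..c} = {a..b} \<union> {b..c}" using assms by auto
  then show ?thesis
    using set_integral_Un_AE[OF disjoint _ _ set_integrable_subinterval[OF assms(1)] set_integrable_subinterval[OF assms(1)]] assms
    by simp
qed

lemma set_integral_singleton [simp]:
  fixes f :: "real \<Rightarrow> 'b::{banach, second_countable_topology}"
  shows "(LINT x:{a}|lebesgue. f x) = 0"
  unfolding set_lebesgue_integral_def
  by (intro integral_eq_zero_AE eventually_mono[OF AE_lebesgue_neq[of a]]) simp

lemma set_integral_const_interval:
  "(LINT x:{a..b}|lebesgue. c) = max 0 (b - a) *\<^sub>R (c :: 'b::{banach, second_countable_topology})"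
  by (simp add: set_lebesgue_integral_def max_def)

lemma set_integral_nonneg:
  fixes f :: "'a \<Rightarrow> real"
  assumes "\<And>x. x \<in> A \<Longrightarrow> 0 \<le> f x"
  shows "0 \<le> (LINT x:A|M. f x)"
  unfolding set_lebesgue_integral_def
  using assms by (intro integral_nonneg_AE AE_I2) (auto simp: indicator_def)

lemma set_integral_mono_set:
  fixes f :: "'a \<Rightarrow> real"
  assumes "set_integrable M A f" "\<And>x. x \<in> A \<Longrightarrow> 0 \<le> f x" "B \<in> sets M" "B \<subseteq> A"
  shows "(LINT x:B|M. f x) \<le> (LINT x:A|M. f x)"
  unfolding set_lebesgue_integral_def
proof (rule integral_mono)
  show "integrable M (\<lambda>x. indicat_real B x *\<^sub>R f x)"
    using set_integrable_subset[OF assms(1,3,4)] by (simp add: set_integrable_def)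
  show "integrable M (\<lambda>x. indicat_real A x *\<^sub>R f x)"
    using assms(1) by (simp add: set_integrable_def)
qed (use assms(2,4) in \<open>auto simp: indicator_def\<close>)

lemma norm_set_integral_le:
  fixes f :: "'a \<Rightarrow> 'b::{banach, second_countable_topology}"
  assumes "set_integrable M A f" "set_integrable M A w" "\<And>x. x \<in> A \<Longrightarrow> norm (f x) \<le> w x"
  shows "norm (LINT x:A|M. f x) \<le> (LINT x:A|M. w x)"
  by (rule order_trans[OF set_integral_norm_bound[OF assms(1)]])
     (intro set_integral_mono set_integrable_norm assms)

lemma
  fixes L :: "'b::{banach, second_countable_topology} \<Rightarrow>\<^sub>L 'c::{banach, second_countable_topology}"
  assumes "set_integrable M A f"
  shows set_integrable_blinfun: "set_integrable M A (\<lambda>x. L (f x))"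
    and set_integral_blinfun: "(LINT x:A|M. L (f x)) = L (LINT x:A|M. f x)"
  using integrable_bounded_linear[OF blinfun.bounded_linear_right, of M _ L]
    integral_bounded_linear[OF blinfun.bounded_linear_right, of M _ L] assms
  by (simp_all add: set_integrable_def set_lebesgue_integral_def flip: blinfun.scaleR_right)

lemma eventually_indicator_Icc_eq:
  fixes xs :: "nat \<Rightarrow> real"
  assumes "xs \<longlonglongrightarrow> s" "x \<noteq> s"
  shows "\<forall>\<^sub>F n in sequentially. indicat_real {a..xs n} x = indicat_real {a..s} x"
proof -
  have "\<forall>\<^sub>F n in sequentially. (x \<le> xs n) = (x \<le> s)"
    using order_tendstoD[OF assms(1), of x] assms(2) by (cases x s rule: linorder_cases) (auto elim: eventually_mono)
  then show ?thesis by eventually_elim (simp add: indicator_def)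
qed

lemma continuous_on_set_integral_param:
  fixes f :: "real \<Rightarrow> real \<Rightarrow> 'b::{banach, second_countable_topology}"
  assumes w: "set_integrable lebesgue {a..b} w"
    and meas: "\<And>s. s \<in> {a..b} \<Longrightarrow> set_borel_measurable lebesgue {a..b} (f s)"
    and bound: "\<And>s x. s \<in> {a..b} \<Longrightarrow> x \<in> {a..b} \<Longrightarrow> norm (f s x) \<le> w x"
    and cont: "\<And>x. x \<in> {a..b} \<Longrightarrow> continuous_on {a..b} (\<lambda>s. f s x)"
  shows "continuous_on {a..b} (\<lambda>s. LINT x:{a..s}|lebesgue. f s x)"
  unfolding continuous_on_sequentially comp_def
proof (intro ballI allI impI, elim conjE)
  fix xs s assume s: "s \<in> {a..b}" and "\<forall>n. xs n \<in> {a..b}" and lim: "xs \<longlonglongrightarrow> s"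
  then have xs: "xs n \<in> {a..b}" for n by blast
  have meas_Icc: "(\<lambda>x. indicat_real {a..r} x *\<^sub>R f r x) \<in> borel_measurable lebesgue" if "r \<in> {a..b}" for r
    using set_borel_measurable_subset[OF meas[OF that], of "{a..r}"] that by (simp add: set_borel_measurable_def)
  show "(\<lambda>n. LINT x:{a..xs n}|lebesgue. f (xs n) x) \<longlonglongrightarrow> (LINT x:{a..s}|lebesgue. f s x)"
    unfolding set_lebesgue_integral_def
  proof (rule integral_dominated_convergence)
    show "integrable lebesgue (\<lambda>x. indicat_real {a..b} x *\<^sub>R w x)"
      using w by (simp add: set_integrable_def)
    show "AE x in lebesgue. norm (indicat_real {a..xs n} x *\<^sub>R f (xs n) x) \<le> indicat_real {a..b} x *\<^sub>R w x" for n
    proof (rule AE_I2)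
      fix x
      show "norm (indicat_real {a..xs n} x *\<^sub>R f (xs n) x) \<le> indicat_real {a..b} x *\<^sub>R w x"
        using bound[OF xs, of x n] xs[of n] order_trans[OF norm_ge_zero bound[OF s, of x]]
        by (auto simp: indicator_def)
    qed
    show "AE x in lebesgue. (\<lambda>n. indicat_real {a..xs n} x *\<^sub>R f (xs n) x) \<longlonglongrightarrow> indicat_real {a..s} x *\<^sub>R f s x"
      using AE_lebesgue_neq[of s]
    proof eventually_elim
      case (elim x)
      show ?case
      proof (cases "x \<in> {a..b}")
        case True
        have "(\<lambda>n. f (xs n) x) \<longlonglongrightarrow> f s x"
          using cont[OF True] s xs lim unfolding continuous_on_sequentially comp_def by blast
        then show ?thesis
          by (intro tendsto_scaleR[OF tendsto_eventually] eventually_indicator_Icc_eq[OF lim elim])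
      next
        case False
        then have "indicat_real {a..r} x = 0" if "r \<in> {a..b}" for r using that by (auto simp: indicator_def)
        then show ?thesis using s xs by simp
      qed
    qed
  qed (use s xs in \<open>auto intro: meas_Icc\<close>)
qed

lemma continuous_on_indefinite_set_integral:
  fixes f :: "real \<Rightarrow> 'b::{banach, second_countable_topology}"
  assumes "set_integrable lebesgue {a..b} f"
  shows "continuous_on {a..b} (\<lambda>s. LINT x:{a..s}|lebesgue. f x)"
  by (rule continuous_on_set_integral_param[where w = "\<lambda>x. norm (f x)"])
     (use assms in \<open>auto intro!: set_borel_measurable_of_integrable simp: set_integrable_norm\<close>)

text \<open>A substitute for the chain rule for absolutely continuous functions: halving the increment
  of \<open>K\<close> halves the error bound, so the increment of \<open>f\<close> vanishes.\<close>

lemma eq_of_quadratic_increments: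
  fixes f :: "real \<Rightarrow> 'b::real_normed_vector" and K :: "real \<Rightarrow> real"
  assumes K: "continuous_on {a..b} K" and "a \<le> b"
    and bound: "\<And>r s. a \<le> r \<Longrightarrow> r \<le> s \<Longrightarrow> s \<le> b \<Longrightarrow> norm (f s - f r) \<le> C * (K s - K r)\<^sup>2"
  shows "f b = f a"
proof -
  have halved: "norm (f s - f r) \<le> C * (K s - K r)\<^sup>2 / 2 ^ n" if "a \<le> r" "r \<le> s" "s \<le> b" for r s n
    using that
  proof (induction n arbitrary: r s)
    case 0
    then show ?case using bound by simp
  next
    case (Suc n)
    have "continuous_on {r..s} K" using K Suc.prems by (auto intro: continuous_on_subset)
    then have "\<exists>m. r \<le> m \<and> m \<le> s \<and> K m = (K r + K s) / 2"
      using IVT'[of K r "(K r + K s) / 2" s] IVT2'[of K s "(K r + K s) / 2" r] Suc.prems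
      by (cases "K r \<le> K s") auto
    then obtain m where m: "r \<le> m" "m \<le> s" "K m = (K r + K s) / 2" by blast
    have "norm (f s - f m) \<le> C * (K s - K m)\<^sup>2 / 2 ^ n" "norm (f m - f r) \<le> C * (K m - K r)\<^sup>2 / 2 ^ n"
      using Suc.IH Suc.prems m by auto
    moreover have "K s - K m = (K s - K r) / 2" "K m - K r = (K s - K r) / 2"
      using m(3) by (auto simp: field_simps)
    ultimately show ?case
      using norm_triangle_ineq[of "f s - f m" "f m - f r"] by (simp add: power_divide)
  qed
  have "(\<lambda>n. C * (K b - K a)\<^sup>2 * (1/2) ^ n) \<longlonglongrightarrow> C * (K b - K a)\<^sup>2 * 0"
    by (intro tendsto_intros LIMSEQ_realpow_zero) auto
  then have "norm (f b - f a) \<le> C * (K b - K a)\<^sup>2 * 0"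
    using halved[of a b] \<open>a \<le> b\<close> by (intro LIMSEQ_le_const) (auto simp: power_one_over)
  then show ?thesis by simp
qed

lemma exp_increment_bounds:
  fixes x y :: real
  shows "exp x * (y - x) \<le> exp y - exp x" "exp y - exp x \<le> exp y * (y - x)"
proof -
  have lower: "exp x * (y - x) \<le> exp y - exp x" for x y :: real
    using mult_left_mono[OF exp_ge_add_one_self[of "y - x"], of "exp x"]
    by (simp add: algebra_simps flip: exp_add)
  show "exp x * (y - x) \<le> exp y - exp x" by (rule lower)
  show "exp y - exp x \<le> exp y * (y - x)" using lower[of y x] by (simp add: algebra_simps)
qed

lemma set_integral_kernel_exp:
  fixes k :: "real \<Rightarrow> real"
  assumes k: "set_integrable lebesgue {a..b} k" and k_nonneg: "\<And>x. x \<in> {a..b} \<Longrightarrow> 0 \<le> k x" and "a \<le> b"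
  defines "K \<equiv> \<lambda>s. LINT x:{a..s}|lebesgue. k x"
  shows "(LINT x:{a..b}|lebesgue. k x * exp (K x)) = exp (K b) - 1"
proof -
  have K_cont: "continuous_on {a..b} K" unfolding K_def by (rule continuous_on_indefinite_set_integral[OF k])
  have k_exp: "set_integrable lebesgue {a..b} (\<lambda>x. k x * exp (K x))"
    by (rule set_integrable_mult_continuous[OF k]) (intro continuous_intros K_cont)
  have K_diff: "K y - K x = (LINT z:{x..y}|lebesgue. k z)" if "a \<le> x" "x \<le> y" "y \<le> b" for x y
    unfolding K_def using set_integral_interval_split[of a y k x] set_integrable_subinterval[OF k] that by simp
  have K_mono: "K x \<le> K y" if "a \<le> x" "x \<le> y" "y \<le> b" for x y
  proof -
    have "0 \<le> (LINT z:{x..y}|lebesgue. k z)" using k_nonneg that by (intro set_integral_nonneg) auto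
    then show ?thesis using K_diff[OF that] by simp
  qed
  define f where "f s = (LINT x:{a..s}|lebesgue. k x * exp (K x)) - exp (K s)" for s
  have "f b = f a"
  proof (rule eq_of_quadratic_increments[OF K_cont \<open>a \<le> b\<close>])
    fix x y assume xy: "a \<le> x" "x \<le> y" "y \<le> b"
    define I where "I = (LINT z:{x..y}|lebesgue. k z * exp (K z))"
    have sub: "set_integrable lebesgue {x..y} (\<lambda>z. k z * c)" "set_integrable lebesgue {x..y} (\<lambda>z. k z * exp (K z))" for c
      using xy by (auto intro!: set_integrable_mult_left intro: set_integrable_subinterval[OF k] set_integrable_subinterval[OF k_exp])
    have weighted: "(LINT z:{x..y}|lebesgue. k z * c) = c * (K y - K x)" for c using K_diff[OF xy] by simp
    have "(LINT z:{x..y}|lebesgue. k z * exp (K x)) \<le> I" "I \<le> (LINT z:{x..y}|lebesgue. k z * exp (K y))"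
      unfolding I_def by (intro set_integral_mono sub mult_left_mono; use xy K_mono k_nonneg in simp)+
    then have I_bounds: "exp (K x) * (K y - K x) \<le> I" "I \<le> exp (K y) * (K y - K x)"
      unfolding weighted .
    have "f y - f x = I - (exp (K y) - exp (K x))"
      unfolding f_def I_def using set_integral_interval_split[OF set_integrable_subinterval[OF k_exp], of a y x] xy by simp
    then have "\<bar>f y - f x\<bar> \<le> (exp (K y) - exp (K x)) * (K y - K x)"
      using I_bounds exp_increment_bounds[where x = "K x" and y = "K y"] unfolding left_diff_distrib by linarith
    also have "\<dots> \<le> (exp (K b) * (K y - K x)) * (K y - K x)"
      using K_mono xy
      by (intro mult_right_mono order_trans[OF exp_increment_bounds(2)]) auto
    finally show "norm (f y - f x) \<le> exp (K b) * (K y - K x)\<^sup>2" by (simp add: power2_eq_square)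
  qed
  moreover have "f a = - 1" by (simp add: f_def K_def)
  ultimately show ?thesis by (simp add: f_def)
qed

lemma Gronwall_integrable_kernel:
  fixes k \<phi> :: "real \<Rightarrow> real"
  assumes k: "set_integrable lebesgue {a..b} k" and k_nonneg: "\<And>x. x \<in> {a..b} \<Longrightarrow> 0 \<le> k x"
    and cont: "continuous_on {a..b} \<phi>"
    and ineq: "\<And>s. s \<in> {a..b} \<Longrightarrow> \<phi> s \<le> c + (LINT x:{a..s}|lebesgue. k x * \<phi> x)"
    and "0 \<le> c" and s: "s \<in> {a..b}"
  shows "\<phi> s \<le> c * exp (LINT x:{a..s}|lebesgue. k x)"
proof -
  define K where "K = (\<lambda>s. LINT x:{a..s}|lebesgue. k x)"
  have K_cont: "continuous_on {a..b} K" unfolding K_def by (rule continuous_on_indefinite_set_integral[OF k])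
  have "continuous_on {a..b} (\<lambda>s. \<phi> s * exp (- K s))" by (intro continuous_intros cont K_cont)
  then obtain s0 where s0: "s0 \<in> {a..b}" "\<And>s. s \<in> {a..b} \<Longrightarrow> \<phi> s * exp (- K s) \<le> \<phi> s0 * exp (- K s0)"
    using continuous_attains_sup[OF compact_Icc, of a b] s by blast
  define m where "m = max 0 (\<phi> s0 * exp (- K s0))"
  have \<phi>_le: "\<phi> s \<le> m * exp (K s)" if "s \<in> {a..b}" for s
  proof -
    have "\<phi> s * exp (- K s) \<le> m" using s0(2)[OF that] by (simp add: m_def)
    then have "\<phi> s * exp (- K s) * exp (K s) \<le> m * exp (K s)" by (rule mult_right_mono) simp
    then show ?thesis by (simp add: mult.assoc flip: exp_add)
  qed
  have "\<phi> s0 \<le> c + m * (exp (K s0) - 1)"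
  proof -
    have sub: "set_integrable lebesgue {a..s0} k" using k s0(1) by (auto intro: set_integrable_subinterval)
    have "(LINT x:{a..s0}|lebesgue. k x * \<phi> x) \<le> (LINT x:{a..s0}|lebesgue. k x * (m * exp (K x)))"
      using s0(1) by (intro set_integral_mono set_integrable_mult_continuous sub mult_left_mono \<phi>_le k_nonneg)
        (auto intro!: continuous_intros continuous_on_subset[OF cont] continuous_on_subset[OF K_cont])
    also have "\<dots> = m * (LINT x:{a..s0}|lebesgue. k x * exp (K x))"
      by (simp flip: set_integral_mult_right add: mult.left_commute)
    also have "(LINT x:{a..s0}|lebesgue. k x * exp (K x)) = exp (K s0) - 1"
      unfolding K_def using s0(1) k_nonneg by (intro set_integral_kernel_exp sub) auto
    finally show ?thesis using ineq[OF s0(1)] by simp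
  qed
  moreover have "m = 0 \<or> \<phi> s0 = m * exp (K s0)"
    by (auto simp: m_def max_def mult.assoc simp flip: exp_add)
  ultimately have "m \<le> c" using \<open>0 \<le> c\<close> by (auto simp: right_diff_distrib)
  then have "m * exp (K s) \<le> c * exp (K s)" by (intro mult_right_mono) auto
  with \<phi>_le[OF s] show ?thesis unfolding K_def by (rule order_trans)
qed

lemma set_integral_kernel_weighted_le:
  fixes k f :: "real \<Rightarrow> real"
  assumes k: "set_integrable lebesgue {a..b} k" and k_nonneg: "\<And>x. x \<in> {a..b} \<Longrightarrow> 0 \<le> k x"
    and s: "s \<in> {a..b}" and cont: "continuous_on {a..b} f" and "0 \<le> d"
  defines "K \<equiv> \<lambda>s. LINT x:{a..s}|lebesgue. 2 * k x"
  assumes bound: "\<And>x. x \<in> {a..b} \<Longrightarrow> f x \<le> d * exp (K x)"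
  shows "(LINT x:{a..s}|lebesgue. k x * f x) \<le> d / 2 * exp (K s)"
proof -
  have K_cont: "continuous_on {a..b} K"
    unfolding K_def using k by (intro continuous_on_indefinite_set_integral set_integrable_mult_right)
  have sub: "set_integrable lebesgue {a..s} k" using k s by (auto intro: set_integrable_subinterval)
  have "(LINT x:{a..s}|lebesgue. k x * f x) \<le> (LINT x:{a..s}|lebesgue. k x * (d * exp (K x)))"
    using s by (intro set_integral_mono set_integrable_mult_continuous sub mult_left_mono bound k_nonneg)
      (auto intro!: continuous_intros intro: continuous_on_subset[OF cont] continuous_on_subset[OF K_cont])
  also have "\<dots> = d / 2 * (LINT x:{a..s}|lebesgue. 2 * k x * exp (K x))"
    by (simp flip: set_integral_mult_right add: mult_ac)
  also have "(LINT x:{a..s}|lebesgue. 2 * k x * exp (K x)) = exp (K s) - 1"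
    unfolding K_def using s k_nonneg sub by (intro set_integral_kernel_exp set_integrable_mult_right) auto
  also have "d / 2 * (exp (K s) - 1) \<le> d / 2 * exp (K s)" using \<open>0 \<le> d\<close> by (intro mult_left_mono) auto
  finally show ?thesis .
qed

text \<open>Contraction in the norm weighted by \<open>exp (- 2 \<integral> k)\<close>.\<close>

lemma Volterra_fixed_point:
  fixes \<Phi> :: "(real \<Rightarrow> 'a::banach) \<Rightarrow> real \<Rightarrow> 'a" and k :: "real \<Rightarrow> real"
  assumes k: "set_integrable lebesgue {a..b} k" and k_nonneg: "\<And>x. x \<in> {a..b} \<Longrightarrow> 0 \<le> k x" and "a \<le> b"
    and cont: "\<And>X. continuous_on {a..b} X \<Longrightarrow> continuous_on {a..b} (\<Phi> X)"
    and lipschitz: "\<And>X Y s. continuous_on {a..b} X \<Longrightarrow> continuous_on {a..b} Y \<Longrightarrow> s \<in> {a..b} \<Longrightarrow>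
      norm (\<Phi> X s - \<Phi> Y s) \<le> (LINT x:{a..s}|lebesgue. k x * norm (X x - Y x))"
  shows "\<exists>X. continuous_on {a..b} X \<and> (\<forall>s\<in>{a..b}. X s = \<Phi> X s)"
proof -
  define K where "K = (\<lambda>s. LINT x:{a..s}|lebesgue. 2 * k x)"
  have K_cont: "continuous_on {a..b} K"
    unfolding K_def using k by (intro continuous_on_indefinite_set_integral set_integrable_mult_right)
  define weighted where "weighted Z s = exp (K s) *\<^sub>R apply_bcontfun Z s" for Z :: "real \<Rightarrow>\<^sub>C 'a" and s
  have weighted_cont: "continuous_on {a..b} (weighted Z)" for Z
    unfolding weighted_def by (intro continuous_intros K_cont) auto
  have "\<exists>Z'. \<forall>s. apply_bcontfun Z' s = exp (- K (clamp a b s)) *\<^sub>R \<Phi> (weighted Z) (clamp a b s)" for Z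
  proof -
    have "continuous_on (cbox a b) (\<lambda>s. exp (- K s) *\<^sub>R \<Phi> (weighted Z) s)"
      by (simp, intro continuous_intros K_cont cont weighted_cont)
    then show ?thesis by (rule continuous_on_cbox_bcontfunE) blast
  qed
  then obtain \<Psi> where \<Psi>: "\<And>Z s. apply_bcontfun (\<Psi> Z) s = exp (- K (clamp a b s)) *\<^sub>R \<Phi> (weighted Z) (clamp a b s)"
    by metis
  have "dist (\<Psi> Z) (\<Psi> Y) \<le> 1/2 * dist Z Y" for Z Y
  proof (rule dist_bound)
    fix r
    define s where "s = clamp a b r"
    have s: "s \<in> {a..b}" using clamp_in_interval[of a b r] \<open>a \<le> b\<close> by (simp add: s_def)
    have "norm (weighted Z x - weighted Y x) \<le> dist Z Y * exp (K x)" for x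
      using dist_bounded[of Z x Y] by (simp add: weighted_def dist_norm mult.commute flip: scaleR_diff_right)
    then have "norm (\<Phi> (weighted Z) s - \<Phi> (weighted Y) s) \<le> dist Z Y / 2 * exp (K s)"
      unfolding K_def
      by (intro order_trans[OF lipschitz set_integral_kernel_weighted_le[OF k]] k_nonneg continuous_intros
          weighted_cont s) auto
    then have "exp (- K s) * norm (\<Phi> (weighted Z) s - \<Phi> (weighted Y) s) \<le> exp (- K s) * (dist Z Y / 2 * exp (K s))"
      by (rule mult_left_mono) simp
    also have "\<dots> = 1/2 * dist Z Y" by (simp add: exp_minus)
    also have "exp (- K s) * norm (\<Phi> (weighted Z) s - \<Phi> (weighted Y) s) = dist (\<Psi> Z r) (\<Psi> Y r)"
      by (simp add: \<Psi> dist_norm flip: s_def scaleR_diff_right)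
    finally show "dist (\<Psi> Z r) (\<Psi> Y r) \<le> 1/2 * dist Z Y" .
  qed
  then obtain Z where Z: "\<Psi> Z = Z" using banach_fix_type[of "1/2" \<Psi>] by auto
  have "weighted Z s = \<Phi> (weighted Z) s" if "s \<in> {a..b}" for s
    using \<Psi>[of Z s] that by (simp add: Z weighted_def clamp_cancel_cbox exp_minus)
  then show ?thesis using weighted_cont by blast
qed

subsection \<open>The semigroup and the weak norm\<close>

locale generated_contraction =
  fixes domA :: "'a::{real_inner, banach, second_countable_topology} set"
    and A :: "'a \<Rightarrow> 'a" and S :: "real \<Rightarrow> 'a \<Rightarrow>\<^sub>L 'a"
  assumes dense: "closure domA = UNIV"
    and semigroup: "contraction_C0_semigroup S"
    and generator: "generator_of S domA (\<lambda>x. - A x)"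
begin

lemma S_0 [simp]: "S 0 x = x"
  using semigroup by (simp add: contraction_C0_semigroup_def)

lemma S_add: "0 \<le> r \<Longrightarrow> 0 \<le> s \<Longrightarrow> S (r + s) x = S r (S s x)"
  using semigroup by (simp add: contraction_C0_semigroup_def)

lemma norm_S_le_1: "0 \<le> r \<Longrightarrow> norm (S r) \<le> 1"
  using semigroup by (simp add: contraction_C0_semigroup_def)

lemma norm_S_apply_le: "0 \<le> r \<Longrightarrow> norm (S r x) \<le> norm x"
  using norm_blinfun[of "S r" x] mult_right_mono[OF norm_S_le_1, of r "norm x"] by simp

lemma norm_S_diff_le: "0 \<le> r \<Longrightarrow> norm (S r x - S r y) \<le> norm (x - y)"
  using norm_S_apply_le[of r "x - y"] by (simp add: blinfun.diff_right)

lemma S_near_id: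
  assumes "e > 0"
  shows "\<exists>d>0. \<forall>h. 0 \<le> h \<and> h < d \<longrightarrow> norm (S h x - x) < e"
proof -
  have "((\<lambda>t. S t x) \<longlongrightarrow> x) (at_right 0)" using semigroup by (simp add: contraction_C0_semigroup_def)
  from tendstoD[OF this assms] obtain d where "d > 0" "\<And>h. 0 < h \<Longrightarrow> h < d \<Longrightarrow> dist (S h x) x < e"
    unfolding eventually_at_right_field by auto
  then show ?thesis using assms by (intro exI[of _ d]) (auto simp: dist_norm le_less)
qed

lemma norm_S_time_diff_le:
  assumes "0 \<le> r" "0 \<le> s"
  shows "norm (S r x - S s x) \<le> norm (S \<bar>r - s\<bar> x - x)"
proof -
  have ordered: "norm (S r x - S s x) \<le> norm (S (r - s) x - x)" if "s \<le> r" "0 \<le> s" for r s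
    using S_add[of s "r - s" x] norm_S_diff_le[of s "S (r - s) x" x] that by simp
  show ?thesis
  proof (cases "s \<le> r")
    case True
    then show ?thesis using ordered assms by simp
  next
    case False
    then show ?thesis using ordered[of r s] assms by (simp add: norm_minus_commute abs_minus_commute)
  qed
qed

lemma continuous_on_S:
  assumes "continuous_on U f" "continuous_on U g" "\<And>x. x \<in> U \<Longrightarrow> 0 \<le> f x"
  shows "continuous_on U (\<lambda>x. S (f x) (g x))"
  unfolding continuous_on_def
proof
  fix x assume x: "x \<in> U"
  have f: "(f \<longlongrightarrow> f x) (at x within U)" and g: "(g \<longlongrightarrow> g x) (at x within U)"
    using assms x by (auto simp: continuous_on_def)
  have "((\<lambda>y. S \<bar>f y - f x\<bar> (g x) - g x) \<longlongrightarrow> 0) (at x within U)"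
  proof (rule tendstoI)
    fix e :: real assume "e > 0"
    then obtain d where d: "d > 0" "\<And>h. 0 \<le> h \<Longrightarrow> h < d \<Longrightarrow> norm (S h (g x) - g x) < e"
      using S_near_id by blast
    from tendstoD[OF f d(1)] show "\<forall>\<^sub>F y in at x within U. dist (S \<bar>f y - f x\<bar> (g x) - g x) 0 < e"
      by eventually_elim (use d in \<open>auto simp: dist_real_def\<close>)
  qed
  moreover have "((\<lambda>y. g y - g x) \<longlongrightarrow> 0) (at x within U)" using g by (simp add: LIM_zero)
  ultimately have lim: "((\<lambda>y. norm (g y - g x) + norm (S \<bar>f y - f x\<bar> (g x) - g x)) \<longlongrightarrow> 0) (at x within U)"
    using tendsto_add[OF tendsto_norm_zero tendsto_norm_zero] by fastforce
  have "((\<lambda>y. S (f y) (g y) - S (f x) (g x)) \<longlongrightarrow> 0) (at x within U)"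
  proof (rule Lim_null_comparison[OF _ lim])
    have "\<forall>\<^sub>F y in at x within U. y \<in> U" by (simp add: eventually_at_filter)
    then show "\<forall>\<^sub>F y in at x within U. norm (S (f y) (g y) - S (f x) (g x))
        \<le> norm (g y - g x) + norm (S \<bar>f y - f x\<bar> (g x) - g x)"
    proof eventually_elim
      case (elim y)
      show ?case
        by (rule norm_diff_triangle_le[where y = "S (f y) (g x)"])
           (use norm_S_diff_le norm_S_time_diff_le assms(3) x elim in auto)
    qed
  qed
  then show "((\<lambda>x. S (f x) (g x)) \<longlongrightarrow> S (f x) (g x)) (at x within U)" by (rule LIM_zero_cancel)
qed

lemma borel_measurable_S:
  assumes "f \<in> borel_measurable N" "g \<in> borel_measurable N"
  shows "(\<lambda>x. S (max 0 (f x)) (g x)) \<in> borel_measurable N"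
  by (rule borel_measurable_continuous_Pair[where H = "\<lambda>r z. S (max 0 r) z", OF assms], rule continuous_on_S)
     (auto intro!: continuous_intros)

lemma generator_tendsto:
  assumes "x \<in> domA"
  shows "((\<lambda>h. (S h x - x) /\<^sub>R h) \<longlongrightarrow> - A x) (at_right 0)"
  using generator assms by (simp add: generator_of_def)

lemma S_domA:
  assumes x: "x \<in> domA" and r: "0 \<le> r"
  shows "S r x \<in> domA" "A (S r x) = S r (A x)"
proof -
  have "((\<lambda>h. S r ((S h x - x) /\<^sub>R h)) \<longlongrightarrow> S r (- A x)) (at_right 0)"
    by (intro tendsto_intros generator_tendsto x)
  moreover have "\<forall>\<^sub>F h in at_right 0. S r ((S h x - x) /\<^sub>R h) = (S h (S r x) - S r x) /\<^sub>R h"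
  proof -
    have "S r (S h x) = S h (S r x)" if "0 < h" for h
      using S_add[of r h x] S_add[of h r x] r that by (simp add: add.commute)
    then show ?thesis
      unfolding eventually_at_filter by (simp add: blinfun.scaleR_right blinfun.diff_right)
  qed
  ultimately have lim: "((\<lambda>h. (S h (S r x) - S r x) /\<^sub>R h) \<longlongrightarrow> S r (- A x)) (at_right 0)"
    by (rule Lim_transform_eventually)
  then show in_domA: "S r x \<in> domA" using generator by (auto simp: generator_of_def)
  have "S r (- A x) = - A (S r x)"
    using lim generator_tendsto[OF in_domA] by (meson tendsto_unique trivial_limit_at_right_real)
  then show "A (S r x) = S r (A x)" by (simp add: blinfun.minus_right)
qed

lemma generator_remainder_le:
  assumes "x \<in> domA" "e > 0"
  shows "\<exists>d>0. \<forall>h. 0 \<le> h \<and> h < d \<longrightarrow> norm (S h x - x + h *\<^sub>R A x) \<le> h * e"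
proof -
  from tendstoD[OF generator_tendsto[OF assms(1)] assms(2)] obtain d where d: "d > 0"
    "\<And>h. 0 < h \<Longrightarrow> h < d \<Longrightarrow> dist ((S h x - x) /\<^sub>R h) (- A x) < e"
    unfolding eventually_at_right_field by auto
  have "norm (S h x - x + h *\<^sub>R A x) \<le> h * e" if "0 \<le> h" "h < d" for h
  proof (cases "h = 0")
    case False
    then have "S h x - x + h *\<^sub>R A x = h *\<^sub>R ((S h x - x) /\<^sub>R h + A x)" by (simp add: scaleR_add_right)
    then have "norm (S h x - x + h *\<^sub>R A x) = h * norm ((S h x - x) /\<^sub>R h + A x)" using that by simp
    also have "\<dots> \<le> h * e" using d(2)[of h] that False by (intro mult_left_mono) (auto simp: dist_norm)
    finally show ?thesis .
  qed simp
  then show ?thesis using d(1) by blast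
qed

lemma norm_S_increment_le:
  assumes "0 \<le> r" "0 \<le> s"
  defines "h \<equiv> \<bar>s - r\<bar>"
  shows "norm (S s x - S r x + (s - r) *\<^sub>R S r z) \<le> norm (S h x - x + h *\<^sub>R z) + h * norm (S h z - z)"
proof (cases "r \<le> s")
  case True
  then have "s = r + h" by (simp add: h_def)
  then have "S s x - S r x + (s - r) *\<^sub>R S r z = S r (S h x - x + h *\<^sub>R z)"
    using S_add[of r h x] assms(1) by (simp add: h_def blinfun.add_right blinfun.diff_right blinfun.scaleR_right)
  then have "norm (S s x - S r x + (s - r) *\<^sub>R S r z) \<le> norm (S h x - x + h *\<^sub>R z)"
    using norm_S_apply_le[OF assms(1)] by simp
  then show ?thesis by (simp add: add_increasing2 h_def)
next
  case False
  then have r_eq: "r = s + h" and "0 \<le> h" by (simp_all add: h_def)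
  then have shift: "S r y = S s (S h y)" for y using S_add[of s h y] assms(2) by simp
  have s_minus_r: "s - r = - h" using r_eq by linarith
  have "S s x - S r x + (s - r) *\<^sub>R S r z = - (S s (S h x - x + h *\<^sub>R z) + h *\<^sub>R S s (S h z - z))"
    unfolding shift s_minus_r by (simp add: blinfun.add_right blinfun.diff_right blinfun.scaleR_right algebra_simps)
  also have "norm \<dots> \<le> norm (S s (S h x - x + h *\<^sub>R z)) + norm (h *\<^sub>R S s (S h z - z))"
    unfolding norm_minus_cancel by (rule norm_triangle_ineq)
  also have "\<dots> \<le> norm (S h x - x + h *\<^sub>R z) + h * norm (S h z - z)"
    using norm_S_apply_le[OF assms(2)] by (intro add_mono) (auto simp: h_def intro: mult_left_mono)
  finally show ?thesis .
qed

lemma S_has_vector_derivative: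
  assumes x: "x \<in> domA" and r: "0 \<le> r"
  shows "((\<lambda>r. S r x) has_vector_derivative - A (S r x)) (at r within {0..})"
  unfolding has_vector_derivative_def has_derivative_within_alt
proof (intro conjI allI impI bounded_linear_scaleR_left)
  fix e :: real assume "e > 0"
  then have "e / 2 > 0" by simp
  obtain d1 where d1: "d1 > 0" "\<And>h. 0 \<le> h \<Longrightarrow> h < d1 \<Longrightarrow> norm (S h x - x + h *\<^sub>R A x) \<le> h * (e / 2)"
    using generator_remainder_le[OF x \<open>e / 2 > 0\<close>] by blast
  obtain d2 where d2: "d2 > 0" "\<And>h. 0 \<le> h \<Longrightarrow> h < d2 \<Longrightarrow> norm (S h (A x) - A x) < e / 2"
    using S_near_id[OF \<open>e / 2 > 0\<close>] by blast
  have "norm (S s x - S r x - (s - r) *\<^sub>R - A (S r x)) \<le> e * norm (s - r)"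
    if s: "s \<in> {0..}" "norm (s - r) < min d1 d2" for s
  proof -
    define h where "h = \<bar>s - r\<bar>"
    have h: "0 \<le> h" "h < d1" "h < d2" using s by (auto simp: h_def)
    have "norm (S s x - S r x - (s - r) *\<^sub>R - A (S r x)) = norm (S s x - S r x + (s - r) *\<^sub>R S r (A x))"
      by (simp add: S_domA[OF x r])
    also have "\<dots> \<le> norm (S h x - x + h *\<^sub>R A x) + h * norm (S h (A x) - A x)"
      unfolding h_def using r s by (intro norm_S_increment_le) auto
    also have "\<dots> \<le> h * (e / 2) + h * (e / 2)"
      using d1(2) d2(2) h by (intro add_mono mult_left_mono) (auto intro: less_imp_le)
    finally show ?thesis by (simp add: h_def mult.commute)
  qed
  then show "\<exists>d>0. \<forall>s\<in>{0..}. norm (s - r) < d \<longrightarrow>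
      norm (S s x - S r x - (s - r) *\<^sub>R - A (S r x)) \<le> e * norm (s - r)"
    using d1(1) d2(1) by (intro exI[of _ "min d1 d2"]) auto
qed

lemma domA_approx: obtains xs where "\<And>n. xs n \<in> domA" "xs \<longlonglongrightarrow> x"
  using dense closure_sequential[of x domA] by auto

lemma S_mean_value_domA:
  assumes w: "w \<in> adj_domain domA A" and d: "0 \<le> d" and z: "z \<in> domA"
  shows "\<exists>\<rho>\<in>{0..d}. (S d z - z) \<bullet> w = - d * (S \<rho> z \<bullet> adj_op domA A w)"
proof -
  have "((\<lambda>r. S r z \<bullet> w) has_derivative (\<lambda>h. h * (- A (S r z) \<bullet> w))) (at r within {0..d})"
    if "0 \<le> r" "r \<le> d" for r
  proof -
    have "((\<lambda>r. S r z) has_vector_derivative - A (S r z)) (at r within {0..d})"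
      by (rule has_vector_derivative_within_subset[OF S_has_vector_derivative[OF z]]) (use that in auto)
    then show ?thesis unfolding has_vector_derivative_def
      by (rule has_derivative_eq_rhs[OF has_derivative_inner_left]) auto
  qed
  then obtain \<rho> where \<rho>: "\<rho> \<in> {0..d}" "S d z \<bullet> w - S 0 z \<bullet> w = (d - 0) * (- A (S \<rho> z) \<bullet> w)"
    using mvt_very_simple[of 0 d "\<lambda>r. S r z \<bullet> w" "\<lambda>r h. h * (- A (S r z) \<bullet> w)"] d by auto
  have "A (S \<rho> z) \<bullet> w = S \<rho> z \<bullet> adj_op domA A w"
    by (rule adj_op_eq[OF dense w]) (use S_domA(1)[OF z] \<rho>(1) in auto)
  then show ?thesis using \<rho> by (auto simp: inner_diff_left)
qed

lemma S_mean_value: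
  assumes w: "w \<in> adj_domain domA A" and d: "0 \<le> d"
  shows "\<exists>\<rho>\<in>{0..d}. (S d z - z) \<bullet> w = - d * (S \<rho> z \<bullet> adj_op domA A w)"
proof -
  obtain zs where zs: "\<And>n. zs n \<in> domA" "zs \<longlonglongrightarrow> z" using domA_approx by metis
  obtain \<rho> where \<rho>: "\<And>n. \<rho> n \<in> {0..d}"
    "\<And>n. (S d (zs n) - zs n) \<bullet> w = - d * (S (\<rho> n) (zs n) \<bullet> adj_op domA A w)"
    using S_mean_value_domA[OF w d zs(1)] by metis
  obtain l k where l: "l \<in> {0..d}" and k: "strict_mono (k :: nat \<Rightarrow> nat)" and \<rho>_lim: "(\<rho> \<circ> k) \<longlonglongrightarrow> l"
    using compact_imp_seq_compact[OF compact_Icc, of 0 d] \<rho>(1) unfolding seq_compact_def by metis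
  have zs_lim: "(\<lambda>n. zs (k n)) \<longlonglongrightarrow> z" using LIMSEQ_subseq_LIMSEQ[OF zs(2) k] by (simp add: comp_def)
  have "continuous_on ({0..} \<times> UNIV) (\<lambda>p. S (fst p) (snd p))"
    by (rule continuous_on_S) (auto intro!: continuous_intros)
  then have "(\<lambda>n. S (\<rho> (k n)) (zs (k n))) \<longlonglongrightarrow> S l z"
    unfolding continuous_on_sequentially comp_def
    by (elim ballE[of _ _ "(l, z)"] allE[of _ "\<lambda>n. (\<rho> (k n), zs (k n))"])
       (use tendsto_Pair[OF \<rho>_lim[unfolded comp_def] zs_lim] l \<rho>(1) in auto)
  then have "(\<lambda>n. - d * (S (\<rho> (k n)) (zs (k n)) \<bullet> adj_op domA A w)) \<longlonglongrightarrow> - d * (S l z \<bullet> adj_op domA A w)"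
    by (intro tendsto_mult tendsto_const tendsto_inner)
  moreover have "(\<lambda>n. (S d (zs (k n)) - zs (k n)) \<bullet> w) \<longlonglongrightarrow> (S d z - z) \<bullet> w"
    by (intro tendsto_intros zs_lim)
  ultimately have "(S d z - z) \<bullet> w = - d * (S l z \<bullet> adj_op domA A w)"
    using \<rho>(2) LIMSEQ_unique by force
  then show ?thesis using l by blast
qed

lemma S_displacement_inner_le:
  assumes "w \<in> adj_domain domA A" "0 \<le> d" and near: "\<And>\<rho>. 0 \<le> \<rho> \<Longrightarrow> \<rho> \<le> d \<Longrightarrow> norm (S \<rho> x - x) \<le> \<kappa>"
    and a: "norm (adj_op domA A w - a) \<le> \<kappa>" "\<kappa> \<le> 1"
  shows "(S d x - x) \<bullet> w \<le> d * (\<kappa> * (norm a + norm x + 1) - x \<bullet> a)"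
proof -
  let ?b = "adj_op domA A w"
  obtain \<rho> where \<rho>: "\<rho> \<in> {0..d}" "(S d x - x) \<bullet> w = - d * (S \<rho> x \<bullet> ?b)"
    using S_mean_value[OF assms(1,2)] by blast
  have "x \<bullet> a - S \<rho> x \<bullet> ?b = (x - S \<rho> x) \<bullet> ?b + x \<bullet> (a - ?b)"
    by (simp add: inner_diff_left inner_diff_right)
  also have "\<dots> \<le> norm (x - S \<rho> x) * norm ?b + norm x * norm (a - ?b)" by (intro add_mono norm_cauchy_schwarz)
  also have "\<dots> \<le> \<kappa> * (norm a + 1) + norm x * \<kappa>"
    using near[of \<rho>] \<rho>(1) a norm_triangle_sub[of ?b a] order_trans[OF norm_ge_zero a(1)]
    by (intro add_mono mult_mono) (auto simp: norm_minus_commute)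
  finally have "- (S \<rho> x \<bullet> ?b) \<le> \<kappa> * (norm a + norm x + 1) - x \<bullet> a" by (simp add: algebra_simps)
  from mult_left_mono[OF this assms(2)] show ?thesis using \<rho>(2) by simp
qed

lemma norm_adjoint_S_le:
  assumes "0 \<le> r"
  shows "norm (adjoint (S r) p) \<le> norm p"
  using norm_adjoint_blinfun_le[of "S r" p] mult_right_mono[OF norm_S_le_1[OF assms], of "norm p"] by simp

lemma norm_adjoint_S_diff_power2_le:
  assumes "0 \<le> r"
  shows "(norm (adjoint (S r) p - p))\<^sup>2 \<le> 2 * norm p * norm (S r p - p)"
proof -
  let ?q = "adjoint (S r) p"
  have "?q \<bullet> ?q \<le> p \<bullet> p" using norm_adjoint_S_le[OF assms] by (simp add: norm_le)
  moreover have "p \<bullet> ?q = S r p \<bullet> p" by (rule inner_adjoint_blinfun)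
  ultimately have "(norm (?q - p))\<^sup>2 \<le> 2 * ((p - S r p) \<bullet> p)"
    by (simp add: power2_norm_eq_inner inner_diff_left inner_diff_right inner_commute)
  also have "\<dots> \<le> 2 * (norm (p - S r p) * norm p)" by (intro mult_left_mono norm_cauchy_schwarz) simp
  finally show ?thesis by (simp add: norm_minus_commute mult_ac)
qed

lemma adjoint_S_near_id:
  assumes "e > 0"
  shows "\<exists>d>0. \<forall>h. 0 \<le> h \<and> h < d \<longrightarrow> norm (adjoint (S h) p - p) \<le> e"
proof -
  have "e\<^sup>2 > 0" using assms by simp
  then obtain \<kappa> where \<kappa>: "\<kappa> > 0" "(2 * norm p) * \<kappa> \<le> e\<^sup>2" using small_scale_exists by metis
  obtain d where d: "d > 0" "\<And>h. 0 \<le> h \<Longrightarrow> h < d \<Longrightarrow> norm (S h p - p) < \<kappa>" using S_near_id[OF \<kappa>(1)] by blast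
  have "norm (adjoint (S h) p - p) \<le> e" if "0 \<le> h" "h < d" for h
  proof (rule power2_le_imp_le)
    have "(norm (adjoint (S h) p - p))\<^sup>2 \<le> 2 * norm p * norm (S h p - p)"
      by (rule norm_adjoint_S_diff_power2_le[OF that(1)])
    also have "\<dots> \<le> 2 * norm p * \<kappa>" using d(2)[OF that] by (intro mult_left_mono) auto
    finally show "(norm (adjoint (S h) p - p))\<^sup>2 \<le> e\<^sup>2" using \<kappa>(2) by simp
  qed (use assms in simp)
  then show ?thesis using d(1) by blast
qed

end

locale weak_contraction = generated_contraction domA A S
  for domA :: "'a::{real_inner, banach, second_countable_topology} set"
    and A :: "'a \<Rightarrow> 'a" and S :: "real \<Rightarrow> 'a \<Rightarrow>\<^sub>L 'a" +
  fixes B :: "'a \<Rightarrow>\<^sub>L 'a" and c0 :: real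
  assumes B_self_adjoint: "self_adjoint B"
    and B_strictly_positive: "strictly_positive B"
    and B_adj_domain: "\<forall>x. B x \<in> adj_domain domA A"
    and adj_B_bounded: "bounded_linear (\<lambda>x. adj_op domA A (B x))"
    and c0_nonneg: "c0 \<ge> 0"
    and weak_B_condition: "\<forall>x. (adj_op domA A (B x) + c0 *\<^sub>R B x) \<bullet> x \<ge> 0"
begin

lemma psd_op_B: "psd_op B"
proof -
  have "0 \<le> B x \<bullet> x" for x
    using B_strictly_positive by (cases "x = 0") (auto simp: strictly_positive_def less_imp_le)
  then show ?thesis using B_self_adjoint by (simp add: psd_op_def)
qed

lemmas norm_m1_B_power2 = norm_m1_power2[OF psd_op_B]

lemma weak_energy_derivative:
  assumes x: "x \<in> domA" and s: "0 \<le> s"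
  shows "((\<lambda>s. B (S s x) \<bullet> S s x) has_real_derivative - 2 * (adj_op domA A (B (S s x)) \<bullet> S s x)) (at s within {0..})"
proof -
  have "((\<lambda>s. S s x) has_derivative (\<lambda>h. h *\<^sub>R - A (S s x))) (at s within {0..})"
    using S_has_vector_derivative[OF x s] by (simp only: has_vector_derivative_def)
  then have "((\<lambda>s. B (S s x) \<bullet> S s x) has_derivative
      (\<lambda>h. B (S s x) \<bullet> (h *\<^sub>R - A (S s x)) + B (h *\<^sub>R - A (S s x)) \<bullet> S s x)) (at s within {0..})"
    by (intro has_derivative_inner bounded_linear.has_derivative[OF blinfun.bounded_linear_right])
  moreover have "B (S s x) \<bullet> (h *\<^sub>R - A (S s x)) + B (h *\<^sub>R - A (S s x)) \<bullet> S s x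
      = - 2 * (adj_op domA A (B (S s x)) \<bullet> S s x) * h" for h
  proof -
    have "A (S s x) \<bullet> B (S s x) = adj_op domA A (B (S s x)) \<bullet> S s x"
      using adj_op_eq[OF dense B_adj_domain[rule_format, of "S s x"] S_domA(1)[OF x s]]
      by (simp only: inner_commute)
    moreover have "B (A (S s x)) \<bullet> S s x = A (S s x) \<bullet> B (S s x)"
      using B_self_adjoint by (simp add: self_adjoint_def)
    ultimately show ?thesis
      by (simp add: blinfun.scaleR_right blinfun.minus_right inner_commute[of "B (S s x)"])
  qed
  ultimately show ?thesis unfolding has_field_derivative_def by (simp only:)
qed

lemma norm_m1_S_domA_le:
  assumes x: "x \<in> domA" and r: "0 \<le> r"
  shows "norm_m1 B (S r x) \<le> exp (c0 * r) * norm_m1 B x"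
proof -
  define q where "q s = exp (- 2 * c0 * s) * (B (S s x) \<bullet> S s x)" for s
  have q_deriv: "(q has_real_derivative
      - 2 * exp (- 2 * c0 * s) * ((adj_op domA A (B (S s x)) + c0 *\<^sub>R B (S s x)) \<bullet> S s x)) (at s within {0..})"
    if "0 \<le> s" for s
    unfolding q_def by (auto intro!: derivative_eq_intros weak_energy_derivative[OF x that])
      (simp add: inner_add_left algebra_simps)
  have "q r \<le> q 0"
  proof (rule DERIV_nonpos_imp_decreasing_open[OF r])
    fix s assume "0 < s" "s < r"
    moreover from this have "at s within {0..} = at s" by (intro at_within_interior) simp
    ultimately have "(q has_real_derivative
        - 2 * exp (- 2 * c0 * s) * ((adj_op domA A (B (S s x)) + c0 *\<^sub>R B (S s x)) \<bullet> S s x)) (at s)"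
      using q_deriv[of s] by simp
    moreover have "- 2 * exp (- 2 * c0 * s) * ((adj_op domA A (B (S s x)) + c0 *\<^sub>R B (S s x)) \<bullet> S s x) \<le> 0"
      using weak_B_condition by (intro mult_nonpos_nonneg) auto
    ultimately show "\<exists>D. (q has_real_derivative D) (at s) \<and> D \<le> 0" by blast
  next
    show "continuous_on {0..r} q"
      unfolding q_def by (intro continuous_intros continuous_on_S) auto
  qed
  then have "exp (2 * c0 * r) * (exp (- 2 * c0 * r) * (norm_m1 B (S r x))\<^sup>2) \<le> exp (2 * c0 * r) * (norm_m1 B x)\<^sup>2"
    by (simp add: q_def norm_m1_B_power2)
  then have "(norm_m1 B (S r x))\<^sup>2 \<le> (exp (c0 * r) * norm_m1 B x)\<^sup>2"
    by (simp add: power_mult_distrib mult.assoc[symmetric] exp_double[symmetric] flip: exp_add)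
  then show ?thesis by (rule power2_le_imp_le) simp
qed

lemma norm_m1_S_le:
  assumes r: "0 \<le> r"
  shows "norm_m1 B (S r x) \<le> exp (c0 * r) * norm_m1 B x"
proof -
  obtain xs where xs: "\<And>n. xs n \<in> domA" "xs \<longlonglongrightarrow> x" using domA_approx by metis
  show ?thesis
  proof (rule LIMSEQ_le)
    show "(\<lambda>n. norm_m1 B (S r (xs n))) \<longlonglongrightarrow> norm_m1 B (S r x)"
      unfolding norm_m1_def by (intro tendsto_intros xs)
    show "(\<lambda>n. exp (c0 * r) * norm_m1 B (xs n)) \<longlonglongrightarrow> exp (c0 * r) * norm_m1 B x"
      unfolding norm_m1_def by (intro tendsto_intros xs)
  qed (use norm_m1_S_domA_le[OF xs(1) r] in blast)
qed

lemma norm_m1_S_diff_le: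
  obtains K where "K \<ge> 0" "\<And>r x. 0 \<le> r \<Longrightarrow> norm_m1 B (S r x - x) \<le> K * sqrt r * norm x"
proof -
  obtain K where K: "K > 0" "\<And>x. norm (adj_op domA A (B x)) \<le> norm x * K"
    using bounded_linear.pos_bounded[OF adj_B_bounded] by auto
  show ?thesis
  proof (rule that[of "sqrt (2 * K)"])
    fix r :: real and x assume r: "0 \<le> r"
    define b where "b = adj_op domA A (B (S r x - x))"
    obtain \<rho> where \<rho>: "\<rho> \<in> {0..r}" "(S r x - x) \<bullet> B (S r x - x) = - r * (S \<rho> x \<bullet> b)"
      unfolding b_def using S_mean_value[of "B (S r x - x)" r x] B_adj_domain r by auto
    have "norm (S r x - x) \<le> 2 * norm x"
      using norm_triangle_ineq4[of "S r x" x] norm_S_apply_le[OF r, of x] by simp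
    then have b_le: "norm b \<le> 2 * norm x * K"
      unfolding b_def using K by (intro order_trans[OF K(2)] mult_right_mono) auto
    have "(norm_m1 B (S r x - x))\<^sup>2 = r * - (S \<rho> x \<bullet> b)"
      using \<rho>(2) by (simp add: norm_m1_B_power2 inner_commute)
    also have "\<dots> \<le> r * (norm (S \<rho> x) * norm b)"
      using Cauchy_Schwarz_ineq2[of "S \<rho> x" b] by (intro mult_left_mono r) linarith
    also have "\<dots> \<le> r * (norm x * (2 * norm x * K))"
      using r \<rho>(1) by (intro mult_left_mono mult_mono norm_S_apply_le b_le) auto
    also have "\<dots> = (sqrt (2 * K) * sqrt r * norm x)\<^sup>2"
      using K r by (simp add: power_mult_distrib power2_eq_square[of "norm x"])
    finally show "norm_m1 B (S r x - x) \<le> sqrt (2 * K) * sqrt r * norm x"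
      by (rule power2_le_imp_le) (use K r in auto)
  qed (use K in auto)
qed

lemma norm_m1_S_diff_affine_bound:
  assumes "d > 0"
  obtains C where "C \<ge> 0" "\<And>r x. 0 \<le> r \<Longrightarrow> norm x \<le> R \<Longrightarrow> norm_m1 B (S r x - x) \<le> d + C * r"
proof -
  obtain K where K: "K \<ge> 0" "\<And>r x. 0 \<le> r \<Longrightarrow> norm_m1 B (S r x - x) \<le> K * sqrt r * norm x"
    using norm_m1_S_diff_le by blast
  show ?thesis
  proof (rule that[of "(K * R)\<^sup>2 / (4 * d)"])
    fix r :: real and x :: 'a assume r: "0 \<le> r" and x: "norm x \<le> R"
    have "norm_m1 B (S r x - x) \<le> K * R * sqrt r"
      using mult_left_mono[OF x, of "K * sqrt r"] K(1) r order_trans[OF K(2)[OF r, of x]] by (simp add: mult_ac)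
    moreover have "4 * d * (K * R * sqrt r) \<le> 4 * d * (d + (K * R)\<^sup>2 / (4 * d) * r)"
    proof -
      have "0 \<le> (2 * d - K * R * sqrt r)\<^sup>2" by simp
      also have "\<dots> = 4 * d\<^sup>2 + (K * R)\<^sup>2 * r - 4 * d * (K * R * sqrt r)"
        using r by (simp add: power2_diff power_mult_distrib)
      finally show ?thesis using assms by (simp add: distrib_left power2_eq_square)
    qed
    ultimately show "norm_m1 B (S r x - x) \<le> d + (K * R)\<^sup>2 / (4 * d) * r"
      using assms by simp
  qed (use assms in simp)
qed

end

subsection \<open>The Hamiltonian and the running cost\<close>

lemma exp_remainder_nonneg: "0 \<le> exp a - 1 - (a :: real)"
  using exp_ge_add_one_self[of a] by linarith

lemma abs_exp_minus_one_le: "\<bar>exp a - 1\<bar> \<le> \<bar>a\<bar> * exp \<bar>a :: real\<bar>"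
proof (cases "0 \<le> a")
  case True
  then show ?thesis using exp_increment_bounds(2)[where x = 0 and y = a] by (simp add: mult.commute)
next
  case False
  then have "\<bar>exp a - 1\<bar> \<le> \<bar>a\<bar> * 1" using exp_ge_add_one_self[of a] exp_less_one_iff[of a] by linarith
  also have "\<dots> \<le> \<bar>a\<bar> * exp \<bar>a\<bar>" by (intro mult_left_mono) auto
  finally show ?thesis .
qed

lemma exp_remainder_le: "exp a - 1 - a \<le> a\<^sup>2 * exp \<bar>a :: real\<bar>"
proof -
  have "exp a - 1 - a \<le> a * (exp a - 1)"
    using exp_increment_bounds(2)[where x = 0 and y = a] by (simp add: algebra_simps)
  also have "\<dots> \<le> \<bar>a\<bar> * \<bar>exp a - 1\<bar>" by (metis abs_ge_self abs_mult)
  also have "\<dots> \<le> \<bar>a\<bar> * (\<bar>a\<bar> * exp \<bar>a\<bar>)" by (intro mult_left_mono abs_exp_minus_one_le) auto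
  finally show ?thesis by (simp add: power2_eq_square mult.assoc[symmetric])
qed

lemma e2ennreal_add_ereal:
  assumes "0 \<le> a" "0 \<le> c"
  shows "e2ennreal (a + ereal c) = e2ennreal a + ennreal c"
  using assms by (cases a) (auto simp: ennreal_plus)

locale exponential_levy =
  fixes \<nu> :: "'a::{real_inner, banach, second_countable_topology} measure"
  assumes sets_\<nu>: "sets \<nu> = sets borel"
    and exp_moment: "\<forall>K>0. (\<integral>\<^sup>+z. ennreal ((norm z)\<^sup>2 * exp (K * norm z)) \<partial>\<nu>) < \<infinity>"
begin

lemma borel_measurable_\<nu>: "f \<in> borel_measurable borel \<Longrightarrow> f \<in> borel_measurable \<nu>"
  using measurable_cong_sets[OF sets_\<nu> refl] by blast

lemma integrable_exp_moment: "K > 0 \<Longrightarrow> integrable \<nu> (\<lambda>z. (norm z)\<^sup>2 * exp (K * norm z))"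
  using exp_moment by (intro integrableI_bounded borel_measurable_\<nu>) (auto simp: abs_mult)

lemma exp_remainder_inner_le:
  assumes "norm p \<le> R"
  shows "exp (p \<bullet> z) - 1 - p \<bullet> z \<le> R\<^sup>2 * ((norm z)\<^sup>2 * exp ((R + 1) * norm z))"
proof -
  have inner_le: "\<bar>p \<bullet> z\<bar> \<le> R * norm z"
    by (rule order_trans[OF Cauchy_Schwarz_ineq2]) (intro mult_right_mono assms; simp)
  then have "(p \<bullet> z)\<^sup>2 \<le> (R * norm z)\<^sup>2" by (metis abs_ge_zero power2_abs power_mono)
  moreover have "exp \<bar>p \<bullet> z\<bar> \<le> exp ((R + 1) * norm z)"
    using inner_le norm_ge_zero[of z] by (simp add: distrib_right del: norm_ge_zero)
  ultimately have "(p \<bullet> z)\<^sup>2 * exp \<bar>p \<bullet> z\<bar> \<le> (R * norm z)\<^sup>2 * exp ((R + 1) * norm z)"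
    by (intro mult_mono) auto
  then show ?thesis using exp_remainder_le[of "p \<bullet> z"] by (simp add: power_mult_distrib mult_ac)
qed

lemma integrable_exp_remainder: "integrable \<nu> (\<lambda>z. exp (p \<bullet> z) - 1 - p \<bullet> z)"
proof (rule Bochner_Integration.integrable_bound)
  show "integrable \<nu> (\<lambda>z. (norm p)\<^sup>2 * ((norm z)\<^sup>2 * exp ((norm p + 1) * norm z)))"
    by (intro integrable_mult_right integrable_exp_moment) (simp add: add_nonneg_pos)
  show "AE z in \<nu>. norm (exp (p \<bullet> z) - 1 - p \<bullet> z) \<le> norm ((norm p)\<^sup>2 * ((norm z)\<^sup>2 * exp ((norm p + 1) * norm z)))"
    using exp_remainder_nonneg exp_remainder_inner_le[of p "norm p"] by (intro AE_I2) (simp add: abs_mult)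
qed (intro borel_measurable_\<nu>, measurable)

lemma H0_nonneg: "0 \<le> H0 \<nu> p"
  unfolding H0_def using exp_remainder_nonneg by (intro integral_nonneg_AE AE_I2)

definition H0_bound :: "real \<Rightarrow> real" where
  "H0_bound R = R\<^sup>2 * (\<integral>z. (norm z)\<^sup>2 * exp ((R + 1) * norm z) \<partial>\<nu>)"

lemma H0_bound_nonneg: "0 \<le> H0_bound R"
  unfolding H0_bound_def by (intro mult_nonneg_nonneg integral_nonneg_AE AE_I2) auto

lemma H0_le_H0_bound:
  assumes "norm p \<le> R"
  shows "H0 \<nu> p \<le> H0_bound R"
proof -
  have "R + 1 > 0" using assms norm_ge_zero[of p] by linarith
  then have "integrable \<nu> (\<lambda>z. R\<^sup>2 * ((norm z)\<^sup>2 * exp ((R + 1) * norm z)))"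
    by (intro integrable_mult_right integrable_exp_moment)
  then have "H0 \<nu> p \<le> (\<integral>z. R\<^sup>2 * ((norm z)\<^sup>2 * exp ((R + 1) * norm z)) \<partial>\<nu>)"
    unfolding H0_def by (intro integral_mono integrable_exp_remainder exp_remainder_inner_le assms)
  then show ?thesis by (simp add: H0_bound_def)
qed

lemma isCont_H0: "isCont (H0 \<nu>) p"
  unfolding continuous_at_sequentially comp_def
proof (intro allI impI)
  fix ps assume lim: "ps \<longlonglongrightarrow> p"
  then obtain R where R: "\<And>n. norm (ps n) \<le> R"
    using convergent_imp_Bseq[OF convergentI[OF lim]] by (auto simp: Bseq_def)
  then have "R + 1 > 0" using norm_ge_zero[of "ps 0"] R[of 0] by linarith
  show "(\<lambda>n. H0 \<nu> (ps n)) \<longlonglongrightarrow> H0 \<nu> p"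
    unfolding H0_def
  proof (rule integral_dominated_convergence)
    show "integrable \<nu> (\<lambda>z. R\<^sup>2 * ((norm z)\<^sup>2 * exp ((R + 1) * norm z)))"
      using \<open>R + 1 > 0\<close> by (intro integrable_mult_right integrable_exp_moment)
    show "AE z in \<nu>. norm (exp (ps n \<bullet> z) - 1 - ps n \<bullet> z) \<le> R\<^sup>2 * ((norm z)\<^sup>2 * exp ((R + 1) * norm z))" for n
      using exp_remainder_nonneg exp_remainder_inner_le[OF R] by (intro AE_I2) simp
    show "AE z in \<nu>. (\<lambda>n. exp (ps n \<bullet> z) - 1 - ps n \<bullet> z) \<longlonglongrightarrow> exp (p \<bullet> z) - 1 - p \<bullet> z"
      by (intro AE_I2 tendsto_intros lim)
  qed (intro borel_measurable_\<nu>, measurable)+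
qed

lemma L0_ge: "ereal (z \<bullet> y - H0 \<nu> y) \<le> L0 \<nu> z"
  unfolding L0_def by (rule SUP_upper) simp

lemma L0_nonneg: "0 \<le> L0 \<nu> z"
  using L0_ge[of z 0] by (simp add: H0_def zero_ereal_def)

lemma L0_zero: "L0 \<nu> 0 = ereal 0"
proof (rule antisym)
  show "L0 \<nu> 0 \<le> ereal 0" unfolding L0_def by (rule SUP_least) (simp add: H0_nonneg)
  show "ereal 0 \<le> L0 \<nu> 0" using L0_nonneg by (simp add: zero_ereal_def)
qed

lemma Fenchel_inequality: "ereal (z \<bullet> y) \<le> L0 \<nu> z + ereal (H0 \<nu> y)"
  using L0_ge[of z y] by (cases "L0 \<nu> z") auto

lemma norm_le_L0:
  assumes "0 \<le> R"
  shows "ereal (R * norm z) \<le> L0 \<nu> z + ereal (H0_bound R)"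
proof -
  have "z \<bullet> (R *\<^sub>R sgn z) = R * norm z"
    by (cases "z = 0") (auto simp: sgn_div_norm dot_square_norm power2_eq_square)
  then have "ereal (R * norm z) \<le> L0 \<nu> z + ereal (H0 \<nu> (R *\<^sub>R sgn z))"
    using Fenchel_inequality[of z "R *\<^sub>R sgn z"] by (simp only:)
  also have "\<dots> \<le> L0 \<nu> z + ereal (H0_bound R)"
    using H0_le_H0_bound[of "R *\<^sub>R sgn z" R] assms by (intro add_left_mono) (simp add: norm_sgn)
  finally show ?thesis .
qed

lemma borel_measurable_L0 [measurable]: "L0 \<nu> \<in> borel_measurable borel"
proof (rule borel_measurableI_greater)
  fix c
  have "{z. c < L0 \<nu> z} = (\<Union>y. {z. c < ereal (z \<bullet> y - H0 \<nu> y)})"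
    by (auto simp: L0_def less_SUP_iff)
  also have "open \<dots>" by (intro open_UN ballI open_Collect_less continuous_intros)
  finally show "{z \<in> space borel. c < L0 \<nu> z} \<in> sets borel" by simp
qed

definition H0_gradient :: "'a \<Rightarrow> 'a" where
  "H0_gradient p = (\<integral>z. (exp (p \<bullet> z) - 1) *\<^sub>R z \<partial>\<nu>)"

lemma integrable_H0_gradient: "integrable \<nu> (\<lambda>z. (exp (p \<bullet> z) - 1) *\<^sub>R z)"
proof (rule Bochner_Integration.integrable_bound)
  show "integrable \<nu> (\<lambda>z. norm p * ((norm z)\<^sup>2 * exp ((norm p + 1) * norm z)))"
    by (intro integrable_mult_right integrable_exp_moment) (simp add: add_nonneg_pos)
  show "AE z in \<nu>. norm ((exp (p \<bullet> z) - 1) *\<^sub>R z) \<le> norm (norm p * ((norm z)\<^sup>2 * exp ((norm p + 1) * norm z)))"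
  proof (rule AE_I2)
    fix z
    have inner_le: "\<bar>p \<bullet> z\<bar> \<le> norm p * norm z" by (rule Cauchy_Schwarz_ineq2)
    then have "\<bar>p \<bullet> z\<bar> \<le> (norm p + 1) * norm z"
      using norm_ge_zero[of z] by (simp add: distrib_right del: norm_ge_zero)
    then have "\<bar>exp (p \<bullet> z) - 1\<bar> \<le> norm p * norm z * exp ((norm p + 1) * norm z)"
      using inner_le by (intro order_trans[OF abs_exp_minus_one_le] mult_mono) auto
    then have "\<bar>exp (p \<bullet> z) - 1\<bar> * norm z \<le> norm p * norm z * exp ((norm p + 1) * norm z) * norm z"
      by (rule mult_right_mono) simp
    then show "norm ((exp (p \<bullet> z) - 1) *\<^sub>R z) \<le> norm (norm p * ((norm z)\<^sup>2 * exp ((norm p + 1) * norm z)))"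
      by (simp add: abs_mult power2_eq_square mult_ac)
  qed
qed (intro borel_measurable_\<nu>, measurable)

lemma H0_subgradient: "H0_gradient p \<bullet> (y - p) \<le> H0 \<nu> y - H0 \<nu> p"
proof -
  have "H0_gradient p \<bullet> (y - p) = (\<integral>z. (exp (p \<bullet> z) - 1) * (z \<bullet> (y - p)) \<partial>\<nu>)"
    unfolding H0_gradient_def using integral_inner_left[OF integrable_H0_gradient[of p], of "y - p"] by simp
  also have "\<dots> \<le> (\<integral>z. (exp (y \<bullet> z) - 1 - y \<bullet> z) - (exp (p \<bullet> z) - 1 - p \<bullet> z) \<partial>\<nu>)"
  proof (rule integral_mono)
    show "integrable \<nu> (\<lambda>z. (exp (p \<bullet> z) - 1) * (z \<bullet> (y - p)))"
      using integrable_inner_left[OF integrable_H0_gradient[of p], of "y - p"] by simp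
    show "integrable \<nu> (\<lambda>z. (exp (y \<bullet> z) - 1 - y \<bullet> z) - (exp (p \<bullet> z) - 1 - p \<bullet> z))"
      by (intro Bochner_Integration.integrable_diff integrable_exp_remainder)
    show "(exp (p \<bullet> z) - 1) * (z \<bullet> (y - p)) \<le> exp (y \<bullet> z) - 1 - y \<bullet> z - (exp (p \<bullet> z) - 1 - p \<bullet> z)" for z
      using exp_increment_bounds(1)[where x = "p \<bullet> z" and y = "y \<bullet> z"]
      by (simp add: inner_diff_right inner_commute[of z] algebra_simps)
  qed
  also have "\<dots> = H0 \<nu> y - H0 \<nu> p"
    unfolding H0_def by (intro Bochner_Integration.integral_diff integrable_exp_remainder)
  finally show ?thesis .
qed

lemma L0_H0_gradient: "L0 \<nu> (H0_gradient p) = ereal (H0_gradient p \<bullet> p - H0 \<nu> p)"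
proof (rule antisym)
  have "H0_gradient p \<bullet> y - H0 \<nu> y \<le> H0_gradient p \<bullet> p - H0 \<nu> p" for y
    using H0_subgradient[of p y] by (simp add: inner_diff_right)
  then show "L0 \<nu> (H0_gradient p) \<le> ereal (H0_gradient p \<bullet> p - H0 \<nu> p)"
    unfolding L0_def by (intro SUP_least) simp
qed (rule L0_ge)

abbreviation cost :: "real \<Rightarrow> real \<Rightarrow> (real \<Rightarrow> 'a) \<Rightarrow> real" where
  "cost b a u \<equiv> enn2real (running_cost \<nu> b a u)"

definition admissible :: "real \<Rightarrow> real \<Rightarrow> (real \<Rightarrow> 'a) \<Rightarrow> bool" where
  "admissible b a u \<longleftrightarrow> u \<in> controls b a \<and> running_cost \<nu> b a u < \<infinity>"

lemma borel_measurable_cost: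
  assumes "u \<in> controls b a"
  shows "(\<lambda>s. e2ennreal (L0 \<nu> (u s)) * indicator {a..b} s) \<in> borel_measurable lebesgue"
proof -
  have "u \<in> borel_measurable (lebesgue_on {a..b})"
    using assms by (simp add: controls_def set_borel_measurable_iff_lebesgue_on)
  then have "(\<lambda>s. e2ennreal (L0 \<nu> (u s))) \<in> borel_measurable (lebesgue_on {a..b})" by measurable
  then show ?thesis by (subst (asm) borel_measurable_restrict_space_iff_ennreal) auto
qed

lemma controls_subinterval:
  assumes "u \<in> controls b a" "a \<le> c" "d \<le> b"
  shows "u \<in> controls d c"
  using assms by (auto simp: controls_def intro: set_borel_measurable_subset)

lemma running_cost_split:
  assumes u: "u \<in> controls b a" and r: "a \<le> r" "r \<le> b"
  shows "running_cost \<nu> b a u = running_cost \<nu> r a u + running_cost \<nu> b r u"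
proof -
  have "running_cost \<nu> b a u = (\<integral>\<^sup>+s. e2ennreal (L0 \<nu> (u s)) * indicator {a..r} s
      + e2ennreal (L0 \<nu> (u s)) * indicator {r..b} s \<partial>lebesgue)"
    unfolding running_cost_def
    by (intro nn_integral_cong_AE eventually_mono[OF AE_lebesgue_neq[of r]]) (use r in \<open>auto simp: indicator_def\<close>)
  also have "\<dots> = running_cost \<nu> r a u + running_cost \<nu> b r u"
    unfolding running_cost_def
    by (intro nn_integral_add borel_measurable_cost controls_subinterval[OF u]) (use r in auto)
  finally show ?thesis .
qed

lemma admissible_split:
  assumes "admissible b a u" "a \<le> r" "r \<le> b"
  shows "admissible r a u" "admissible b r u" "cost b a u = cost r a u + cost b r u"
proof -
  have u: "u \<in> controls b a" and total: "running_cost \<nu> b a u < \<infinity>" using assms by (auto simp: admissible_def)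
  have finite: "running_cost \<nu> r a u < \<infinity>" "running_cost \<nu> b r u < \<infinity>"
    using total unfolding running_cost_split[OF u assms(2,3)] by auto
  then show "admissible r a u" "admissible b r u"
    using controls_subinterval[OF u] assms by (auto simp: admissible_def)
  show "cost b a u = cost r a u + cost b r u"
    unfolding running_cost_split[OF u assms(2,3)] using finite by (intro enn2real_plus) auto
qed

lemma admissible_const:
  assumes "L0 \<nu> u = ereal l" "a \<le> b"
  shows "admissible b a (\<lambda>_. u)" "cost b a (\<lambda>_. u) = l * (b - a)"
proof -
  have l: "0 \<le> l" using L0_nonneg[of u] assms by simp
  have const: "running_cost \<nu> b a (\<lambda>_. u) = ennreal (l * (b - a))"
    unfolding running_cost_def using assms l by (simp add: nn_integral_cmult_indicator ennreal_mult)
  then show "admissible b a (\<lambda>_. u)" by (simp add: admissible_def controls_def set_borel_measurable_continuous)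
  show "cost b a (\<lambda>_. u) = l * (b - a)" unfolding const using l assms by (intro enn2real_ennreal) simp
qed

lemma controls_concat:
  assumes "u \<in> controls r a" "w \<in> controls b r" "a \<le> r" "r \<le> b"
  shows "(\<lambda>s. if s \<le> r then u s else w s) \<in> controls b a"
proof -
  have "(\<lambda>s. indicat_real {a..b} s *\<^sub>R (if s \<le> r then u s else w s))
      = (\<lambda>s. indicat_real {a..r} s *\<^sub>R u s + indicat_real {r<..b} s *\<^sub>R w s)"
    using assms(3,4) by (auto simp: indicator_def fun_eq_iff)
  moreover have "set_borel_measurable lebesgue {r<..b} w"
    by (rule set_borel_measurable_subset[of _ "{r..b}"]) (use assms(2) in \<open>auto simp: controls_def\<close>)
  ultimately show ?thesis
    using assms(1) by (auto simp: set_borel_measurable_def controls_def intro!: borel_measurable_add)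
qed

lemma admissible_concat:
  fixes u w :: "real \<Rightarrow> 'a"
  assumes u: "admissible r a u" and w: "admissible b r w" and r: "a \<le> r" "r \<le> b"
  defines "c \<equiv> \<lambda>s. if s \<le> r then u s else w s"
  shows "admissible b a c" "cost b a c = cost r a u + cost b r w"
proof -
  have c: "c \<in> controls b a"
    unfolding c_def using u w r by (intro controls_concat) (auto simp: admissible_def)
  have "running_cost \<nu> r a c = running_cost \<nu> r a u"
    unfolding running_cost_def by (intro nn_integral_cong) (simp add: c_def indicator_def)
  moreover have "running_cost \<nu> b r c = running_cost \<nu> b r w"
    unfolding running_cost_def
    by (intro nn_integral_cong_AE eventually_mono[OF AE_lebesgue_neq[of r]]) (auto simp: c_def indicator_def)
  ultimately have split: "running_cost \<nu> b a c = running_cost \<nu> r a u + running_cost \<nu> b r w"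
    using running_cost_split[OF c r] by simp
  then show "admissible b a c" using c u w by (simp add: admissible_def)
  show "cost b a c = cost r a u + cost b r w"
    unfolding split using u w by (intro enn2real_plus) (auto simp: admissible_def)
qed

lemma nn_integral_le_running_cost:
  assumes u: "u \<in> controls b a" and "a \<le> b" and C: "0 \<le> C"
    and bound: "\<And>s. s \<in> {a..b} \<Longrightarrow> ereal (f s) \<le> L0 \<nu> (u s) + ereal C"
  shows "(\<integral>\<^sup>+s. ennreal (indicator {a..b} s * f s) \<partial>lebesgue) \<le> running_cost \<nu> b a u + ennreal (C * (b - a))"
proof -
  have "(\<integral>\<^sup>+s. ennreal (indicator {a..b} s * f s) \<partial>lebesgue)
      \<le> (\<integral>\<^sup>+s. e2ennreal (L0 \<nu> (u s)) * indicator {a..b} s + ennreal C * indicator {a..b} s \<partial>lebesgue)"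
  proof (rule nn_integral_mono)
    fix s
    show "ennreal (indicator {a..b} s * f s) \<le> e2ennreal (L0 \<nu> (u s)) * indicator {a..b} s + ennreal C * indicator {a..b} s"
    proof (cases "s \<in> {a..b}")
      case True
      have "ennreal (f s) = e2ennreal (ereal (f s))" by simp
      also have "\<dots> \<le> e2ennreal (L0 \<nu> (u s) + ereal C)" by (intro e2ennreal_mono bound True)
      also have "\<dots> = e2ennreal (L0 \<nu> (u s)) + ennreal C"
        using L0_nonneg C by (rule e2ennreal_add_ereal)
      finally show ?thesis using True by simp
    qed simp
  qed
  also have "\<dots> = running_cost \<nu> b a u + (\<integral>\<^sup>+s. ennreal C * indicator {a..b} s \<partial>lebesgue)"
    unfolding running_cost_def
    by (intro nn_integral_add borel_measurable_cost u borel_measurable_times_ennreal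
        borel_measurable_const borel_measurable_indicator) auto
  also have "(\<integral>\<^sup>+s. ennreal C * indicator {a..b} s \<partial>lebesgue) = ennreal (C * (b - a))"
    using \<open>a \<le> b\<close> C by (simp add: nn_integral_cmult_indicator ennreal_mult)
  finally show ?thesis .
qed

lemma admissible_integrable:
  assumes "admissible b a u"
  shows "set_integrable lebesgue {a..b} u"
proof (cases "a \<le> b")
  case True
  have "(\<integral>\<^sup>+s. ennreal (norm (indicator {a..b} s *\<^sub>R u s)) \<partial>lebesgue)
      = (\<integral>\<^sup>+s. ennreal (indicator {a..b} s * norm (u s)) \<partial>lebesgue)" by simp
  also have "\<dots> \<le> running_cost \<nu> b a u + ennreal (H0_bound 1 * (b - a))"
    using assms norm_le_L0[of 1] True
    by (intro nn_integral_le_running_cost H0_bound_nonneg) (auto simp: admissible_def)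
  also have "\<dots> < \<infinity>" using assms by (simp add: admissible_def less_top)
  finally show ?thesis
    unfolding set_integrable_def using assms
    by (intro integrableI_bounded) (auto simp: admissible_def controls_def set_borel_measurable_def)
qed simp

lemma set_integral_le_cost:
  assumes u: "admissible b a u" and "a \<le> b" and C: "0 \<le> C"
    and f: "set_integrable lebesgue {a..b} f"
    and bound: "\<And>s. s \<in> {a..b} \<Longrightarrow> ereal (f s) \<le> L0 \<nu> (u s) + ereal C"
  shows "(LINT s:{a..b}|lebesgue. f s) \<le> cost b a u + C * (b - a)"
proof -
  have "(LINT s:{a..b}|lebesgue. f s) \<le> enn2real (\<integral>\<^sup>+s. ennreal (indicator {a..b} s * f s) \<partial>lebesgue)"
    using f unfolding set_lebesgue_integral_def set_integrable_def by (simp add: real_lebesgue_integral_def)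
  also have "\<dots> \<le> enn2real (running_cost \<nu> b a u + ennreal (C * (b - a)))"
  proof (rule enn2real_mono)
    show "running_cost \<nu> b a u + ennreal (C * (b - a)) < top"
      using u by (simp add: admissible_def less_top)
  qed (use u in \<open>intro nn_integral_le_running_cost \<open>a \<le> b\<close> C bound; simp add: admissible_def\<close>)
  also have "\<dots> = cost b a u + C * (b - a)"
    using u \<open>a \<le> b\<close> C by (subst enn2real_plus) (auto simp: admissible_def less_top)
  finally show ?thesis .
qed

lemma set_integral_inner_le_cost:
  assumes "admissible b a u" "a \<le> b" "0 \<le> C" "set_integrable lebesgue {a..b} (\<lambda>s. u s \<bullet> w s)"
    and H0_le: "\<And>s. s \<in> {a..b} \<Longrightarrow> H0 \<nu> (w s) \<le> C"
  shows "(LINT s:{a..b}|lebesgue. u s \<bullet> w s) \<le> cost b a u + C * (b - a)"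
proof (rule set_integral_le_cost[OF assms(1-4)])
  fix s assume "s \<in> {a..b}"
  then have "L0 \<nu> (u s) + ereal (H0 \<nu> (w s)) \<le> L0 \<nu> (u s) + ereal C"
    by (intro add_left_mono) (simp add: H0_le)
  then show "ereal (u s \<bullet> w s) \<le> L0 \<nu> (u s) + ereal C"
    by (rule order_trans[OF Fenchel_inequality])
qed

lemma set_integral_norm_control_le:
  assumes "admissible b a u" "a \<le> b" "0 \<le> R"
  shows "R * (LINT s:{a..b}|lebesgue. norm (u s)) \<le> cost b a u + H0_bound R * (b - a)"
proof -
  have "set_integrable lebesgue {a..b} (\<lambda>s. R * norm (u s))"
    by (intro set_integrable_mult_right set_integrable_norm admissible_integrable assms)
  from set_integral_le_cost[OF assms(1,2) H0_bound_nonneg this norm_le_L0[OF assms(3)]]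
  show ?thesis by simp
qed

end

subsection \<open>Mild solutions\<close>

locale control_system = weak_contraction domA A S B c0
  for domA :: "'a::{real_inner, banach, second_countable_topology} set"
    and A :: "'a \<Rightarrow> 'a" and S :: "real \<Rightarrow> 'a \<Rightarrow>\<^sub>L 'a" and B :: "'a \<Rightarrow>\<^sub>L 'a" and c0 :: real +
  fixes F :: "'a \<Rightarrow> 'a" and G :: "'a \<Rightarrow> 'a \<Rightarrow>\<^sub>L 'a" and M :: real
  assumes M_nonneg: "M \<ge> 0"
    and norm_F_0_le: "norm (F 0) \<le> M"
    and F_weak_lipschitz: "\<forall>x y. norm (F x - F y) \<le> M * norm_m1 B (x - y)"
    and G_weak_lipschitz: "\<forall>x y. norm (G x - G y) \<le> M * norm_m1 B (x - y)"
    and norm_G_le: "\<forall>x. norm (G x) \<le> M"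
begin

abbreviation "mild \<equiv> mild_solution S F G"

definition Lip :: real where "Lip = M * norm (sqrt_op B)"

definition drift :: "'a \<Rightarrow> 'a \<Rightarrow> 'a" where "drift x u = F x + G x u"

lemma Lip_nonneg: "0 \<le> Lip"
  using M_nonneg by (simp add: Lip_def)

lemma M_norm_m1_le: "M * norm_m1 B x \<le> Lip * norm x"
  unfolding Lip_def mult.assoc by (intro mult_left_mono norm_m1_le M_nonneg)

lemma F_lipschitz: "norm (F x - F y) \<le> Lip * norm (x - y)"
  using F_weak_lipschitz M_norm_m1_le order_trans by blast

lemma G_lipschitz: "norm (G x - G y) \<le> Lip * norm (x - y)"
  using G_weak_lipschitz M_norm_m1_le order_trans by blast

lemma drift_growth: "norm (drift x u) \<le> M + Lip * norm x + M * norm u"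
proof -
  have "norm (F x) \<le> M + Lip * norm x"
    using F_lipschitz[of x 0] norm_F_0_le norm_triangle_ineq[of "F x - F 0" "F 0"] by simp
  moreover have "norm (G x u) \<le> M * norm u"
    using norm_blinfun[of "G x" u] mult_right_mono[of "norm (G x)" M "norm u"] norm_G_le order_trans by auto
  ultimately show ?thesis unfolding drift_def using norm_triangle_ineq[of "F x" "G x u"] by linarith
qed

lemma drift_weak_lipschitz: "norm (drift x u - drift y u) \<le> M * (1 + norm u) * norm_m1 B (x - y)"
proof -
  have "norm ((G x - G y) u) \<le> M * norm_m1 B (x - y) * norm u"
    by (rule order_trans[OF norm_blinfun]) (intro mult_right_mono G_weak_lipschitz[rule_format]; simp)
  moreover have "drift x u - drift y u = (F x - F y) + (G x - G y) u"
    by (simp add: drift_def blinfun.diff_left)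
  ultimately have "norm (drift x u - drift y u) \<le> M * norm_m1 B (x - y) + M * norm_m1 B (x - y) * norm u"
    using F_weak_lipschitz[rule_format, of x y] norm_triangle_ineq[of "F x - F y" "(G x - G y) u"] by (simp only:)
  then show ?thesis by (simp add: algebra_simps)
qed

lemma drift_lipschitz: "norm (drift x u - drift y u) \<le> Lip * (1 + norm u) * norm (x - y)"
proof -
  have "M * (1 + norm u) * norm_m1 B (x - y) = (1 + norm u) * (M * norm_m1 B (x - y))" by simp
  also have "\<dots> \<le> (1 + norm u) * (Lip * norm (x - y))" by (intro mult_left_mono M_norm_m1_le) simp
  finally show ?thesis using drift_weak_lipschitz[of x u y] by (simp add: mult_ac)
qed

lemma continuous_drift: "continuous_on UNIV (\<lambda>p. drift (fst p) (snd p))"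
proof -
  have "Lip-lipschitz_on UNIV F" "Lip-lipschitz_on UNIV G"
    by (auto intro!: lipschitz_onI simp: dist_norm F_lipschitz G_lipschitz Lip_nonneg)
  then have "continuous_on UNIV (\<lambda>p. F (fst p))" "continuous_on UNIV (\<lambda>p. G (fst p))"
    using continuous_on_compose2[OF lipschitz_on_continuous_on continuous_on_fst[OF continuous_on_id]] by blast+
  then show ?thesis unfolding drift_def by (intro continuous_intros) auto
qed

lemma set_integrable_growth:
  fixes t T :: real and u :: "real \<Rightarrow> 'a"
  assumes X: "continuous_on {t..T} X" and u: "set_integrable lebesgue {t..T} u"
  shows "set_integrable lebesgue {t..T} (\<lambda>\<tau>. M + Lip * norm (X \<tau>) + M * norm (u \<tau>))"
proof (rule set_integral_add(1))
  show "set_integrable lebesgue {t..T} (\<lambda>\<tau>. M + Lip * norm (X \<tau>))"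
    by (intro set_integrable_continuous_interval continuous_intros X)
qed (intro set_integrable_mult_right set_integrable_norm u)

lemma set_integrable_kernel:
  fixes t T :: real and u :: "real \<Rightarrow> 'a"
  assumes "set_integrable lebesgue {t..T} u"
  shows "set_integrable lebesgue {t..T} (\<lambda>\<tau>. c * (1 + norm (u \<tau>)))"
  by (rule set_integrable_mult_right,
      rule set_integral_add(1)[OF set_integrable_continuous_interval set_integrable_norm[OF assms]],
      rule continuous_on_const)

lemma set_integral_kernel:
  fixes t T :: real and u :: "real \<Rightarrow> 'a"
  assumes "t \<le> T" "set_integrable lebesgue {t..T} u"
  shows "(LINT \<tau>:{t..T}|lebesgue. c * (1 + norm (u \<tau>))) = c * ((T - t) + (LINT \<tau>:{t..T}|lebesgue. norm (u \<tau>)))"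
  using assms by (simp add: set_integral_add set_integrable_norm set_integrable_continuous_interval
      set_integral_const_interval)

lemma set_integrable_drift:
  fixes t T :: real
  assumes X: "continuous_on {t..T} X" and u: "set_integrable lebesgue {t..T} u"
  shows "set_integrable lebesgue {t..T} (\<lambda>\<tau>. drift (X \<tau>) (u \<tau>))"
proof (rule set_integrable_dominated[OF set_integrable_growth[OF assms]])
  show "set_borel_measurable lebesgue {t..T} (\<lambda>\<tau>. drift (X \<tau>) (u \<tau>))"
    unfolding set_borel_measurable_iff_lebesgue_on
    by (rule borel_measurable_continuous_Pair[OF _ _ continuous_drift])
       (use set_borel_measurable_continuous[OF X] set_borel_measurable_of_integrable[OF u]
         in \<open>auto simp: set_borel_measurable_iff_lebesgue_on\<close>)
qed (rule drift_growth)

lemma set_borel_measurable_S: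
  assumes "set_integrable lebesgue {t..T} f"
  shows "set_borel_measurable lebesgue {t..T} (\<lambda>\<tau>. S (max 0 (s - \<tau>)) (f \<tau>))"
  using set_borel_measurable_of_integrable[OF assms] unfolding set_borel_measurable_iff_lebesgue_on
  by (rule borel_measurable_S[OF continuous_imp_measurable_on_sets_lebesgue, rotated 2]) (auto intro!: continuous_intros)

lemma set_integrable_S:
  assumes "set_integrable lebesgue {t..T} f" "s \<in> {t..T}"
  shows "set_integrable lebesgue {t..s} (\<lambda>\<tau>. S (s - \<tau>) (f \<tau>))"
proof -
  have f: "set_integrable lebesgue {t..s} f" by (rule set_integrable_subinterval[OF assms(1)]) (use assms in auto)
  have "set_integrable lebesgue {t..s} (\<lambda>\<tau>. S (max 0 (s - \<tau>)) (f \<tau>))"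
    by (rule set_integrable_dominated[OF set_integrable_norm[OF f] set_borel_measurable_S[OF f]])
       (simp add: norm_S_apply_le)
  then show ?thesis by (subst set_integrable_cong[OF refl refl]) (auto simp: max_def)
qed

lemma continuous_on_convolution:
  assumes f: "set_integrable lebesgue {t..T} f"
  shows "continuous_on {t..T} (\<lambda>s. LINT \<tau>:{t..s}|lebesgue. S (s - \<tau>) (f \<tau>))"
proof -
  have "continuous_on {t..T} (\<lambda>s. LINT \<tau>:{t..s}|lebesgue. S (max 0 (s - \<tau>)) (f \<tau>))"
    by (rule continuous_on_set_integral_param[OF set_integrable_norm[OF f] set_borel_measurable_S[OF f]],
        simp add: norm_S_apply_le, rule continuous_on_S) (auto intro!: continuous_intros)
  moreover have "(LINT \<tau>:{t..s}|lebesgue. S (max 0 (s - \<tau>)) (f \<tau>)) = (LINT \<tau>:{t..s}|lebesgue. S (s - \<tau>) (f \<tau>))" for s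
    by (rule set_lebesgue_integral_cong) (auto simp: max_def)
  ultimately show ?thesis by simp
qed

definition Picard :: "real \<Rightarrow> 'a \<Rightarrow> (real \<Rightarrow> 'a) \<Rightarrow> (real \<Rightarrow> 'a) \<Rightarrow> real \<Rightarrow> 'a" where
  "Picard t x u X s = S (s - t) x + (LINT \<tau>:{t..s}|lebesgue. S (s - \<tau>) (drift (X \<tau>) (u \<tau>)))"

lemma mild_iff_Picard:
  assumes "set_integrable lebesgue {t..T} u"
  shows "mild T t x u X \<longleftrightarrow> continuous_on {t..T} X \<and> (\<forall>s\<in>{t..T}. X s = Picard t x u X s)"
proof -
  have "set_integrable lebesgue {t..s} (\<lambda>\<tau>. S (s - \<tau>) (F (X \<tau>) + G (X \<tau>) (u \<tau>)))"
    if "continuous_on {t..T} X" "s \<in> {t..T}" for s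
    using set_integrable_S[OF set_integrable_drift[OF that(1) assms] that(2)] by (simp add: drift_def)
  then show ?thesis unfolding mild_solution_def Picard_def drift_def by blast
qed

lemma mild_continuous: "mild T t x u X \<Longrightarrow> continuous_on {t..T} X"
  by (simp add: mild_solution_def)

lemma mild_eq_Picard:
  assumes "set_integrable lebesgue {t..T} u" "mild T t x u X" "s \<in> {t..T}"
  shows "X s = Picard t x u X s"
  using assms mild_iff_Picard by blast

lemma continuous_on_Picard:
  assumes "continuous_on {t..T} X" "set_integrable lebesgue {t..T} u"
  shows "continuous_on {t..T} (Picard t x u X)"
  unfolding Picard_def
  by (rule continuous_on_add[OF continuous_on_S continuous_on_convolution[OF set_integrable_drift[OF assms]]])
     (auto intro!: continuous_intros)

lemma Picard_diff:
  assumes X: "continuous_on {t..T} X" and Y: "continuous_on {t..T} Y"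
    and u: "set_integrable lebesgue {t..T} u" and s: "s \<in> {t..T}"
  shows "set_integrable lebesgue {t..s} (\<lambda>\<tau>. S (s - \<tau>) (drift (X \<tau>) (u \<tau>) - drift (Y \<tau>) (u \<tau>)))"
    "Picard t x u X s - Picard t y u Y s =
      S (s - t) (x - y) + (LINT \<tau>:{t..s}|lebesgue. S (s - \<tau>) (drift (X \<tau>) (u \<tau>) - drift (Y \<tau>) (u \<tau>)))"
proof -
  note diff = set_integral_diff[OF set_integrable_S[OF set_integrable_drift[OF X u] s]
      set_integrable_S[OF set_integrable_drift[OF Y u] s]]
  show "set_integrable lebesgue {t..s} (\<lambda>\<tau>. S (s - \<tau>) (drift (X \<tau>) (u \<tau>) - drift (Y \<tau>) (u \<tau>)))"
    unfolding blinfun.diff_right by (rule diff(1))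
  show "Picard t x u X s - Picard t y u Y s =
      S (s - t) (x - y) + (LINT \<tau>:{t..s}|lebesgue. S (s - \<tau>) (drift (X \<tau>) (u \<tau>) - drift (Y \<tau>) (u \<tau>)))"
    unfolding Picard_def blinfun.diff_right diff(2) by simp
qed

lemma norm_Picard_diff_le:
  assumes X: "continuous_on {t..T} X" and Y: "continuous_on {t..T} Y"
    and u: "set_integrable lebesgue {t..T} u" and s: "s \<in> {t..T}"
  shows "norm (Picard t x u X s - Picard t x u Y s) \<le>
    (LINT \<tau>:{t..s}|lebesgue. Lip * (1 + norm (u \<tau>)) * norm (X \<tau> - Y \<tau>))"
  unfolding Picard_diff(2)[OF assms] diff_self blinfun.zero_right add_0
proof (rule norm_set_integral_le[OF Picard_diff(1)[OF assms]])
  have "set_integrable lebesgue {t..s} u" by (rule set_integrable_subinterval[OF u]) (use s in auto)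
  then show "set_integrable lebesgue {t..s} (\<lambda>\<tau>. Lip * (1 + norm (u \<tau>)) * norm (X \<tau> - Y \<tau>))"
    by (intro set_integrable_mult_continuous set_integrable_kernel
        continuous_intros continuous_on_subset[OF X] continuous_on_subset[OF Y]) (use s in auto)
  fix \<tau> assume "\<tau> \<in> {t..s}"
  then show "norm (S (s - \<tau>) (drift (X \<tau>) (u \<tau>) - drift (Y \<tau>) (u \<tau>))) \<le> Lip * (1 + norm (u \<tau>)) * norm (X \<tau> - Y \<tau>)"
    by (intro order_trans[OF norm_S_apply_le drift_lipschitz]) auto
qed

lemma mild_unique:
  assumes u: "set_integrable lebesgue {t..T} u"
    and X: "mild T t x u X" and Y: "mild T t x u Y" and s: "s \<in> {t..T}"
  shows "X s = Y s"
proof -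
  note cont = mild_continuous[OF X] mild_continuous[OF Y]
  have "norm (X s - Y s) \<le> 0 * exp (LINT \<tau>:{t..s}|lebesgue. Lip * (1 + norm (u \<tau>)))"
  proof (rule Gronwall_integrable_kernel[OF set_integrable_kernel[OF u] _ _ _ _ s])
    show "continuous_on {t..T} (\<lambda>s. norm (X s - Y s))" by (intro continuous_intros cont)
    show "norm (X s - Y s) \<le> 0 + (LINT \<tau>:{t..s}|lebesgue. Lip * (1 + norm (u \<tau>)) * norm (X \<tau> - Y \<tau>))"
      if "s \<in> {t..T}" for s
      using norm_Picard_diff_le[OF cont u that] mild_eq_Picard[OF u X that] mild_eq_Picard[OF u Y that] by simp
  qed (auto simp: Lip_nonneg)
  then show ?thesis by simp
qed

lemma mild_exists:
  assumes u: "set_integrable lebesgue {t..T} u" and "t \<le> T"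
  shows "\<exists>X. mild T t x u X"
  unfolding mild_iff_Picard[OF u]
proof (rule Volterra_fixed_point[OF set_integrable_kernel[OF u] _ \<open>t \<le> T\<close>])
  show "0 \<le> Lip * (1 + norm (u \<tau>))" for \<tau> using Lip_nonneg by simp
qed (rule continuous_on_Picard[OF _ u] norm_Picard_diff_le[OF _ _ u]; assumption)+

lemma mild_cong:
  assumes "\<And>s. s \<in> {t..T} \<Longrightarrow> X s = Y s" "\<And>s. s \<in> {t..T} \<Longrightarrow> u s = w s"
  shows "mild T t x u X \<longleftrightarrow> mild T t x w Y"
proof -
  have "set_integrable lebesgue {t..s} (\<lambda>\<tau>. S (s - \<tau>) (F (X \<tau>) + G (X \<tau>) (u \<tau>)))
      \<longleftrightarrow> set_integrable lebesgue {t..s} (\<lambda>\<tau>. S (s - \<tau>) (F (Y \<tau>) + G (Y \<tau>) (w \<tau>)))"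
    "(LINT \<tau>:{t..s}|lebesgue. S (s - \<tau>) (F (X \<tau>) + G (X \<tau>) (u \<tau>)))
      = (LINT \<tau>:{t..s}|lebesgue. S (s - \<tau>) (F (Y \<tau>) + G (Y \<tau>) (w \<tau>)))" if "s \<in> {t..T}" for s
    using that assms by (intro set_integrable_cong set_lebesgue_integral_cong; auto)+
  moreover have "continuous_on {t..T} X \<longleftrightarrow> continuous_on {t..T} Y" by (rule continuous_on_cong[OF refl assms(1)])
  ultimately show ?thesis
    unfolding mild_solution_def using assms(1) by (intro conj_cong ball_cong) simp_all
qed

lemma mild_cong_except_point:
  assumes u: "set_integrable lebesgue {t..r} u" and w: "set_integrable lebesgue {t..r} w"
    and agree: "\<And>s. s \<in> {t..r} \<Longrightarrow> s \<noteq> c \<Longrightarrow> u s = w s" and X: "mild r t x u X"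
  shows "mild r t x w X"
proof -
  note cont = mild_continuous[OF X]
  have "X s = Picard t x w X s" if s: "s \<in> {t..r}" for s
  proof -
    have ae: "AE \<tau> in lebesgue. indicat_real {t..s} \<tau> *\<^sub>R S (s - \<tau>) (drift (X \<tau>) (u \<tau>))
        = indicat_real {t..s} \<tau> *\<^sub>R S (s - \<tau>) (drift (X \<tau>) (w \<tau>))"
      using AE_lebesgue_neq[of c] by eventually_elim (use agree s in \<open>auto simp: indicator_def\<close>)
    have "Picard t x u X s = Picard t x w X s"
      unfolding Picard_def set_lebesgue_integral_def
      using integral_cong_AE[OF _ _ ae] set_integrable_S[OF set_integrable_drift[OF cont u] s]
        set_integrable_S[OF set_integrable_drift[OF cont w] s]
      by (simp add: set_integrable_def borel_measurable_integrable)
    then show ?thesis using mild_eq_Picard[OF u X s] by simp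
  qed
  then show ?thesis unfolding mild_iff_Picard[OF w] using cont by simp
qed

lemma the_mild_solution_mild:
  assumes u: "set_integrable lebesgue {t..T} u" and "t \<le> T"
  shows "mild T t x u (the_mild_solution S F G T t x u)"
proof -
  obtain X where X: "mild T t x u X" using mild_exists[OF assms] by blast
  have "mild T t x u (restrict X {t..T})"
    using X by (subst (asm) mild_cong[of t T X "restrict X {t..T}" u u]) auto
  then have "restrict X {t..T} \<in> extensional {t..T} \<and> mild T t x u (restrict X {t..T})" by simp
  moreover have "Y = restrict X {t..T}" if "Y \<in> extensional {t..T} \<and> mild T t x u Y" for Y
    using that X mild_unique[OF u] by (auto simp: extensional_def restrict_def fun_eq_iff)
  ultimately have "the_mild_solution S F G T t x u \<in> extensional {t..T} \<and> mild T t x u (the_mild_solution S F G T t x u)"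
    unfolding the_mild_solution_def by (rule theI)
  then show ?thesis by simp
qed

lemma mild_initial:
  assumes "mild T t x u X" "t \<le> T"
  shows "X t = x"
proof -
  have "t \<in> {t..T}" using assms(2) by simp
  then have "X t = S (t - t) x + (LINT \<tau>:{t..t}|lebesgue. S (t - \<tau>) (F (X \<tau>) + G (X \<tau>) (u \<tau>)))"
    using assms(1) unfolding mild_solution_def by blast
  then show ?thesis by simp
qed

lemma mild_restrict_left:
  assumes "mild T t x u X" "r \<le> T"
  shows "mild r t x u X"
proof -
  have "{t..r} \<subseteq> {t..T}" using assms(2) by auto
  then show ?thesis using assms(1) continuous_on_subset unfolding mild_solution_def by blast
qed

lemma Picard_restart:
  assumes X: "continuous_on {t..T} X" and u: "set_integrable lebesgue {t..T} u"
    and order: "t \<le> r" "r \<le> s" "s \<le> T"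
  shows "Picard r (Picard t x u X r) u X s = Picard t x u X s"
proof -
  let ?f = "\<lambda>\<tau>. drift (X \<tau>) (u \<tau>)"
  have f: "set_integrable lebesgue {t..s} (\<lambda>\<tau>. S (s - \<tau>) (?f \<tau>))"
    "set_integrable lebesgue {t..r} (\<lambda>\<tau>. S (r - \<tau>) (?f \<tau>))"
    using order by (intro set_integrable_S[OF set_integrable_drift[OF X u]]; simp)+
  have "S (s - r) (LINT \<tau>:{t..r}|lebesgue. S (r - \<tau>) (?f \<tau>)) = (LINT \<tau>:{t..r}|lebesgue. S (s - r) (S (r - \<tau>) (?f \<tau>)))"
    by (rule set_integral_blinfun[OF f(2), symmetric])
  also have "\<dots> = (LINT \<tau>:{t..r}|lebesgue. S (s - \<tau>) (?f \<tau>))"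
    by (rule set_lebesgue_integral_cong) (use order in \<open>auto simp flip: S_add\<close>)
  finally have "S (s - r) (Picard t x u X r) = S (s - t) x + (LINT \<tau>:{t..r}|lebesgue. S (s - \<tau>) (?f \<tau>))"
    using order S_add[of "s - r" "r - t" x] by (simp add: Picard_def blinfun.add_right)
  then show ?thesis
    using set_integral_interval_split[OF f(1) order(1,2)] by (simp add: Picard_def)
qed

lemma mild_restrict_right:
  assumes X: "mild T t x u X" and r: "r \<in> {t..T}" and u: "set_integrable lebesgue {t..T} u"
  shows "mild T r (X r) u X"
proof -
  have "set_integrable lebesgue {r..T} u" by (rule set_integrable_subinterval[OF u]) (use r in auto)
  moreover have "continuous_on {r..T} X" by (rule continuous_on_subset[OF mild_continuous[OF X]]) (use r in auto)
  moreover have "X s = Picard r (X r) u X s" if "s \<in> {r..T}" for s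
    using Picard_restart[OF mild_continuous[OF X] u, of r s x] mild_eq_Picard[OF u X] r that by simp
  ultimately show ?thesis using mild_iff_Picard by blast
qed

lemma mild_concat:
  fixes u w :: "real \<Rightarrow> 'a" and r :: real
  defines "c \<equiv> \<lambda>s. if s \<le> r then u s else w s"
  assumes X: "mild r t x u X" and Z: "mild T r (X r) w Z" and r: "t \<le> r" "r \<le> T"
    and w: "set_integrable lebesgue {r..T} w" and c: "set_integrable lebesgue {t..T} c"
  obtains Y where "mild T t x c Y" "Y T = Z T"
proof -
  have c_left: "set_integrable lebesgue {t..r} c" and c_right: "set_integrable lebesgue {r..T} c"
    using r by (auto intro: set_integrable_subinterval[OF c])
  obtain Y where Y: "mild T t x c Y" using mild_exists[OF c] r by fastforce
  have "mild r t x c X" using X by (subst mild_cong[of t r X X c u]) (auto simp: c_def)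
  then have "Y r = X r"
    using mild_unique[OF c_left mild_restrict_left[OF Y r(2)]] r by simp
  then have "mild T r (X r) c Y"
    using mild_restrict_right[OF Y _ c, of r] r by simp
  moreover have "mild T r (X r) c Z"
    by (rule mild_cong_except_point[OF w c_right _ Z, of r]) (auto simp: c_def)
  ultimately have "Y T = Z T" using mild_unique[OF c_right] r by simp
  then show ?thesis using that Y by blast
qed

lemma norm_m1_Picard_diff_le:
  assumes X: "continuous_on {t..T} X" and Y: "continuous_on {t..T} Y"
    and u: "set_integrable lebesgue {t..T} u" and s: "s \<in> {t..T}"
  defines "E \<equiv> exp (c0 * (T - t))"
  shows "norm_m1 B (Picard t x u X s - Picard t y u Y s) \<le> E * norm_m1 B (x - y)
    + (LINT \<tau>:{t..s}|lebesgue. E * Lip * (1 + norm (u \<tau>)) * norm_m1 B (X \<tau> - Y \<tau>))"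
proof -
  have norm_m1_S_le_E: "norm_m1 B (S r z) \<le> E * norm_m1 B z" if "0 \<le> r" "r \<le> T - t" for r z
    unfolding E_def using c0_nonneg that
    by (intro order_trans[OF norm_m1_S_le] mult_right_mono) (auto intro: mult_left_mono)
  let ?h = "\<lambda>\<tau>. S (s - \<tau>) (drift (X \<tau>) (u \<tau>) - drift (Y \<tau>) (u \<tau>))"
  note h = Picard_diff(1)[OF X Y u s]
  have "norm_m1 B (LINT \<tau>:{t..s}|lebesgue. ?h \<tau>) = norm (LINT \<tau>:{t..s}|lebesgue. sqrt_op B (?h \<tau>))"
    by (simp add: norm_m1_def set_integral_blinfun[OF h])
  also have "\<dots> \<le> (LINT \<tau>:{t..s}|lebesgue. E * Lip * (1 + norm (u \<tau>)) * norm_m1 B (X \<tau> - Y \<tau>))"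
  proof (rule norm_set_integral_le[OF set_integrable_blinfun[OF h]])
    have us: "set_integrable lebesgue {t..s} u" by (rule set_integrable_subinterval[OF u]) (use s in auto)
    show "set_integrable lebesgue {t..s} (\<lambda>\<tau>. E * Lip * (1 + norm (u \<tau>)) * norm_m1 B (X \<tau> - Y \<tau>))"
      unfolding norm_m1_def by (intro set_integrable_mult_continuous set_integrable_kernel us continuous_intros
          continuous_on_subset[OF X] continuous_on_subset[OF Y]) (use s in auto)
    fix \<tau> assume \<tau>: "\<tau> \<in> {t..s}"
    have "norm_m1 B (?h \<tau>) \<le> E * norm_m1 B (drift (X \<tau>) (u \<tau>) - drift (Y \<tau>) (u \<tau>))"
      using \<tau> s by (intro norm_m1_S_le_E) auto
    also have "\<dots> \<le> E * (norm (sqrt_op B) * (M * (1 + norm (u \<tau>)) * norm_m1 B (X \<tau> - Y \<tau>)))"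
      by (intro mult_left_mono order_trans[OF norm_m1_le] drift_weak_lipschitz) (auto simp: E_def)
    finally show "norm (sqrt_op B (?h \<tau>)) \<le> E * Lip * (1 + norm (u \<tau>)) * norm_m1 B (X \<tau> - Y \<tau>)"
      by (simp add: norm_m1_def Lip_def mult_ac)
  qed
  moreover have "norm_m1 B (S (s - t) (x - y)) \<le> E * norm_m1 B (x - y)" using s by (intro norm_m1_S_le_E) auto
  ultimately show ?thesis
    unfolding Picard_diff(2)[OF X Y u s]
    using norm_m1_triangle[of B "S (s - t) (x - y)" "LINT \<tau>:{t..s}|lebesgue. ?h \<tau>"] by simp
qed

lemma mild_weak_dependence:
  assumes u: "set_integrable lebesgue {t..T} u" and "t \<le> T"
    and X: "mild T t x u X" and Y: "mild T t y u Y"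
  defines "E \<equiv> exp (c0 * (T - t))"
  shows "norm_m1 B (X T - Y T)
    \<le> E * norm_m1 B (x - y) * exp (E * Lip * ((T - t) + (LINT \<tau>:{t..T}|lebesgue. norm (u \<tau>))))"
proof -
  note cont = mild_continuous[OF X] mild_continuous[OF Y]
  have "norm_m1 B (X T - Y T) \<le> E * norm_m1 B (x - y) * exp (LINT \<tau>:{t..T}|lebesgue. E * Lip * (1 + norm (u \<tau>)))"
  proof (rule Gronwall_integrable_kernel[OF set_integrable_kernel[OF u]])
    show "continuous_on {t..T} (\<lambda>s. norm_m1 B (X s - Y s))"
      unfolding norm_m1_def by (intro continuous_intros cont)
    show "norm_m1 B (X s - Y s) \<le> E * norm_m1 B (x - y)
        + (LINT \<tau>:{t..s}|lebesgue. E * Lip * (1 + norm (u \<tau>)) * norm_m1 B (X \<tau> - Y \<tau>))" if "s \<in> {t..T}" for s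
      unfolding E_def using norm_m1_Picard_diff_le[OF cont u that, of x y]
        mild_eq_Picard[OF u X that] mild_eq_Picard[OF u Y that] by simp
  qed (use \<open>t \<le> T\<close> in \<open>auto simp: E_def Lip_nonneg\<close>)
  then show ?thesis unfolding set_integral_kernel[OF \<open>t \<le> T\<close> u] .
qed

lemma mild_displacement:
  assumes "set_integrable lebesgue {t..T} u" "mild T t x u X" "t \<le> T"
  shows "X T - S (T - t) x = (LINT \<tau>:{t..T}|lebesgue. S (T - \<tau>) (drift (X \<tau>) (u \<tau>)))"
  using mild_eq_Picard[OF assms(1,2), of T] assms(3) by (simp add: Picard_def)

lemma norm_mild_displacement_le:
  assumes u: "set_integrable lebesgue {t..T} u" and X: "mild T t x u X" and "t \<le> T"
  shows "norm (X T - S (T - t) x) \<le> (LINT \<tau>:{t..T}|lebesgue. M + Lip * norm (X \<tau>) + M * norm (u \<tau>))"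
  unfolding mild_displacement[OF assms]
  using \<open>t \<le> T\<close>
  by (intro norm_set_integral_le set_integrable_S[OF set_integrable_drift[OF mild_continuous[OF X] u]]
      set_integrable_growth mild_continuous[OF X] u order_trans[OF norm_S_apply_le drift_growth]) auto

lemma norm_mild_le:
  assumes u: "set_integrable lebesgue {t..T} u" and X: "mild T t x u X" and "t \<le> T"
  shows "norm (X T) \<le> (norm x + M * (T - t) + M * (LINT \<tau>:{t..T}|lebesgue. norm (u \<tau>))) * exp (Lip * (T - t))"
proof -
  let ?U = "LINT \<tau>:{t..T}|lebesgue. norm (u \<tau>)"
  have "norm (X T) \<le> (norm x + M * (T - t) + M * ?U) * exp (LINT \<tau>:{t..T}|lebesgue. Lip)"
  proof (rule Gronwall_integrable_kernel)
    fix s assume s: "s \<in> {t..T}"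
    have sub: "set_integrable lebesgue {t..s} u" "set_integrable lebesgue {t..s} (\<lambda>\<tau>. norm (X \<tau>))"
      using set_integrable_subinterval[OF u, of t s]
        set_integrable_subinterval[OF set_integrable_continuous_interval[OF continuous_on_norm[OF mild_continuous[OF X]]], of t s] s
      by auto
    have "(LINT \<tau>:{t..s}|lebesgue. M + Lip * norm (X \<tau>) + M * norm (u \<tau>))
        = M * (s - t) + (LINT \<tau>:{t..s}|lebesgue. Lip * norm (X \<tau>)) + M * (LINT \<tau>:{t..s}|lebesgue. norm (u \<tau>))"
      using sub s by (simp add: set_integral_add set_integrable_norm set_integrable_continuous_interval
          set_integral_const_interval)
    also have "\<dots> \<le> M * (T - t) + (LINT \<tau>:{t..s}|lebesgue. Lip * norm (X \<tau>)) + M * ?U"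
      using s M_nonneg u by (intro add_mono mult_left_mono order_refl set_integral_mono_set set_integrable_norm) auto
    finally show "norm (X s) \<le> norm x + M * (T - t) + M * ?U + (LINT \<tau>:{t..s}|lebesgue. Lip * norm (X \<tau>))"
      using norm_mild_displacement_le[OF sub(1) mild_restrict_left[OF X]] s
        norm_triangle_sub[of "X s" "S (s - t) x"] norm_S_apply_le[of "s - t" x] by simp
  next
    show "0 \<le> norm x + M * (T - t) + M * ?U"
      using M_nonneg \<open>t \<le> T\<close> by (intro add_nonneg_nonneg mult_nonneg_nonneg set_integral_nonneg) auto
  qed (use \<open>t \<le> T\<close> Lip_nonneg mild_continuous[OF X] in \<open>auto intro!: continuous_intros set_integrable_continuous_interval\<close>)
  then show ?thesis using \<open>t \<le> T\<close> by (simp add: set_integral_const_interval mult.commute)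
qed

lemma inner_mild_displacement:
  assumes u: "set_integrable lebesgue {t..T} u" and X: "mild T t x u X" and "t \<le> T"
  shows "set_integrable lebesgue {t..T} (\<lambda>\<tau>. drift (X \<tau>) (u \<tau>) \<bullet> adjoint (S (T - \<tau>)) p)"
    "(X T - S (T - t) x) \<bullet> p = (LINT \<tau>:{t..T}|lebesgue. drift (X \<tau>) (u \<tau>) \<bullet> adjoint (S (T - \<tau>)) p)"
proof -
  have "set_integrable lebesgue {t..T} (\<lambda>\<tau>. S (T - \<tau>) (drift (X \<tau>) (u \<tau>)))"
    using set_integrable_S[OF set_integrable_drift[OF mild_continuous[OF X] u], of T] \<open>t \<le> T\<close> by simp
  note inner = set_integrable_blinfun[OF this, of "blinfun_inner_left p"] set_integral_blinfun[OF this, of "blinfun_inner_left p"]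
  show "set_integrable lebesgue {t..T} (\<lambda>\<tau>. drift (X \<tau>) (u \<tau>) \<bullet> adjoint (S (T - \<tau>)) p)"
    using inner(1) by (simp add: inner_adjoint_blinfun)
  show "(X T - S (T - t) x) \<bullet> p = (LINT \<tau>:{t..T}|lebesgue. drift (X \<tau>) (u \<tau>) \<bullet> adjoint (S (T - \<tau>)) p)"
    using inner(2) by (simp add: inner_adjoint_blinfun mild_displacement[OF assms])
qed

end

subsection \<open>The value function\<close>

definition affine_envelope :: "(nat \<Rightarrow> real) \<Rightarrow> (nat \<Rightarrow> real) \<Rightarrow> real \<Rightarrow> real" where
  "affine_envelope a C r = (INF n. a n + C n * r)"

lemma affine_envelope_le:
  assumes "\<And>n. 0 \<le> a n" "\<And>n. 0 \<le> C n" "0 \<le> r"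
  shows "affine_envelope a C r \<le> a n + C n * r"
proof -
  have "bdd_below (range (\<lambda>n. a n + C n * r))" using assms by (intro bdd_belowI[of _ 0]) auto
  then show ?thesis unfolding affine_envelope_def by (rule cINF_lower) simp
qed

lemma affine_envelope_ge: "(\<And>n. c \<le> a n + C n * r) \<Longrightarrow> c \<le> affine_envelope a C r"
  unfolding affine_envelope_def by (intro cINF_greatest) auto

lemma affine_envelope_subadditive:
  assumes "\<And>n. 0 \<le> a n" "\<And>n. 0 \<le> C n" "0 \<le> r" "0 \<le> s"
  shows "affine_envelope a C (r + s) \<le> affine_envelope a C r + affine_envelope a C s"
proof (cases "r + s = 0")
  case True
  then have "r = 0" "s = 0" using assms(3,4) by auto
  moreover have "0 \<le> affine_envelope a C 0" using assms(1) by (intro affine_envelope_ge) simp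
  ultimately show ?thesis by simp
next
  case False
  let ?\<omega> = "affine_envelope a C"
  have fraction: "p / (r + s) * ?\<omega> (r + s) \<le> ?\<omega> p" if "0 \<le> p" "p \<le> r + s" for p
  proof (rule affine_envelope_ge)
    fix n
    have "p / (r + s) * ?\<omega> (r + s) \<le> p / (r + s) * (a n + C n * (r + s))"
      using assms that by (intro mult_left_mono affine_envelope_le) auto
    also have "\<dots> = p / (r + s) * a n + C n * p" using False by (simp add: field_simps)
    also have "\<dots> \<le> a n + C n * p"
      using assms(1) that False by (intro add_right_mono mult_left_le_one_le) (auto simp: divide_le_eq_1)
    finally show "p / (r + s) * ?\<omega> (r + s) \<le> a n + C n * p" .
  qed
  have "?\<omega> (r + s) = r / (r + s) * ?\<omega> (r + s) + s / (r + s) * ?\<omega> (r + s)"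
    using False by (simp flip: distrib_right add_divide_distrib)
  then show ?thesis using fraction[of r] fraction[of s] assms(3,4) by simp
qed

lemma is_modulus_affine_envelope:
  assumes a: "\<And>n. 0 \<le> a n" "a \<longlonglongrightarrow> 0" and C: "\<And>n. 0 \<le> C n"
  shows "is_modulus (affine_envelope a C)"
proof -
  let ?\<omega> = "affine_envelope a C"
  have nonneg: "0 \<le> ?\<omega> r" if "0 \<le> r" for r using a C that by (intro affine_envelope_ge) simp
  have mono: "?\<omega> r \<le> ?\<omega> s" if "0 \<le> r" "r \<le> s" for r s
  proof (rule affine_envelope_ge)
    fix n
    have "?\<omega> r \<le> a n + C n * r" by (intro affine_envelope_le a(1) C that)
    also have "\<dots> \<le> a n + C n * s" by (intro add_left_mono mult_left_mono C that)
    finally show "?\<omega> r \<le> a n + C n * s" .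
  qed
  have zero: "?\<omega> 0 = 0"
  proof (rule antisym)
    have "?\<omega> 0 \<le> a n" for n using affine_envelope_le[of a C 0 n] a(1) C by simp
    then show "?\<omega> 0 \<le> 0" by (intro LIMSEQ_le_const[OF a(2)]) blast
  qed (rule nonneg[OF order_refl])
  have increment: "\<bar>?\<omega> r - ?\<omega> s\<bar> \<le> a n + C n * \<bar>r - s\<bar>" if "0 \<le> r" "0 \<le> s" for r s n
    using affine_envelope_subadditive[of a C "min r s" "\<bar>r - s\<bar>", OF a(1) C] mono[of "min r s" "max r s"]
      affine_envelope_le[of a C "\<bar>r - s\<bar>" n, OF a(1) C] that
    by (cases "r \<le> s") (auto simp: min_def max_def)
  have "continuous_on {0..} ?\<omega>"
    unfolding continuous_on_iff
  proof (intro ballI allI impI)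
    fix s e :: real assume "s \<in> {0..}" "0 < e"
    obtain n where n: "a n < e / 2" using order_tendstoD(2)[OF a(2), of "e / 2"] \<open>0 < e\<close> eventually_happens by fastforce
    obtain \<delta> where \<delta>: "\<delta> > 0" "C n * \<delta> \<le> e / 2" using small_scale_exists[of "e / 2" "C n"] \<open>0 < e\<close> by auto
    have "dist (?\<omega> r) (?\<omega> s) < e" if "r \<in> {0..}" "dist r s < \<delta>" for r
    proof -
      have "C n * \<bar>r - s\<bar> \<le> C n * \<delta>" using that C by (intro mult_left_mono) (auto simp: dist_real_def)
      then show ?thesis using increment[of r s n] n \<delta>(2) that \<open>s \<in> {0..}\<close> by (simp add: dist_real_def)
    qed
    then show "\<exists>\<delta>>0. \<forall>r\<in>{0..}. dist r s < \<delta> \<longrightarrow> dist (?\<omega> r) (?\<omega> s) < e" using \<delta>(1) by blast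
  qed
  then show ?thesis using mono nonneg zero by (auto simp: is_modulus_def mono_on_def)
qed

lemma modulus_of_affine_bounds:
  fixes E :: "(real \<times> real) set"
  assumes bound: "\<And>d. d > 0 \<Longrightarrow> \<exists>C\<ge>0. \<forall>(p, r)\<in>E. p \<le> d + C * r"
  shows "\<exists>\<omega>. is_modulus \<omega> \<and> (\<forall>(p, r)\<in>E. p \<le> \<omega> r)"
proof -
  have "\<forall>n. \<exists>C\<ge>0. \<forall>(p, r)\<in>E. p \<le> inverse (real (Suc n)) + C * r" by (intro allI bound) simp
  then obtain C where C: "\<And>n. 0 \<le> C n" "\<And>n. \<forall>(p, r)\<in>E. p \<le> inverse (real (Suc n)) + C n * r" by metis
  have "is_modulus (affine_envelope (\<lambda>n. inverse (real (Suc n))) C)"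
    by (intro is_modulus_affine_envelope C(1) LIMSEQ_inverse_real_of_nat) simp
  moreover have "p \<le> affine_envelope (\<lambda>n. inverse (real (Suc n))) C r" if "(p, r) \<in> E" for p r
    using C(2) that by (intro affine_envelope_ge) blast
  ultimately show ?thesis by blast
qed

locale control_problem = control_system domA A S B c0 F G M + exponential_levy \<nu>
  for domA :: "'a::{real_inner, banach, second_countable_topology} set"
    and A :: "'a \<Rightarrow> 'a" and S :: "real \<Rightarrow> 'a \<Rightarrow>\<^sub>L 'a" and B :: "'a \<Rightarrow>\<^sub>L 'a" and c0 :: real
    and F :: "'a \<Rightarrow> 'a" and G :: "'a \<Rightarrow> 'a \<Rightarrow>\<^sub>L 'a" and M :: real and \<nu> :: "'a measure" +
  fixes \<gamma> :: "'a \<Rightarrow> real" and C\<gamma> L\<gamma> T :: real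
  assumes \<gamma>_bounded: "\<And>x. \<bar>\<gamma> x\<bar> \<le> C\<gamma>"
    and \<gamma>_weak_lipschitz: "\<And>x y. \<bar>\<gamma> x - \<gamma> y\<bar> \<le> L\<gamma> * norm_m1 B (x - y)"
    and L\<gamma>_nonneg: "0 \<le> L\<gamma>"
    and T_pos: "T > 0"
begin

definition v :: "real \<times> 'a \<Rightarrow> real" where
  "v = (\<lambda>(t, x). real_of_ereal (value_function \<nu> S F G \<gamma> T t x))"

lemma C\<gamma>_nonneg: "0 \<le> C\<gamma>"
  using \<gamma>_bounded[of 0] by simp

lemma zero_control:
  assumes "t \<le> r"
  obtains X where "admissible r t (\<lambda>_. 0)" "mild r t x (\<lambda>_. 0) X" "cost r t (\<lambda>_. 0) = 0"
  using admissible_const[OF L0_zero assms] mild_exists[OF admissible_integrable assms] by auto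

lemma payoff_admissible:
  assumes "admissible T t u" "mild T t x u X" "t \<le> T"
  shows "payoff \<nu> S F G \<gamma> T t x u = ereal (- cost T t u + \<gamma> (X T))"
proof -
  note u = admissible_integrable[OF assms(1)]
  have "the_mild_solution S F G T t x u T = X T"
    by (rule mild_unique[OF u the_mild_solution_mild[OF u assms(3)] assms(2)]) (use assms in auto)
  then show ?thesis using assms(1) by (auto simp: payoff_def admissible_def)
qed

lemma payoff_le_value_function:
  assumes "admissible T t u"
  shows "payoff \<nu> S F G \<gamma> T t x u \<le> value_function \<nu> S F G \<gamma> T t x"
  unfolding value_function_def using assms by (intro SUP_upper) (simp add: admissible_def)

lemma value_function_bounds:
  assumes "t \<le> T"
  shows "ereal (- C\<gamma>) \<le> value_function \<nu> S F G \<gamma> T t x" "value_function \<nu> S F G \<gamma> T t x \<le> ereal C\<gamma>"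
proof -
  obtain X where zero: "admissible T t (\<lambda>_. 0)" "mild T t x (\<lambda>_. 0) X" "cost T t (\<lambda>_. 0) = 0"
    by (rule zero_control[OF assms])
  have "ereal (- C\<gamma>) \<le> payoff \<nu> S F G \<gamma> T t x (\<lambda>_. 0)"
    unfolding payoff_admissible[OF zero(1,2) assms] zero(3) using \<gamma>_bounded[of "X T"] by simp
  then show "ereal (- C\<gamma>) \<le> value_function \<nu> S F G \<gamma> T t x"
    using payoff_le_value_function[OF zero(1)] by (rule order_trans)
  show "value_function \<nu> S F G \<gamma> T t x \<le> ereal C\<gamma>"
    unfolding value_function_def
  proof (rule SUP_least)
    fix u
    have "- enn2real (running_cost \<nu> T t u) + \<gamma> y \<le> C\<gamma>" for y
      using \<gamma>_bounded[of y] enn2real_nonneg[of "running_cost \<nu> T t u"] by linarith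
    then show "payoff \<nu> S F G \<gamma> T t x u \<le> ereal C\<gamma>" by (simp add: payoff_def)
  qed
qed

lemma ereal_v:
  assumes "t \<le> T"
  shows "ereal (v (t, x)) = value_function \<nu> S F G \<gamma> T t x"
  using value_function_bounds[OF assms, of x] by (cases "value_function \<nu> S F G \<gamma> T t x") (auto simp: v_def)

lemma abs_v_le:
  assumes "t \<le> T"
  shows "\<bar>v (t, x)\<bar> \<le> C\<gamma>"
  using value_function_bounds[OF assms, of x] unfolding ereal_v[OF assms, symmetric] by simp

lemma payoff_le_v:
  assumes "admissible T t u" "mild T t x u X" "t \<le> T"
  shows "- cost T t u + \<gamma> (X T) \<le> v (t, x)"
  using payoff_le_value_function[OF assms(1), of x]
  unfolding payoff_admissible[OF assms] ereal_v[OF assms(3), symmetric] by simp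

lemma near_optimal_control:
  assumes "t \<le> T" "e > 0"
  obtains u X where "admissible T t u" "mild T t x u X" "v (t, x) \<le> - cost T t u + \<gamma> (X T) + e"
    "cost T t u \<le> 2 * C\<gamma> + e"
proof -
  have "ereal (v (t, x) - e) < value_function \<nu> S F G \<gamma> T t x"
    unfolding ereal_v[OF assms(1), symmetric] using assms by simp
  then obtain u where u: "u \<in> controls T t" "ereal (v (t, x) - e) < payoff \<nu> S F G \<gamma> T t x u"
    unfolding value_function_def less_SUP_iff by blast
  then have admissible: "admissible T t u" by (auto simp: admissible_def payoff_def less_top split: if_splits)
  obtain X where X: "mild T t x u X" using mild_exists[OF admissible_integrable[OF admissible] assms(1)] by blast
  have "v (t, x) - e < - cost T t u + \<gamma> (X T)" using u(2) unfolding payoff_admissible[OF admissible X assms(1)] by simp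
  then show ?thesis using that[OF admissible X] abs_v_le[OF assms(1), of x] \<gamma>_bounded[of "X T"] by linarith
qed

lemma v_terminal: "v (T, x) = \<gamma> x"
proof (rule antisym)
  show "v (T, x) \<le> \<gamma> x"
  proof (rule field_le_epsilon)
    fix e :: real assume "e > 0"
    then obtain u X where "mild T T x u X" "v (T, x) \<le> - cost T T u + \<gamma> (X T) + e"
      using near_optimal_control[OF order_refl \<open>e > 0\<close>] by blast
    then show "v (T, x) \<le> \<gamma> x + e"
      using mild_initial[of T T x u X] enn2real_nonneg[of "running_cost \<nu> T T u"] by (simp del: enn2real_nonneg)
  qed
  obtain X where zero: "admissible T T (\<lambda>_. 0)" "mild T T x (\<lambda>_. 0) X" "cost T T (\<lambda>_. 0) = 0"
    by (rule zero_control[OF order_refl])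
  then show "\<gamma> x \<le> v (T, x)" using payoff_le_v[OF zero(1,2)] mild_initial[OF zero(2)] by simp
qed

text \<open>Since \<open>v\<close> and \<open>\<gamma>\<close> are bounded by \<open>C\<gamma>\<close>, every \<open>1\<close>-optimal control costs at most \<open>2 * C\<gamma> + 1\<close>.\<close>

definition cheap_trajectory :: "real \<Rightarrow> real \<Rightarrow> 'a \<Rightarrow> (real \<Rightarrow> 'a) \<Rightarrow> (real \<Rightarrow> 'a) \<Rightarrow> bool" where
  "cheap_trajectory r t x u X \<longleftrightarrow>
     0 \<le> t \<and> t \<le> r \<and> r \<le> T \<and> admissible r t u \<and> cost r t u \<le> 2 * C\<gamma> + 1 \<and> mild r t x u X"

lemma cheap_trajectoryD:
  assumes "cheap_trajectory r t x u X"
  shows "0 \<le> t" "t \<le> r" "r \<le> T" "admissible r t u" "cost r t u \<le> 2 * C\<gamma> + 1" "mild r t x u X"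
    "set_integrable lebesgue {t..r} u"
  using assms admissible_integrable by (auto simp: cheap_trajectory_def)

lemma cheap_trajectory_restrict:
  assumes "cheap_trajectory r t x u X" "t \<le> s" "s \<le> r"
  shows "cheap_trajectory s t x u X"
  using cheap_trajectoryD[OF assms(1)] assms(2,3) admissible_split[of r t u s] mild_restrict_left[of r t x u X s]
    enn2real_nonneg[of "running_cost \<nu> r s u"]
  by (auto simp: cheap_trajectory_def simp del: enn2real_nonneg)

definition control_bound :: real where "control_bound = 2 * C\<gamma> + 1 + H0_bound 1 * T"

lemma control_bound_nonneg: "0 \<le> control_bound"
  using C\<gamma>_nonneg H0_bound_nonneg[of 1] T_pos by (simp add: control_bound_def)

lemma cheap_trajectory_control_le:
  assumes "cheap_trajectory r t x u X"
  shows "(LINT s:{t..r}|lebesgue. norm (u s)) \<le> control_bound"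
proof -
  note u = cheap_trajectoryD[OF assms]
  have "1 * (LINT s:{t..r}|lebesgue. norm (u s)) \<le> cost r t u + H0_bound 1 * (r - t)"
    by (intro set_integral_norm_control_le u) simp
  also have "\<dots> \<le> control_bound"
    unfolding control_bound_def using u H0_bound_nonneg[of 1] by (intro add_mono mult_left_mono) auto
  finally show ?thesis by simp
qed

lemma cheap_trajectory_control_affine_bound:
  assumes "d > 0"
  obtains C where "C \<ge> 0" "\<And>r t x u X. cheap_trajectory r t x u X \<Longrightarrow>
    (LINT s:{t..r}|lebesgue. norm (u s)) \<le> d + C * (r - t)"
proof -
  define R where "R = (2 * C\<gamma> + 1) / d"
  have R: "R > 0" and R_d: "R * d = 2 * C\<gamma> + 1" using assms C\<gamma>_nonneg by (auto simp: R_def)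
  show ?thesis
  proof (rule that[of "H0_bound R / R"])
    fix r t x u X assume "cheap_trajectory r t x u X"
    note u = cheap_trajectoryD[OF this]
    have "R * (LINT s:{t..r}|lebesgue. norm (u s)) \<le> cost r t u + H0_bound R * (r - t)"
      using R by (intro set_integral_norm_control_le u) simp
    also have "\<dots> \<le> R * d + H0_bound R * (r - t)" using u(5) R_d by simp
    also have "\<dots> = R * (d + H0_bound R / R * (r - t))" using R by (simp add: distrib_left)
    finally show "(LINT s:{t..r}|lebesgue. norm (u s)) \<le> d + H0_bound R / R * (r - t)"
      using R by (simp only: mult_le_cancel_left_pos)
  qed (use R H0_bound_nonneg in auto)
qed

lemma norm_cheap_trajectory_le:
  obtains Q where "Q \<ge> 0"
    "\<And>r t x u X. cheap_trajectory r t x u X \<Longrightarrow> norm x \<le> R \<Longrightarrow> norm (X r) \<le> Q"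
proof (rule that[of "(\<bar>R\<bar> + M * T + M * control_bound) * exp (Lip * T)"])
  fix r t x u X assume traj: "cheap_trajectory r t x u X" and x: "norm x \<le> R"
  note u = cheap_trajectoryD[OF traj]
  have "norm (X r) \<le> (norm x + M * (r - t) + M * (LINT s:{t..r}|lebesgue. norm (u s))) * exp (Lip * (r - t))"
    by (intro norm_mild_le u)
  also have "\<dots> \<le> (\<bar>R\<bar> + M * T + M * control_bound) * exp (Lip * T)"
    using u(1-3) x M_nonneg Lip_nonneg control_bound_nonneg T_pos
    by (intro mult_mono add_mono exp_le_cancel_iff[THEN iffD2] cheap_trajectory_control_le[OF traj]
        mult_nonneg_nonneg add_nonneg_nonneg set_integral_nonneg) auto
  finally show "norm (X r) \<le> (\<bar>R\<bar> + M * T + M * control_bound) * exp (Lip * T)" .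
qed (use M_nonneg control_bound_nonneg T_pos in simp)

lemma cheap_trajectory_displacement_le:
  obtains N where "N \<ge> 0" "\<And>r t x u X. cheap_trajectory r t x u X \<Longrightarrow> norm x \<le> R \<Longrightarrow>
    norm (X r - S (r - t) x) \<le> N * ((r - t) + (LINT s:{t..r}|lebesgue. norm (u s)))"
proof -
  obtain Q where Q: "Q \<ge> 0" "\<And>r t x u X. cheap_trajectory r t x u X \<Longrightarrow> norm x \<le> R \<Longrightarrow> norm (X r) \<le> Q"
    using norm_cheap_trajectory_le by blast
  show ?thesis
  proof (rule that[of "M + Lip * Q"])
    fix r t x u X assume traj: "cheap_trajectory r t x u X" and x: "norm x \<le> R"
    note u = cheap_trajectoryD[OF traj]
    have "norm (X r - S (r - t) x) \<le> (LINT s:{t..r}|lebesgue. M + Lip * norm (X s) + M * norm (u s))"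
      by (intro norm_mild_displacement_le u)
    also have "\<dots> \<le> (LINT s:{t..r}|lebesgue. (M + Lip * Q) * (1 + norm (u s)))"
    proof (intro set_integral_mono set_integrable_growth mild_continuous[OF u(6)] set_integrable_kernel u(7))
      fix s assume "s \<in> {t..r}"
      then have "norm (X s) \<le> Q" using Q(2)[OF cheap_trajectory_restrict[OF traj] x] by simp
      then have "Lip * norm (X s) \<le> Lip * Q" by (intro mult_left_mono Lip_nonneg)
      moreover have "0 \<le> Lip * Q * norm (u s)" using Lip_nonneg Q(1) by simp
      ultimately show "M + Lip * norm (X s) + M * norm (u s) \<le> (M + Lip * Q) * (1 + norm (u s))"
        by (simp add: algebra_simps)
    qed
    also have "\<dots> = (M + Lip * Q) * ((r - t) + (LINT s:{t..r}|lebesgue. norm (u s)))"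
      by (intro set_integral_kernel u)
    finally show "norm (X r - S (r - t) x) \<le> (M + Lip * Q) * ((r - t) + (LINT s:{t..r}|lebesgue. norm (u s)))" .
  qed (use M_nonneg Lip_nonneg Q(1) in auto)
qed

lemma cheap_trajectory_displacement_affine_bound:
  assumes "d > 0"
  obtains C where "C \<ge> 0" "\<And>r t x u X. cheap_trajectory r t x u X \<Longrightarrow> norm x \<le> R \<Longrightarrow>
    norm (X r - S (r - t) x) \<le> d + C * (r - t)"
proof -
  obtain N where N: "N \<ge> 0" "\<And>r t x u X. cheap_trajectory r t x u X \<Longrightarrow> norm x \<le> R \<Longrightarrow>
      norm (X r - S (r - t) x) \<le> N * ((r - t) + (LINT s:{t..r}|lebesgue. norm (u s)))"
    using cheap_trajectory_displacement_le by blast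
  obtain b where b: "b > 0" "N * b \<le> d" using small_scale_exists[OF assms] by metis
  obtain C where C: "C \<ge> 0" "\<And>r t x u X. cheap_trajectory r t x u X \<Longrightarrow>
      (LINT s:{t..r}|lebesgue. norm (u s)) \<le> b + C * (r - t)"
    using cheap_trajectory_control_affine_bound[OF b(1)] by blast
  show ?thesis
  proof (rule that[of "N * (1 + C)"])
    fix r t x u X assume traj: "cheap_trajectory r t x u X" and x: "norm x \<le> R"
    have "norm (X r - S (r - t) x) \<le> N * ((r - t) + (LINT s:{t..r}|lebesgue. norm (u s)))"
      by (rule N(2)[OF traj x])
    also have "\<dots> \<le> N * ((r - t) + (b + C * (r - t)))"
      by (intro mult_left_mono add_left_mono C(2)[OF traj] N(1))
    also have "\<dots> = N * b + N * (1 + C) * (r - t)" by (simp add: algebra_simps)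
    finally show "norm (X r - S (r - t) x) \<le> d + N * (1 + C) * (r - t)" using b(2) by simp
  qed (use N(1) C(1) in simp)
qed

lemma cheap_trajectory_weak_affine_bound:
  assumes "d > 0"
  obtains C where "C \<ge> 0" "\<And>r t x u X. cheap_trajectory r t x u X \<Longrightarrow> norm x \<le> R \<Longrightarrow>
    norm_m1 B (X r - x) \<le> d + C * (r - t)"
proof -
  obtain b where b: "b > 0" "norm (sqrt_op B) * b \<le> d / 2"
    using small_scale_exists[of "d / 2"] assms by (metis half_gt_zero)
  obtain C where C: "C \<ge> 0" "\<And>r t x u X. cheap_trajectory r t x u X \<Longrightarrow> norm x \<le> R \<Longrightarrow>
      norm (X r - S (r - t) x) \<le> b + C * (r - t)"
    using cheap_trajectory_displacement_affine_bound[OF b(1)] by blast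
  obtain K where K: "K \<ge> 0" "\<And>r x. 0 \<le> r \<Longrightarrow> norm x \<le> R \<Longrightarrow> norm_m1 B (S r x - x) \<le> d / 2 + K * r"
    using norm_m1_S_diff_affine_bound[of "d / 2"] assms by (metis half_gt_zero)
  show ?thesis
  proof (rule that[of "norm (sqrt_op B) * C + K"])
    fix r t x u X assume traj: "cheap_trajectory r t x u X" and x: "norm x \<le> R"
    have "norm_m1 B (X r - x) \<le> norm_m1 B (X r - S (r - t) x) + norm_m1 B (S (r - t) x - x)"
      using norm_m1_triangle[of B "X r - S (r - t) x" "S (r - t) x - x"] by simp
    also have "norm_m1 B (X r - S (r - t) x) \<le> norm (sqrt_op B) * (b + C * (r - t))"
      by (rule order_trans[OF norm_m1_le]) (intro mult_left_mono C(2)[OF traj x] norm_ge_zero)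
    also have "norm_m1 B (S (r - t) x - x) \<le> d / 2 + K * (r - t)"
      using cheap_trajectoryD(2)[OF traj] by (intro K(2) x) simp
    also have "norm (sqrt_op B) * (b + C * (r - t)) + (d / 2 + K * (r - t))
        = norm (sqrt_op B) * b + d / 2 + (norm (sqrt_op B) * C + K) * (r - t)"
      by (simp add: algebra_simps)
    finally show "norm_m1 B (X r - x) \<le> d + (norm (sqrt_op B) * C + K) * (r - t)" using b(2) by simp
  qed (use C(1) K(1) in simp)
qed

definition v_lipschitz_const :: real where
  "v_lipschitz_const = L\<gamma> * (exp (c0 * T) * exp (exp (c0 * T) * Lip * (T + control_bound)))"

lemma v_lipschitz_const_nonneg: "0 \<le> v_lipschitz_const"
  using L\<gamma>_nonneg by (simp add: v_lipschitz_const_def)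

lemma \<gamma>_mild_lipschitz:
  assumes traj: "cheap_trajectory T t x u X" and Y: "mild T t y u Y"
  shows "\<gamma> (X T) \<le> \<gamma> (Y T) + v_lipschitz_const * norm_m1 B (x - y)"
proof -
  note u = cheap_trajectoryD[OF traj]
  let ?U = "LINT s:{t..T}|lebesgue. norm (u s)"
  have E: "exp (c0 * (T - t)) \<le> exp (c0 * T)" using c0_nonneg u(1) by (simp add: mult_left_mono)
  have "norm_m1 B (X T - Y T)
      \<le> exp (c0 * (T - t)) * norm_m1 B (x - y) * exp (exp (c0 * (T - t)) * Lip * ((T - t) + ?U))"
    by (intro mild_weak_dependence u Y)
  also have "\<dots> \<le> exp (c0 * T) * norm_m1 B (x - y) * exp (exp (c0 * T) * Lip * (T + control_bound))"
    using u(1,2)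
    by (intro mult_mono exp_le_cancel_iff[THEN iffD2] E add_mono cheap_trajectory_control_le[OF traj]
        mult_nonneg_nonneg Lip_nonneg add_nonneg_nonneg set_integral_nonneg) auto
  finally have "L\<gamma> * norm_m1 B (X T - Y T)
      \<le> L\<gamma> * (exp (c0 * T) * norm_m1 B (x - y) * exp (exp (c0 * T) * Lip * (T + control_bound)))"
    by (intro mult_left_mono L\<gamma>_nonneg)
  then show ?thesis using \<gamma>_weak_lipschitz[of "X T" "Y T"] by (simp add: v_lipschitz_const_def mult_ac)
qed

lemma v_weak_lipschitz:
  assumes t: "t \<in> {0..T}"
  shows "v (t, x) \<le> v (t, y) + v_lipschitz_const * norm_m1 B (x - y)"
proof (rule field_le_epsilon)
  fix e :: real assume "e > 0"
  then have "min e 1 > 0" and "t \<le> T" using t by auto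
  then obtain u X where u: "admissible T t u" and X: "mild T t x u X"
    and near_optimal: "v (t, x) \<le> - cost T t u + \<gamma> (X T) + min e 1" "cost T t u \<le> 2 * C\<gamma> + min e 1"
    using near_optimal_control by blast
  obtain Y where Y: "mild T t y u Y" using mild_exists[OF admissible_integrable[OF u] \<open>t \<le> T\<close>] by blast
  have "cheap_trajectory T t x u X" using u X near_optimal(2) t by (simp add: cheap_trajectory_def)
  then have "\<gamma> (X T) \<le> \<gamma> (Y T) + v_lipschitz_const * norm_m1 B (x - y)" using Y by (rule \<gamma>_mild_lipschitz)
  then show "v (t, x) \<le> v (t, y) + v_lipschitz_const * norm_m1 B (x - y) + e"
    using near_optimal(1) payoff_le_v[OF u Y \<open>t \<le> T\<close>] by simp
qed

lemma dynamic_programming_le: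
  assumes "0 \<le> t" "t \<le> r" "r \<le> T" "0 < e" "e \<le> 1"
  obtains u X where "cheap_trajectory r t x u X" "v (t, x) \<le> - cost r t u + v (r, X r) + e"
proof -
  have "t \<le> T" using assms by simp
  then obtain u X where u: "admissible T t u" and X: "mild T t x u X"
    and near_optimal: "v (t, x) \<le> - cost T t u + \<gamma> (X T) + e" "cost T t u \<le> 2 * C\<gamma> + e"
    using near_optimal_control[OF _ assms(4)] by blast
  note split = admissible_split[OF u assms(2,3)]
  have "mild T r (X r) u X"
    by (rule mild_restrict_right[OF X _ admissible_integrable[OF u]]) (use assms in auto)
  then have "v (t, x) \<le> - cost r t u + v (r, X r) + e"
    using payoff_le_v[OF split(2) _ assms(3)] near_optimal(1) split(3) by force
  moreover have "cheap_trajectory T t x u X"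
    using u X near_optimal(2) assms by (simp add: cheap_trajectory_def)
  ultimately show ?thesis using that cheap_trajectory_restrict assms(2,3) by blast
qed

lemma dynamic_programming_ge:
  assumes r: "t \<le> r" "r \<le> T" and u: "admissible r t u" and X: "mild r t x u X"
  shows "- cost r t u + v (r, X r) \<le> v (t, x)"
proof (rule field_le_epsilon)
  fix e :: real assume "e > 0"
  obtain w Z where w: "admissible T r w" and Z: "mild T r (X r) w Z"
    and near_optimal: "v (r, X r) \<le> - cost T r w + \<gamma> (Z T) + e"
    using near_optimal_control[OF r(2) \<open>e > 0\<close>] by blast
  note concat = admissible_concat[OF u w r]
  obtain Y where "mild T t x (\<lambda>s. if s \<le> r then u s else w s) Y" "Y T = Z T"
    using mild_concat[OF X Z r admissible_integrable[OF w] admissible_integrable[OF concat(1)]] by blast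
  then have "- (cost r t u + cost T r w) + \<gamma> (Z T) \<le> v (t, x)"
    using payoff_le_v[OF concat(1)] concat(2) r by fastforce
  then show "- cost r t u + v (r, X r) \<le> v (t, x) + e" using near_optimal by simp
qed

lemma v_time_affine_bound:
  assumes "d > 0"
  obtains C where "C \<ge> 0"
    "\<And>t r x. 0 \<le> t \<Longrightarrow> t \<le> r \<Longrightarrow> r \<le> T \<Longrightarrow> norm x \<le> R \<Longrightarrow> \<bar>v (t, x) - v (r, x)\<bar> \<le> d + C * (r - t)"
proof -
  let ?L = v_lipschitz_const
  obtain b where b: "b > 0" "?L * b \<le> d" using small_scale_exists[OF assms] by metis
  obtain C where C: "C \<ge> 0" "\<And>r t x u X. cheap_trajectory r t x u X \<Longrightarrow> norm x \<le> R \<Longrightarrow> norm_m1 B (X r - x) \<le> b + C * (r - t)"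
    using cheap_trajectory_weak_affine_bound[OF b(1)] by blast
  have near: "\<bar>v (r, X r) - v (r, x)\<bar> \<le> d + ?L * C * (r - t)"
    if traj: "cheap_trajectory r t x u X" and x: "norm x \<le> R" for r t x u X
  proof -
    have "?L * norm_m1 B (X r - x) \<le> ?L * (b + C * (r - t))"
      by (intro mult_left_mono C(2)[OF traj x] v_lipschitz_const_nonneg)
    then have "?L * norm_m1 B (X r - x) \<le> d + ?L * C * (r - t)" using b(2) by (simp add: distrib_left)
    then show ?thesis
      using v_weak_lipschitz[of r "X r" x] v_weak_lipschitz[of r x "X r"] cheap_trajectoryD[OF traj]
      by (simp add: norm_m1_minus_commute[of B x])
  qed
  show ?thesis
  proof (rule that[of "?L * C"])
    fix t r x assume t: "0 \<le> t" "t \<le> r" "r \<le> T" and x: "norm (x :: 'a) \<le> R"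
    have "v (t, x) \<le> v (r, x) + (d + ?L * C * (r - t))"
    proof (rule field_le_epsilon)
      fix e :: real assume "e > 0"
      then obtain u X where traj: "cheap_trajectory r t x u X" and "v (t, x) \<le> - cost r t u + v (r, X r) + min e 1"
        using dynamic_programming_le[OF t, of "min e 1"] by auto
      then show "v (t, x) \<le> v (r, x) + (d + ?L * C * (r - t)) + e"
        using near[OF traj x] enn2real_nonneg[of "running_cost \<nu> r t u"] by linarith
    qed
    moreover have "v (r, x) \<le> v (t, x) + (d + ?L * C * (r - t))"
    proof -
      obtain X where zero: "admissible r t (\<lambda>_. 0)" "mild r t x (\<lambda>_. 0) X" "cost r t (\<lambda>_. 0) = 0"
        by (rule zero_control[OF t(2)])
      then have "cheap_trajectory r t x (\<lambda>_. 0) X" using t C\<gamma>_nonneg by (simp add: cheap_trajectory_def)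
      from near[OF this x] show ?thesis using dynamic_programming_ge[OF t(2,3) zero(1,2)] zero(3) by linarith
    qed
    ultimately show "\<bar>v (t, x) - v (r, x)\<bar> \<le> d + ?L * C * (r - t)" by simp
  qed (use v_lipschitz_const_nonneg C(1) in simp)
qed

lemma v_modulus:
  "\<exists>\<omega>. is_modulus \<omega> \<and> (\<forall>x y. norm x \<le> R \<longrightarrow> norm y \<le> R \<longrightarrow> (\<forall>t\<in>{0..T}. \<forall>s\<in>{0..T}.
    \<bar>v (t, x) - v (s, y)\<bar> \<le> v_lipschitz_const * norm_m1 B (x - y) + \<omega> \<bar>t - s\<bar>))"
proof -
  define E where "E = {(\<bar>v (t, x) - v (s, x)\<bar>, \<bar>t - s\<bar>) |t s x. t \<in> {0..T} \<and> s \<in> {0..T} \<and> norm x \<le> R}"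
  have "\<exists>\<omega>. is_modulus \<omega> \<and> (\<forall>(p, r)\<in>E. p \<le> \<omega> r)"
  proof (rule modulus_of_affine_bounds)
    fix d :: real assume "d > 0"
    then obtain C where C: "C \<ge> 0"
      "\<And>t r x. 0 \<le> t \<Longrightarrow> t \<le> r \<Longrightarrow> r \<le> T \<Longrightarrow> norm x \<le> R \<Longrightarrow> \<bar>v (t, x) - v (r, x)\<bar> \<le> d + C * (r - t)"
      using v_time_affine_bound by blast
    have "\<bar>v (t, x) - v (s, x)\<bar> \<le> d + C * \<bar>t - s\<bar>" if "t \<in> {0..T}" "s \<in> {0..T}" "norm x \<le> R" for t s x
      using C(2)[of t s x] C(2)[of s t x] that by (cases "t \<le> s") (auto simp: abs_minus_commute)
    then show "\<exists>C\<ge>0. \<forall>(p, r)\<in>E. p \<le> d + C * r" using C(1) by (intro exI[of _ C]) (auto simp: E_def)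
  qed
  then obtain \<omega> where \<omega>: "is_modulus \<omega>" "\<And>p r. (p, r) \<in> E \<Longrightarrow> p \<le> \<omega> r" by blast
  have "\<bar>v (t, x) - v (s, y)\<bar> \<le> v_lipschitz_const * norm_m1 B (x - y) + \<omega> \<bar>t - s\<bar>"
    if "norm x \<le> R" "norm y \<le> R" "t \<in> {0..T}" "s \<in> {0..T}" for t s x y
  proof -
    have "\<bar>v (t, y) - v (s, y)\<bar> \<le> \<omega> \<bar>t - s\<bar>" using that by (intro \<omega>(2)) (auto simp: E_def)
    then show ?thesis
      using v_weak_lipschitz[OF that(3), of x y] v_weak_lipschitz[OF that(3), of y x]
      by (simp add: norm_m1_minus_commute[of B y])
  qed
  then show ?thesis using \<omega>(1) by blast
qed

end

subsection \<open>Test functions\<close>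

lemma GDERIV_unique:
  assumes "GDERIV f x :> p" "GDERIV f x :> q"
  shows "p = q"
proof -
  have "(\<lambda>h. h \<bullet> p) = (\<lambda>h. h \<bullet> q)" using assms unfolding gderiv_def by (rule has_derivative_unique)
  then show ?thesis by (metis vector_eq_ldot)
qed

lemma space_grad_eqI: "GDERIV (\<lambda>y. \<phi> (t, y)) x :> p \<Longrightarrow> space_grad \<phi> (t, x) = p"
  unfolding space_grad_def by (auto intro: the_equality GDERIV_unique)

lemma time_deriv_eqI: "((\<lambda>s. \<phi> (s, x)) has_real_derivative d) (at t) \<Longrightarrow> time_deriv \<phi> (t, x) = d"
  by (simp add: time_deriv_def DERIV_imp_deriv)

lemma differentiable_partials:
  fixes \<phi> :: "real \<times> 'a::{real_inner, banach} \<Rightarrow> real"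
  assumes "\<phi> differentiable (at (t, x))"
  shows "GDERIV (\<lambda>y. \<phi> (t, y)) x :> space_grad \<phi> (t, x)"
    "((\<lambda>s. \<phi> (s, x)) has_real_derivative time_deriv \<phi> (t, x)) (at t)"
proof -
  obtain \<phi>' where \<phi>': "(\<phi> has_derivative \<phi>') (at (t, x))" using assms by (auto simp: differentiable_def)
  have space: "((\<lambda>y. \<phi> (t, y)) has_derivative (\<lambda>h. \<phi>' (0, h))) (at x)"
    by (rule has_derivative_compose[of "\<lambda>y. (t, y)" "\<lambda>h. (0, h)", OF _ \<phi>']) (auto intro!: derivative_eq_intros)
  then obtain p where "\<forall>h. \<phi>' (0, h) = h \<bullet> p" using Riesz_representation[OF has_derivative_bounded_linear] by blast
  then have "GDERIV (\<lambda>y. \<phi> (t, y)) x :> p" using space by (simp add: gderiv_def)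
  then show "GDERIV (\<lambda>y. \<phi> (t, y)) x :> space_grad \<phi> (t, x)" using space_grad_eqI by metis
  have "((\<lambda>s. \<phi> (s, x)) has_derivative (\<lambda>h. \<phi>' (h, 0))) (at t)"
    by (rule has_derivative_compose[of "\<lambda>s. (s, x)" "\<lambda>h. (h, 0)", OF _ \<phi>']) (auto intro!: derivative_eq_intros)
  then have "(\<lambda>s. \<phi> (s, x)) differentiable (at t)" by (auto simp: differentiable_def)
  then show "((\<lambda>s. \<phi> (s, x)) has_real_derivative time_deriv \<phi> (t, x)) (at t)"
    by (simp add: time_deriv_def DERIV_deriv_iff_real_differentiable)
qed

lemma space_mean_value:
  fixes \<phi> :: "real \<times> 'a::{real_inner, banach} \<Rightarrow> real"
  assumes "\<And>z. \<phi> differentiable (at (s, z))"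
  obtains z where "norm (z - x) \<le> norm (y - x)" "\<phi> (s, y) - \<phi> (s, x) = (y - x) \<bullet> space_grad \<phi> (s, z)"
proof -
  define z where "z \<sigma> = x + \<sigma> *\<^sub>R (y - x)" for \<sigma> :: real
  have "((\<lambda>\<sigma>. \<phi> (s, z \<sigma>)) has_derivative (\<lambda>k. k * ((y - x) \<bullet> space_grad \<phi> (s, z \<sigma>)))) (at \<sigma> within {0..1})" for \<sigma>
  proof -
    have "((\<lambda>y. \<phi> (s, y)) has_derivative (\<lambda>h. h \<bullet> space_grad \<phi> (s, z \<sigma>))) (at (z \<sigma>))"
      using differentiable_partials(1)[OF assms] by (simp add: gderiv_def)
    moreover have "(z has_derivative (\<lambda>k. k *\<^sub>R (y - x))) (at \<sigma> within {0..1})"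
      unfolding z_def by (auto intro!: derivative_eq_intros)
    ultimately show ?thesis using has_derivative_compose by (fastforce simp: inner_scaleR_left)
  qed
  then obtain \<sigma> where \<sigma>: "\<sigma> \<in> {0..1}" "\<phi> (s, z 1) - \<phi> (s, z 0) = (1 - 0) * ((y - x) \<bullet> space_grad \<phi> (s, z \<sigma>))"
    using mvt_very_simple[of 0 1 "\<lambda>\<sigma>. \<phi> (s, z \<sigma>)" "\<lambda>\<sigma> k. k * ((y - x) \<bullet> space_grad \<phi> (s, z \<sigma>))"] by auto
  have "norm (z \<sigma> - x) \<le> norm (y - x)"
    using \<sigma>(1) by (auto simp: z_def intro!: mult_left_le_one_le)
  moreover have "\<phi> (s, y) - \<phi> (s, x) = (y - x) \<bullet> space_grad \<phi> (s, z \<sigma>)" using \<sigma>(2) by (simp add: z_def)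
  ultimately show ?thesis by (rule that)
qed

definition radial_derivative :: "(real \<Rightarrow> real) \<Rightarrow> (real \<Rightarrow> real) \<Rightarrow> bool" where
  "radial_derivative h h' \<longleftrightarrow> (\<forall>r\<ge>0. (h has_real_derivative h' r) (at r within {0..})) \<and>
     continuous_on {0..} h' \<and> h' 0 = 0 \<and> (\<forall>r\<ge>0. 0 \<le> h' r)"

lemma test_h_radial_derivative:
  assumes "test_h h"
  obtains h' where "radial_derivative h h'"
  using assms unfolding test_h_def radial_derivative_def by (metis order_le_less)

lemma GDERIV_radial:
  fixes x :: "'a::real_inner"
  assumes "radial_derivative h h'"
  shows "GDERIV (\<lambda>y. h (norm y)) x :> h' (norm x) *\<^sub>R sgn x"
proof (cases "x = 0")
  case False
  then have "at (norm x) within {0..} = at (norm x)" by (intro at_within_interior) simp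
  then have "DERIV h (norm x) :> h' (norm x)"
    using assms by (metis norm_ge_zero radial_derivative_def)
  then show ?thesis using GDERIV_DERIV_compose[OF GDERIV_norm[OF False]] by blast
next
  case True
  have "(h has_derivative (*) 0) (at 0 within {0..})"
    using assms unfolding radial_derivative_def has_field_derivative_def by (metis order_refl)
  then have flat: "\<forall>e>0. \<exists>d>0. \<forall>r\<in>{0..}. norm (r - 0) < d \<longrightarrow> norm (h r - h 0 - 0 * (r - 0)) \<le> e * norm (r - 0)"
    unfolding has_derivative_within_alt by blast
  have "((\<lambda>y. h (norm y)) has_derivative (\<lambda>k. 0)) (at x)"
    unfolding has_derivative_within_alt
  proof (intro conjI allI impI bounded_linear_zero)
    fix e :: real assume "e > 0"
    with flat obtain d where d: "d > 0"
      "\<forall>r\<in>{0..}. norm (r - 0) < d \<longrightarrow> norm (h r - h 0 - 0 * (r - 0)) \<le> e * norm (r - 0)" by blast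
    have "\<bar>h r - h 0\<bar> \<le> e * r" if "r \<ge> 0" "r < d" for r using bspec[OF d(2), of r] that by simp
    with d(1) show "\<exists>d>0. \<forall>y\<in>UNIV. norm (y - x) < d \<longrightarrow> norm (h (norm y) - h (norm x) - 0) \<le> e * norm (y - x)"
      using True by (intro exI[of _ d]) auto
  qed
  then show ?thesis using True by (simp add: gderiv_def)
qed

lemma dist_Pair_le: "dist (a, b) (c, d) \<le> dist a c + dist b d"
  unfolding dist_Pair_Pair by (rule order_trans[OF sqrt_sum_squares_le_sum]) auto

lemma radial_gradient_tendsto:
  fixes x :: "'a::real_inner"
  assumes "radial_derivative h h'"
  shows "((\<lambda>(\<xi>, y). h' \<xi> *\<^sub>R sgn y) \<longlongrightarrow> h' (norm x) *\<^sub>R sgn x) (at (norm x, x) within {0..} \<times> UNIV)"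
proof -
  have "continuous_on {0..} h'" using assms by (simp add: radial_derivative_def)
  then have "continuous_on ({0..} \<times> (UNIV :: 'a set)) (\<lambda>p. h' (fst p))"
    by (rule continuous_on_compose2) (auto intro!: continuous_intros)
  then have h'_lim: "((\<lambda>p. h' (fst p)) \<longlongrightarrow> h' (norm x)) (at (norm x, x) within {0..} \<times> UNIV)"
    unfolding continuous_on_def by force
  show ?thesis
  proof (cases "x = 0")
    case True
    then have "h' (norm x) = 0" using assms by (simp add: radial_derivative_def)
    then have null: "((\<lambda>p. norm (h' (fst p))) \<longlongrightarrow> 0) (at (norm x, x) within {0..} \<times> UNIV)"
      using tendsto_norm_zero[OF h'_lim[unfolded \<open>h' (norm x) = 0\<close>]] by simp
    have "((\<lambda>(\<xi>, y). h' \<xi> *\<^sub>R sgn y) \<longlongrightarrow> 0) (at (norm x, x) within {0..} \<times> UNIV)"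
      by (rule Lim_null_comparison[OF _ null]) (auto simp: norm_sgn split: prod.split)
    then show ?thesis using True by simp
  next
    case False
    have "((\<lambda>p. sgn (snd p)) \<longlongrightarrow> sgn x) (at (norm x, x) within {0..} \<times> UNIV)"
      using False by (intro tendsto_sgn) (auto intro!: tendsto_eq_intros)
    from tendsto_scaleR[OF h'_lim this] show ?thesis by (simp add: case_prod_unfold)
  qed
qed

lemma radial_gradient_near:
  fixes x :: "'a::real_inner"
  assumes "radial_derivative h h'" "e > 0"
  shows "\<exists>d>0. \<forall>\<xi> y. 0 \<le> \<xi> \<longrightarrow> \<bar>\<xi> - norm x\<bar> < d \<longrightarrow> norm (y - x) < d \<longrightarrow>
    norm (h' \<xi> *\<^sub>R sgn y - h' (norm x) *\<^sub>R sgn x) < e"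
proof -
  have "continuous (at (norm x, x) within {0..} \<times> UNIV) (\<lambda>(\<xi>, y). h' \<xi> *\<^sub>R sgn y)"
    using radial_gradient_tendsto[OF assms(1)] by (simp add: continuous_within)
  then obtain d where d: "d > 0" "\<And>\<xi> y. 0 \<le> \<xi> \<Longrightarrow> dist (\<xi>, y) (norm x, x) < d \<Longrightarrow>
      dist (h' \<xi> *\<^sub>R sgn y) (h' (norm x) *\<^sub>R sgn x) < e"
    using assms(2) unfolding continuous_within_eps_delta by fastforce
  have "norm (h' \<xi> *\<^sub>R sgn y - h' (norm x) *\<^sub>R sgn x) < e"
    if "0 \<le> \<xi>" "\<bar>\<xi> - norm x\<bar> < d / 2" "norm (y - x) < d / 2" for \<xi> y
    using d(2)[of \<xi> y] that dist_Pair_le[of \<xi> y "norm x" x] by (simp add: dist_norm)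
  then show ?thesis using d(1) by (intro exI[of _ "d / 2"]) auto
qed

lemma radial_mean_value:
  assumes "radial_derivative h h'" "0 \<le> a" "a \<le> b"
  obtains \<xi> where "a \<le> \<xi>" "\<xi> \<le> b" "h b - h a = h' \<xi> * (b - a)"
proof -
  have "\<exists>\<xi>\<in>{a..b}. h b - h a = h' \<xi> * (b - a)"
  proof (rule mvt_very_simple[OF assms(3), of h "\<lambda>r k. h' r * k"])
    fix r assume "a \<le> r" "r \<le> b"
    then have "(h has_real_derivative h' r) (at r within {0..})"
      using assms(1,2) by (simp add: radial_derivative_def)
    then have "(h has_real_derivative h' r) (at r within {a..b})"
      by (rule DERIV_subset) (use assms(2) in auto)
    then show "(h has_derivative (\<lambda>k. h' r * k)) (at r within {a..b})" unfolding has_field_derivative_def .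
  qed
  then show ?thesis using that by auto
qed

lemma norm_diff_le_inner_sgn: "norm y - norm z \<le> sgn y \<bullet> (y - z)" for y z :: "'a::real_inner"
proof -
  have "sgn y \<bullet> y = norm y" by (cases "y = 0") (auto simp: sgn_div_norm dot_square_norm power2_eq_square)
  moreover have "sgn y \<bullet> z \<le> norm z"
    using norm_cauchy_schwarz[of "sgn y" z] by (cases "y = 0") (auto simp: norm_sgn)
  ultimately show ?thesis by (simp add: inner_diff_right)
qed

lemma radial_increment_le:
  fixes x y z :: "'a::real_inner"
  assumes radial: "radial_derivative h h'" and z: "norm z \<le> norm x"
  obtains \<xi> where "0 \<le> \<xi>" "\<bar>\<xi> - norm x\<bar> \<le> max (norm (y - x)) (norm (z - x))"
    "h (norm y) - h (norm x) \<le> (h' \<xi> *\<^sub>R sgn y) \<bullet> (y - z)"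
proof -
  have h'_nonneg: "0 \<le> h' r" if "0 \<le> r" for r using radial that by (simp add: radial_derivative_def)
  have mean_value: "\<exists>\<xi>. min a b \<le> \<xi> \<and> \<xi> \<le> max a b \<and> h b - h a = h' \<xi> * (b - a)" if "0 \<le> a" "0 \<le> b" for a b
  proof (cases "a \<le> b")
    case True
    then show ?thesis using radial_mean_value[OF radial \<open>0 \<le> a\<close> True] by (metis max_absorb2 min_absorb1)
  next
    case False
    then obtain \<xi> where "b \<le> \<xi>" "\<xi> \<le> a" "h a - h b = h' \<xi> * (a - b)"
      using radial_mean_value[OF radial \<open>0 \<le> b\<close>, of a] by auto
    then show ?thesis using False by (intro exI[of _ \<xi>]) (auto simp: algebra_simps)
  qed
  obtain \<zeta> where "norm z \<le> \<zeta>" "h (norm x) - h (norm z) = h' \<zeta> * (norm x - norm z)"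
    using radial_mean_value[OF radial norm_ge_zero z] by blast
  moreover from this have "0 \<le> h' \<zeta>" using h'_nonneg order_trans[OF norm_ge_zero] by blast
  then have "0 \<le> h' \<zeta> * (norm x - norm z)" using z by simp
  ultimately have decreases: "h (norm z) \<le> h (norm x)" by linarith
  obtain \<xi> where \<xi>: "min (norm z) (norm y) \<le> \<xi>" "\<xi> \<le> max (norm z) (norm y)"
    "h (norm y) - h (norm z) = h' \<xi> * (norm y - norm z)"
    using mean_value[OF norm_ge_zero norm_ge_zero] by blast
  have "0 \<le> \<xi>" using order_trans[OF _ \<xi>(1), of 0] by simp
  have "h (norm y) - h (norm x) \<le> h' \<xi> * (sgn y \<bullet> (y - z))"
    using \<xi>(3) decreases mult_left_mono[OF norm_diff_le_inner_sgn h'_nonneg[OF \<open>0 \<le> \<xi>\<close>], of y z] by linarith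
  moreover have "\<bar>\<xi> - norm x\<bar> \<le> max (norm (y - x)) (norm (z - x))"
    using \<xi>(1,2) norm_triangle_ineq3[of y x] norm_triangle_ineq3[of z x] by (auto simp: min_def max_def split: if_splits)
  ultimately show ?thesis using that \<open>0 \<le> \<xi>\<close> by simp
qed

lemma test_phi_differentiable:
  assumes "test_phi D A B T \<phi>" "t \<in> {0<..<T}"
  shows "\<phi> differentiable (at (t, x))" "space_grad \<phi> (t, x) \<in> adj_domain D A"
  using assms by (auto simp: test_phi_def C1_on_cylinder_def)

lemma test_phi_isCont:
  fixes x :: "'a::real_inner"
  assumes \<phi>: "test_phi D A B T \<phi>" and t: "t \<in> {0<..<T}"
  shows "isCont (time_deriv \<phi>) (t, x)" "isCont (space_grad \<phi>) (t, x)"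
    "isCont (\<lambda>z. adj_op D A (space_grad \<phi> z)) (t, x)"
proof -
  have "open ({0<..<T} \<times> (UNIV :: 'a set))" by (intro open_Times) auto
  then show "isCont (time_deriv \<phi>) (t, x)" "isCont (space_grad \<phi>) (t, x)"
    using \<phi> t by (auto simp: test_phi_def C1_on_cylinder_def continuous_on_eq_continuous_at)
  define \<theta> where "\<theta> = min t (T - t) / 2"
  have \<theta>: "\<theta> > 0" "\<theta> < t" "t < T - \<theta>" using t by (auto simp: \<theta>_def min_def field_simps)
  have "continuous_on ({\<theta>..T - \<theta>} \<times> UNIV) (\<lambda>z. adj_op D A (space_grad \<phi> z))"
    using \<phi> \<theta>(1) by (auto simp: test_phi_def intro: uniformly_continuous_imp_continuous)
  then have "continuous_on ({\<theta><..<T - \<theta>} \<times> UNIV) (\<lambda>z. adj_op D A (space_grad \<phi> z))"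
    by (rule continuous_on_subset) auto
  moreover have "open ({\<theta><..<T - \<theta>} \<times> (UNIV :: 'a set))" by (intro open_Times) auto
  ultimately show "isCont (\<lambda>z. adj_op D A (space_grad \<phi> z)) (t, x)"
    using \<theta> by (auto simp: continuous_on_eq_continuous_at)
qed

definition test_function :: "(real \<times> 'a \<Rightarrow> real) \<Rightarrow> (real \<Rightarrow> real) \<Rightarrow> real \<times> 'a::real_inner \<Rightarrow> real" where
  "test_function \<phi> h = (\<lambda>(s, y). \<phi> (s, y) + h (norm y))"

lemma test_function_partials:
  fixes x :: "'a::{real_inner, banach}"
  assumes "test_phi D A B T \<phi>" "t \<in> {0<..<T}" "radial_derivative h h'"
  shows "GDERIV (\<lambda>y. test_function \<phi> h (t, y)) x :> space_grad \<phi> (t, x) + h' (norm x) *\<^sub>R sgn x"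
    "((\<lambda>s. test_function \<phi> h (s, x)) has_real_derivative time_deriv \<phi> (t, x)) (at t)"
  unfolding test_function_def split_conv
  using differentiable_partials[OF test_phi_differentiable(1)[OF assms(1,2)]]
  by (auto intro!: GDERIV_add GDERIV_radial[OF assms(3)] derivative_eq_intros)

lemma space_grad_test_function:
  fixes x :: "'a::{real_inner, banach}"
  assumes "test_phi D A B T \<phi>" "t \<in> {0<..<T}" "radial_derivative h h'"
  shows "space_grad (test_function \<phi> h) (t, x) = space_grad \<phi> (t, x) + h' (norm x) *\<^sub>R sgn x"
  by (rule space_grad_eqI[OF test_function_partials(1)[OF assms]])

definition derivatives_close ::
    "'a::real_inner set \<Rightarrow> ('a \<Rightarrow> 'a) \<Rightarrow> (real \<times> 'a \<Rightarrow> real) \<Rightarrow> real \<Rightarrow> real \<times> 'a \<Rightarrow> real \<times> 'a \<Rightarrow> bool" where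
  "derivatives_close D A \<phi> \<kappa> z z' \<longleftrightarrow> \<bar>time_deriv \<phi> z - time_deriv \<phi> z'\<bar> \<le> \<kappa> \<and>
     norm (space_grad \<phi> z - space_grad \<phi> z') \<le> \<kappa> \<and>
     norm (adj_op D A (space_grad \<phi> z) - adj_op D A (space_grad \<phi> z')) \<le> \<kappa>"

lemma test_phi_derivatives_close:
  fixes x :: "'a::real_inner"
  assumes \<phi>: "test_phi D A B T \<phi>" and t: "t \<in> {0<..<T}" and "\<kappa> > 0"
  shows "\<exists>\<delta>>0. \<forall>s y. \<bar>s - t\<bar> < \<delta> \<longrightarrow> norm (y - x) < \<delta> \<longrightarrow> s \<in> {0<..<T} \<and> derivatives_close D A \<phi> \<kappa> (s, y) (t, x)"
proof -
  have near: "\<forall>\<^sub>F z in nhds (t, x). dist (f z) (f (t, x)) < \<kappa>"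
    if "isCont f (t, x)" for f :: "real \<times> 'a \<Rightarrow> 'c::metric_space"
    using that \<open>\<kappa> > 0\<close> tendstoD unfolding isCont_def tendsto_at_iff_tendsto_nhds by blast
  have "\<forall>\<^sub>F z in nhds (t, x). z \<in> {0<..<T} \<times> UNIV"
    using t by (intro eventually_nhds_in_open open_Times) auto
  then have "\<forall>\<^sub>F z in nhds (t, x). z \<in> {0<..<T} \<times> UNIV \<and> derivatives_close D A \<phi> \<kappa> z (t, x)"
    using near[OF test_phi_isCont(1)[OF \<phi> t]] near[OF test_phi_isCont(2)[OF \<phi> t]] near[OF test_phi_isCont(3)[OF \<phi> t]]
    by eventually_elim (simp add: derivatives_close_def dist_norm less_imp_le)
  then obtain d where d: "d > 0" "\<And>z. dist z (t, x) < d \<Longrightarrow> z \<in> {0<..<T} \<times> UNIV \<and> derivatives_close D A \<phi> \<kappa> z (t, x)"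
    unfolding eventually_nhds_metric by blast
  have "s \<in> {0<..<T} \<and> derivatives_close D A \<phi> \<kappa> (s, y) (t, x)" if "\<bar>s - t\<bar> < d / 2" "norm (y - x) < d / 2" for s y
    using d(2)[of "(s, y)"] that dist_Pair_le[of s y t x] by (simp add: dist_norm)
  then show ?thesis using d(1) by (intro exI[of _ "d / 2"]) auto
qed

context generated_contraction
begin

text \<open>Only one mean value step in space is needed: the gradient at the intermediate point lies in the domain
  of the adjoint, so that the semigroup part of the increment is of first order in \<open>\<epsilon>\<close> although
  \<open>x\<close> need not lie in the domain of \<open>A\<close>.\<close>

lemma test_phi_increment_le:
  fixes x y :: 'a
  assumes \<phi>: "test_phi domA A B T \<phi>" and \<epsilon>: "0 < \<epsilon>" and \<kappa>: "\<kappa> \<le> 1"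
    and close: "\<And>s z. t \<le> s \<Longrightarrow> s \<le> t + \<epsilon> \<Longrightarrow> norm (z - x) \<le> norm (y - x) \<Longrightarrow>
      s \<in> {0<..<T} \<and> derivatives_close domA A \<phi> \<kappa> (s, z) (t, x)"
    and S_near: "\<And>\<rho>. 0 \<le> \<rho> \<Longrightarrow> \<rho> \<le> \<epsilon> \<Longrightarrow> norm (S \<rho> x - x) \<le> \<kappa>"
  defines "p \<equiv> space_grad \<phi> (t, x)"
  defines "a \<equiv> adj_op domA A p"
  obtains q where "norm (q - p) \<le> \<kappa>"
    "\<phi> (t + \<epsilon>, y) - \<phi> (t, x)
      \<le> \<epsilon> * (time_deriv \<phi> (t, x) - x \<bullet> a + \<kappa> * (norm a + norm x + 2)) + (y - S \<epsilon> x) \<bullet> q"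
proof -
  have time_derivative: "((\<lambda>s. \<phi> (s, x)) has_real_derivative time_deriv \<phi> (s, x)) (at s)" if "t \<le> s" "s \<le> t + \<epsilon>" for s
    using close[OF that, of x] test_phi_differentiable(1)[OF \<phi>] by (intro differentiable_partials(2)) simp
  obtain s where s: "t < s" "s < t + \<epsilon>" "\<phi> (t + \<epsilon>, x) - \<phi> (t, x) = (t + \<epsilon> - t) * time_deriv \<phi> (s, x)"
    using MVT2[of t "t + \<epsilon>" "\<lambda>s. \<phi> (s, x)" "\<lambda>s. time_deriv \<phi> (s, x)"] \<epsilon> time_derivative by auto
  have "time_deriv \<phi> (s, x) \<le> time_deriv \<phi> (t, x) + \<kappa>"
    using close[of s x] s by (simp add: derivatives_close_def abs_le_iff)
  then have time_part: "\<phi> (t + \<epsilon>, x) - \<phi> (t, x) \<le> \<epsilon> * (time_deriv \<phi> (t, x) + \<kappa>)"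
    using s(3) \<epsilon> by (simp add: mult_left_mono)
  have "t + \<epsilon> \<in> {0<..<T}" using close[of "t + \<epsilon>" x] \<epsilon> by simp
  note end_time = test_phi_differentiable[OF \<phi> this]
  obtain z where z: "norm (z - x) \<le> norm (y - x)"
    "\<phi> (t + \<epsilon>, y) - \<phi> (t + \<epsilon>, x) = (y - x) \<bullet> space_grad \<phi> (t + \<epsilon>, z)"
    using space_mean_value[OF end_time(1)] by blast
  define q where "q = space_grad \<phi> (t + \<epsilon>, z)"
  have q: "norm (q - p) \<le> \<kappa>" "norm (adj_op domA A q - a) \<le> \<kappa>"
    using close[of "t + \<epsilon>" z] z(1) \<epsilon> by (auto simp: derivatives_close_def q_def p_def a_def)
  have semigroup_part: "(S \<epsilon> x - x) \<bullet> q \<le> \<epsilon> * (\<kappa> * (norm a + norm x + 1) - x \<bullet> a)"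
    by (intro S_displacement_inner_le q(2) \<kappa> S_near) (use end_time(2) \<epsilon> in \<open>simp_all add: q_def\<close>)
  have "(y - x) \<bullet> q = (y - S \<epsilon> x) \<bullet> q + (S \<epsilon> x - x) \<bullet> q" by (simp flip: inner_add_left)
  then have "\<phi> (t + \<epsilon>, y) - \<phi> (t, x)
      \<le> \<epsilon> * (time_deriv \<phi> (t, x) - x \<bullet> a + \<kappa> * (norm a + norm x + 2)) + (y - S \<epsilon> x) \<bullet> q"
    using time_part z(2) semigroup_part by (simp add: q_def algebra_simps)
  then show ?thesis using that q(1) by blast
qed

lemma test_function_increment_le:
  fixes x y :: 'a
  assumes \<phi>: "test_phi domA A B T \<phi>" and radial: "radial_derivative h h'" and \<epsilon>: "0 < \<epsilon>" and \<kappa>: "\<kappa> \<le> 1"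
    and close: "\<And>s z. t \<le> s \<Longrightarrow> s \<le> t + \<epsilon> \<Longrightarrow> norm (z - x) \<le> norm (y - x) \<Longrightarrow>
      s \<in> {0<..<T} \<and> derivatives_close domA A \<phi> \<kappa> (s, z) (t, x)"
    and S_near: "\<And>\<rho>. 0 \<le> \<rho> \<Longrightarrow> \<rho> \<le> \<epsilon> \<Longrightarrow> norm (S \<rho> x - x) \<le> \<kappa>"
    and radial_near: "\<And>\<xi>. 0 \<le> \<xi> \<Longrightarrow> \<bar>\<xi> - norm x\<bar> \<le> max (norm (y - x)) (norm (S \<epsilon> x - x)) \<Longrightarrow>
      norm (h' \<xi> *\<^sub>R sgn y - h' (norm x) *\<^sub>R sgn x) \<le> \<kappa>"
  defines "a \<equiv> adj_op domA A (space_grad \<phi> (t, x))"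
  obtains \<pi> where "norm (\<pi> - space_grad (test_function \<phi> h) (t, x)) \<le> 2 * \<kappa>"
    "test_function \<phi> h (t + \<epsilon>, y) - test_function \<phi> h (t, x)
      \<le> \<epsilon> * (time_deriv \<phi> (t, x) - x \<bullet> a + \<kappa> * (norm a + norm x + 2)) + (y - S \<epsilon> x) \<bullet> \<pi>"
proof -
  have t: "t \<in> {0<..<T}" using close[of t x] \<epsilon> by simp
  obtain q where q: "norm (q - space_grad \<phi> (t, x)) \<le> \<kappa>" and \<phi>_part: "\<phi> (t + \<epsilon>, y) - \<phi> (t, x)
      \<le> \<epsilon> * (time_deriv \<phi> (t, x) - x \<bullet> a + \<kappa> * (norm a + norm x + 2)) + (y - S \<epsilon> x) \<bullet> q"
    using test_phi_increment_le[OF \<phi> \<epsilon> \<kappa> close S_near] unfolding a_def by blast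
  have "norm (S \<epsilon> x) \<le> norm x" using \<epsilon> by (intro norm_S_apply_le) simp
  then obtain \<xi> where \<xi>: "0 \<le> \<xi>" "\<bar>\<xi> - norm x\<bar> \<le> max (norm (y - x)) (norm (S \<epsilon> x - x))"
    and h_part: "h (norm y) - h (norm x) \<le> (h' \<xi> *\<^sub>R sgn y) \<bullet> (y - S \<epsilon> x)"
    by (rule radial_increment_le[OF radial])
  define \<pi> where "\<pi> = q + h' \<xi> *\<^sub>R sgn y"
  have "\<pi> - space_grad (test_function \<phi> h) (t, x)
      = (q - space_grad \<phi> (t, x)) + (h' \<xi> *\<^sub>R sgn y - h' (norm x) *\<^sub>R sgn x)"
    by (simp add: \<pi>_def space_grad_test_function[OF \<phi> t radial])
  also have "norm \<dots> \<le> \<kappa> + \<kappa>" by (intro norm_triangle_mono q radial_near \<xi>)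
  finally have "norm (\<pi> - space_grad (test_function \<phi> h) (t, x)) \<le> 2 * \<kappa>" by simp
  moreover have "test_function \<phi> h (t + \<epsilon>, y) - test_function \<phi> h (t, x)
      \<le> \<epsilon> * (time_deriv \<phi> (t, x) - x \<bullet> a + \<kappa> * (norm a + norm x + 2)) + (y - S \<epsilon> x) \<bullet> \<pi>"
    using \<phi>_part h_part unfolding test_function_def \<pi>_def inner_add_right inner_commute[of "h' \<xi> *\<^sub>R sgn y"] by simp
  ultimately show ?thesis by (rule that)
qed

lemma test_function_expansion:
  fixes x :: 'a
  assumes \<phi>: "test_phi domA A B T \<phi>" and "test_h h" and t: "t \<in> {0<..<T}" and "\<eta> > 0"
  defines "a \<equiv> adj_op domA A (space_grad \<phi> (t, x))"
  shows "\<exists>\<delta>>0. \<forall>\<epsilon> y. 0 < \<epsilon> \<longrightarrow> \<epsilon> < \<delta> \<longrightarrow> norm (y - x) < \<delta> \<longrightarrow>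
    (\<exists>\<pi>. norm (\<pi> - space_grad (test_function \<phi> h) (t, x)) \<le> \<eta> \<and>
      test_function \<phi> h (t + \<epsilon>, y) - test_function \<phi> h (t, x)
        \<le> \<epsilon> * (time_deriv \<phi> (t, x) - x \<bullet> a + \<eta>) + (y - S \<epsilon> x) \<bullet> \<pi>)"
proof -
  obtain h' where radial: "radial_derivative h h'" using test_h_radial_derivative[OF \<open>test_h h\<close>] .
  obtain \<kappa> where \<kappa>: "\<kappa> > 0" "\<kappa> \<le> 1" "(norm a + norm x + 2) * \<kappa> \<le> \<eta>"
    using small_scale_exists[OF \<open>\<eta> > 0\<close>] by metis
  have "2 * \<kappa> \<le> (norm a + norm x + 2) * \<kappa>" using \<kappa>(1) by (intro mult_right_mono) auto
  obtain d\<^sub>\<phi> where d\<^sub>\<phi>: "d\<^sub>\<phi> > 0" "\<And>s y. \<bar>s - t\<bar> < d\<^sub>\<phi> \<Longrightarrow> norm (y - x) < d\<^sub>\<phi> \<Longrightarrow>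
      s \<in> {0<..<T} \<and> derivatives_close domA A \<phi> \<kappa> (s, y) (t, x)"
    using test_phi_derivatives_close[OF \<phi> t \<kappa>(1)] by blast
  obtain d\<^sub>h where d\<^sub>h: "d\<^sub>h > 0" "\<And>\<xi> y. 0 \<le> \<xi> \<Longrightarrow> \<bar>\<xi> - norm x\<bar> < d\<^sub>h \<Longrightarrow> norm (y - x) < d\<^sub>h \<Longrightarrow>
      norm (h' \<xi> *\<^sub>R sgn y - h' (norm x) *\<^sub>R sgn x) < \<kappa>"
    using radial_gradient_near[OF radial \<kappa>(1), of x] by blast
  have "min \<kappa> d\<^sub>h > 0" using \<kappa>(1) d\<^sub>h(1) by simp
  then obtain d\<^sub>S where d\<^sub>S: "d\<^sub>S > 0" "\<And>r. 0 \<le> r \<Longrightarrow> r < d\<^sub>S \<Longrightarrow> norm (S r x - x) < min \<kappa> d\<^sub>h"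
    using S_near_id by blast
  have "\<exists>\<pi>. norm (\<pi> - space_grad (test_function \<phi> h) (t, x)) \<le> \<eta> \<and>
      test_function \<phi> h (t + \<epsilon>, y) - test_function \<phi> h (t, x)
        \<le> \<epsilon> * (time_deriv \<phi> (t, x) - x \<bullet> a + \<eta>) + (y - S \<epsilon> x) \<bullet> \<pi>"
    if \<epsilon>: "0 < \<epsilon>" "\<epsilon> < min d\<^sub>\<phi> d\<^sub>S" and y: "norm (y - x) < min d\<^sub>\<phi> d\<^sub>h" for \<epsilon> y
  proof -
    have close: "s \<in> {0<..<T} \<and> derivatives_close domA A \<phi> \<kappa> (s, z) (t, x)"
      if "t \<le> s" "s \<le> t + \<epsilon>" "norm (z - x) \<le> norm (y - x)" for s z
      using d\<^sub>\<phi>(2)[of s z] that \<epsilon> y by simp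
    have S_near: "norm (S \<rho> x - x) \<le> \<kappa>" if "0 \<le> \<rho>" "\<rho> \<le> \<epsilon>" for \<rho> using d\<^sub>S(2)[of \<rho>] that \<epsilon> by simp
    have radial_near: "norm (h' \<xi> *\<^sub>R sgn y - h' (norm x) *\<^sub>R sgn x) \<le> \<kappa>"
      if "0 \<le> \<xi>" "\<bar>\<xi> - norm x\<bar> \<le> max (norm (y - x)) (norm (S \<epsilon> x - x))" for \<xi>
      by (rule less_imp_le, rule d\<^sub>h(2)) (use d\<^sub>S(2)[of \<epsilon>] that \<epsilon> y in auto)
    obtain \<pi> where \<pi>: "norm (\<pi> - space_grad (test_function \<phi> h) (t, x)) \<le> 2 * \<kappa>"
      "test_function \<phi> h (t + \<epsilon>, y) - test_function \<phi> h (t, x)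
        \<le> \<epsilon> * (time_deriv \<phi> (t, x) - x \<bullet> a + \<kappa> * (norm a + norm x + 2)) + (y - S \<epsilon> x) \<bullet> \<pi>"
      unfolding a_def by (rule test_function_increment_le[OF \<phi> radial \<epsilon>(1) \<kappa>(2) close S_near radial_near])
    have "\<epsilon> * (\<kappa> * (norm a + norm x + 2)) \<le> \<epsilon> * \<eta>" using \<kappa>(3) \<epsilon>(1) by (simp add: mult.commute)
    then show ?thesis
      using \<pi> \<kappa>(3) \<open>2 * \<kappa> \<le> (norm a + norm x + 2) * \<kappa>\<close> unfolding distrib_left by (intro exI[of _ \<pi>]) linarith
  qed
  then show ?thesis using d\<^sub>\<phi>(1) d\<^sub>S(1) d\<^sub>h(1) by (intro exI[of _ "min (min d\<^sub>\<phi> d\<^sub>S) (min d\<^sub>\<phi> d\<^sub>h)"]) auto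
qed

end

context control_system
begin

lemma inner_mild_displacement_le:
  assumes u: "set_integrable lebesgue {t..T} u" and X: "mild T t x u X" and "t \<le> T"
    and F_part: "\<And>\<tau>. \<tau> \<in> {t..T} \<Longrightarrow> F (X \<tau>) \<bullet> adjoint (S (T - \<tau>)) p \<le> k"
  defines "w \<equiv> \<lambda>\<tau>. adjoint (G (X \<tau>)) (adjoint (S (T - \<tau>)) p)"
  shows "set_integrable lebesgue {t..T} (\<lambda>\<tau>. u \<tau> \<bullet> w \<tau>)"
    "(X T - S (T - t) x) \<bullet> p \<le> (T - t) * k + (LINT \<tau>:{t..T}|lebesgue. u \<tau> \<bullet> w \<tau>)"
proof -
  note displacement = inner_mild_displacement[OF assms(1-3), of p]
  have decompose: "drift (X \<tau>) (u \<tau>) \<bullet> adjoint (S (T - \<tau>)) p = F (X \<tau>) \<bullet> adjoint (S (T - \<tau>)) p + u \<tau> \<bullet> w \<tau>" for \<tau>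
    by (simp add: drift_def w_def blinfun.add_right inner_add_left inner_adjoint_blinfun)
  have "set_integrable lebesgue {t..T} (\<lambda>_. 0 :: 'a)" by (simp add: set_integrable_def)
  from set_integrable_drift[OF mild_continuous[OF X] this] have "set_integrable lebesgue {t..T} (\<lambda>\<tau>. F (X \<tau>))"
    by (simp add: drift_def)
  then have "set_integrable lebesgue {t..T} (\<lambda>\<tau>. S (T - \<tau>) (F (X \<tau>)))"
    by (rule set_integrable_S) (use \<open>t \<le> T\<close> in simp)
  from set_integrable_blinfun[OF this, of "blinfun_inner_left p"]
  have F_integrable: "set_integrable lebesgue {t..T} (\<lambda>\<tau>. F (X \<tau>) \<bullet> adjoint (S (T - \<tau>)) p)"
    by (simp add: inner_adjoint_blinfun)
  from set_integral_diff(1)[OF displacement(1) this]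
  show w_integrable: "set_integrable lebesgue {t..T} (\<lambda>\<tau>. u \<tau> \<bullet> w \<tau>)" by (simp add: decompose)
  have "(LINT \<tau>:{t..T}|lebesgue. F (X \<tau>) \<bullet> adjoint (S (T - \<tau>)) p) \<le> (LINT \<tau>:{t..T}|lebesgue. k)"
    by (intro set_integral_mono F_integrable F_part set_integrable_continuous_interval continuous_on_const)
  also have "\<dots> = (T - t) * k" using \<open>t \<le> T\<close> by (simp add: set_integral_const_interval)
  finally show "(X T - S (T - t) x) \<bullet> p \<le> (T - t) * k + (LINT \<tau>:{t..T}|lebesgue. u \<tau> \<bullet> w \<tau>)"
    using displacement(2) by (simp add: decompose set_integral_add(2)[OF F_integrable w_integrable])
qed

lemma
  assumes "norm (q - P) \<le> \<kappa>" "norm (y - x) \<le> \<kappa>" "\<kappa> \<le> 1"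
  shows inner_F_perturbation_le: "F y \<bullet> q \<le> F x \<bullet> P + (Lip * (norm P + 1) + norm (F x)) * \<kappa>"
    and norm_adjoint_G_perturbation_le: "norm (adjoint (G y) q - adjoint (G x) P) \<le> (M + Lip * norm P) * \<kappa>"
proof -
  have "0 \<le> \<kappa>" using assms(1) norm_ge_zero order_trans by blast
  have Lip_\<kappa>: "Lip * norm (y - x) \<le> Lip * \<kappa>" by (intro mult_left_mono assms(2) Lip_nonneg)
  have "F y \<bullet> q - F x \<bullet> P = (F y - F x) \<bullet> q + F x \<bullet> (q - P)" by (simp add: inner_diff_left inner_diff_right)
  also have "\<dots> \<le> norm (F y - F x) * norm q + norm (F x) * norm (q - P)" by (intro add_mono norm_cauchy_schwarz)
  also have "\<dots> \<le> (Lip * \<kappa>) * (norm P + 1) + norm (F x) * \<kappa>"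
    using assms norm_triangle_sub[of q P] Lip_nonneg \<open>0 \<le> \<kappa>\<close>
    by (intro add_mono mult_mono order_trans[OF F_lipschitz Lip_\<kappa>]) auto
  finally show "F y \<bullet> q \<le> F x \<bullet> P + (Lip * (norm P + 1) + norm (F x)) * \<kappa>" by (simp add: algebra_simps)
  have "adjoint (G y) q - adjoint (G x) P = adjoint (G y) (q - P) + adjoint (G y - G x) P"
    by (simp add: adjoint_blinfun_diff_right adjoint_blinfun_diff_left)
  also have "norm \<dots> \<le> M * \<kappa> + (Lip * \<kappa>) * norm P"
    using assms(1) norm_G_le M_nonneg Lip_nonneg \<open>0 \<le> \<kappa>\<close>
    by (intro norm_triangle_mono order_trans[OF norm_adjoint_blinfun_le] mult_mono order_trans[OF G_lipschitz Lip_\<kappa>]) auto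
  finally show "norm (adjoint (G y) q - adjoint (G x) P) \<le> (M + Lip * norm P) * \<kappa>" by (simp add: algebra_simps)
qed

lemma mild_displacement_inner_perturbation_le:
  assumes u: "set_integrable lebesgue {t..r} u" and X: "mild r t x u X" and "t \<le> r"
    and \<pi>: "norm (\<pi> - P) \<le> \<kappa> / 2" and "\<kappa> \<le> 1"
    and adjoint_near: "\<And>s. 0 \<le> s \<Longrightarrow> s \<le> r - t \<Longrightarrow> norm (adjoint (S s) P - P) \<le> \<kappa> / 2"
    and X_near: "\<And>s. s \<in> {t..r} \<Longrightarrow> norm (X s - x) \<le> \<kappa>"
  obtains w where "\<And>\<tau>. \<tau> \<in> {t..r} \<Longrightarrow> norm (w \<tau> - adjoint (G x) P) \<le> (M + Lip * norm P) * \<kappa>"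
    "set_integrable lebesgue {t..r} (\<lambda>\<tau>. u \<tau> \<bullet> w \<tau>)"
    "(X r - S (r - t) x) \<bullet> \<pi> \<le> (r - t) * (F x \<bullet> P + (Lip * (norm P + 1) + norm (F x)) * \<kappa>)
      + (LINT \<tau>:{t..r}|lebesgue. u \<tau> \<bullet> w \<tau>)"
proof -
  define q where "q \<tau> = adjoint (S (r - \<tau>)) \<pi>" for \<tau>
  have q_near: "norm (q \<tau> - P) \<le> \<kappa>" if "\<tau> \<in> {t..r}" for \<tau>
  proof -
    have "q \<tau> - P = adjoint (S (r - \<tau>)) (\<pi> - P) + (adjoint (S (r - \<tau>)) P - P)"
      by (simp add: q_def adjoint_blinfun_diff_right)
    also have "norm \<dots> \<le> \<kappa> / 2 + \<kappa> / 2"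
      using that \<pi> by (intro norm_triangle_mono order_trans[OF norm_adjoint_S_le] adjoint_near) auto
    finally show ?thesis by simp
  qed
  define w where "w \<tau> = adjoint (G (X \<tau>)) (q \<tau>)" for \<tau>
  have "F (X \<tau>) \<bullet> q \<tau> \<le> F x \<bullet> P + (Lip * (norm P + 1) + norm (F x)) * \<kappa>" if "\<tau> \<in> {t..r}" for \<tau>
    by (intro inner_F_perturbation_le q_near X_near that \<open>\<kappa> \<le> 1\<close>)
  note displacement = inner_mild_displacement_le[OF u X \<open>t \<le> r\<close> this[unfolded q_def], folded q_def, folded w_def]
  have "norm (w \<tau> - adjoint (G x) P) \<le> (M + Lip * norm P) * \<kappa>" if "\<tau> \<in> {t..r}" for \<tau>
    unfolding w_def by (intro norm_adjoint_G_perturbation_le q_near X_near that \<open>\<kappa> \<le> 1\<close>)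
  then show ?thesis using displacement by (rule that)
qed

definition uncontrolled_rate :: "(real \<times> 'a \<Rightarrow> real) \<Rightarrow> (real \<Rightarrow> real) \<Rightarrow> real \<times> 'a \<Rightarrow> real" where
  "uncontrolled_rate \<phi> h = (\<lambda>(t, x). time_deriv \<phi> (t, x) - x \<bullet> adj_op domA A (space_grad \<phi> (t, x))
     + F x \<bullet> space_grad (test_function \<phi> h) (t, x))"

text \<open>\<open>w\<close> is the costate \<open>G\<^sup>*(X(\<tau>)) S\<^sup>*(t + \<epsilon> - \<tau>) \<pi>\<close> paired with the control, frozen up to the error \<open>\<eta>\<close> at its
  value for \<open>\<tau> = t\<close> and \<open>\<epsilon> = 0\<close>.\<close>

definition one_step_expansion ::
    "(real \<times> 'a \<Rightarrow> real) \<Rightarrow> (real \<Rightarrow> real) \<Rightarrow> real \<Rightarrow> real \<Rightarrow> real \<Rightarrow> 'a \<Rightarrow> bool" where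
  "one_step_expansion \<phi> h \<eta> \<delta> t x \<longleftrightarrow> (\<forall>\<epsilon> u X. 0 < \<epsilon> \<longrightarrow> \<epsilon> < \<delta> \<longrightarrow>
     set_integrable lebesgue {t..t + \<epsilon>} u \<longrightarrow> mild (t + \<epsilon>) t x u X \<longrightarrow>
     (\<forall>s\<in>{t..t + \<epsilon>}. norm (X s - x) < \<delta>) \<longrightarrow>
     (\<exists>w. (\<forall>\<tau>\<in>{t..t + \<epsilon>}. norm (w \<tau> - adjoint (G x) (space_grad (test_function \<phi> h) (t, x))) \<le> \<eta>) \<and>
       set_integrable lebesgue {t..t + \<epsilon>} (\<lambda>\<tau>. u \<tau> \<bullet> w \<tau>) \<and>
       test_function \<phi> h (t + \<epsilon>, X (t + \<epsilon>)) - test_function \<phi> h (t, x)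
         \<le> \<epsilon> * (uncontrolled_rate \<phi> h (t, x) + \<eta>) + (LINT \<tau>:{t..t + \<epsilon>}|lebesgue. u \<tau> \<bullet> w \<tau>)))"

lemma one_step_expansionE:
  assumes "one_step_expansion \<phi> h \<eta> \<delta> t x" "0 < \<epsilon>" "\<epsilon> < \<delta>" "set_integrable lebesgue {t..t + \<epsilon>} u"
    "mild (t + \<epsilon>) t x u X" "\<forall>s\<in>{t..t + \<epsilon>}. norm (X s - x) < \<delta>"
  obtains w where
    "\<forall>\<tau>\<in>{t..t + \<epsilon>}. norm (w \<tau> - adjoint (G x) (space_grad (test_function \<phi> h) (t, x))) \<le> \<eta>"
    "set_integrable lebesgue {t..t + \<epsilon>} (\<lambda>\<tau>. u \<tau> \<bullet> w \<tau>)"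
    "test_function \<phi> h (t + \<epsilon>, X (t + \<epsilon>)) - test_function \<phi> h (t, x)
      \<le> \<epsilon> * (uncontrolled_rate \<phi> h (t, x) + \<eta>) + (LINT \<tau>:{t..t + \<epsilon>}|lebesgue. u \<tau> \<bullet> w \<tau>)"
  using assms(1)[unfolded one_step_expansion_def, rule_format, OF assms(2-5) bspec[OF assms(6)]] that by blast

lemma one_step_expansion_exists:
  assumes \<phi>: "test_phi domA A B T \<phi>" and h: "test_h h" and t: "t \<in> {0<..<T}" and "\<eta> > 0"
  obtains \<delta> where "\<delta> > 0" "one_step_expansion \<phi> h \<eta> \<delta> t x"
proof -
  define P where "P = space_grad (test_function \<phi> h) (t, x)"
  define K\<^sub>F where "K\<^sub>F = Lip * (norm P + 1) + norm (F x)"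
  define K\<^sub>G where "K\<^sub>G = M + Lip * norm P"
  have c_nonneg: "0 \<le> K\<^sub>F" "0 \<le> K\<^sub>G" using Lip_nonneg M_nonneg by (auto simp: K\<^sub>F_def K\<^sub>G_def)
  obtain \<kappa> where \<kappa>: "\<kappa> > 0" "\<kappa> \<le> 1" "(K\<^sub>F + K\<^sub>G + 1) * \<kappa> \<le> \<eta>" using small_scale_exists[OF \<open>\<eta> > 0\<close>] by metis
  have "0 \<le> K\<^sub>F * \<kappa>" "0 \<le> K\<^sub>G * \<kappa>" using c_nonneg \<kappa>(1) by auto
  then have errors: "K\<^sub>F * \<kappa> + \<kappa> / 2 \<le> \<eta>" "K\<^sub>G * \<kappa> \<le> \<eta>" using \<kappa> by (auto simp: distrib_right)
  have "\<kappa> / 2 > 0" using \<kappa>(1) by simp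
  obtain d where "d > 0" and expansion: "\<And>\<epsilon> y. 0 < \<epsilon> \<Longrightarrow> \<epsilon> < d \<Longrightarrow> norm (y - x) < d \<Longrightarrow>
      \<exists>\<pi>. norm (\<pi> - P) \<le> \<kappa> / 2 \<and> test_function \<phi> h (t + \<epsilon>, y) - test_function \<phi> h (t, x)
        \<le> \<epsilon> * (time_deriv \<phi> (t, x) - x \<bullet> adj_op domA A (space_grad \<phi> (t, x)) + \<kappa> / 2) + (y - S \<epsilon> x) \<bullet> \<pi>"
    using test_function_expansion[OF \<phi> h t \<open>\<kappa> / 2 > 0\<close>, of x] unfolding P_def by blast
  obtain e where "e > 0" and adjoint_near: "\<And>r. 0 \<le> r \<Longrightarrow> r < e \<Longrightarrow> norm (adjoint (S r) P - P) \<le> \<kappa> / 2"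
    using adjoint_S_near_id[OF \<open>\<kappa> / 2 > 0\<close>] by blast
  have "one_step_expansion \<phi> h \<eta> (min (min d e) \<kappa>) t x"
    unfolding one_step_expansion_def P_def[symmetric]
  proof (intro allI impI)
    fix \<epsilon> u X
    assume \<epsilon>: "0 < \<epsilon>" "\<epsilon> < min (min d e) \<kappa>"
      and u: "set_integrable lebesgue {t..t + \<epsilon>} u" and X: "mild (t + \<epsilon>) t x u X"
      and near: "\<forall>s\<in>{t..t + \<epsilon>}. norm (X s - x) < min (min d e) \<kappa>"
    obtain \<pi> where \<pi>: "norm (\<pi> - P) \<le> \<kappa> / 2"
      and increment: "test_function \<phi> h (t + \<epsilon>, X (t + \<epsilon>)) - test_function \<phi> h (t, x)
        \<le> \<epsilon> * (time_deriv \<phi> (t, x) - x \<bullet> adj_op domA A (space_grad \<phi> (t, x)) + \<kappa> / 2) + (X (t + \<epsilon>) - S \<epsilon> x) \<bullet> \<pi>"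
      using expansion[of \<epsilon> "X (t + \<epsilon>)"] near \<epsilon> by auto
    have "t \<le> t + \<epsilon>" using \<epsilon>(1) by simp
    then obtain w where w: "\<And>\<tau>. \<tau> \<in> {t..t + \<epsilon>} \<Longrightarrow> norm (w \<tau> - adjoint (G x) P) \<le> K\<^sub>G * \<kappa>"
      "set_integrable lebesgue {t..t + \<epsilon>} (\<lambda>\<tau>. u \<tau> \<bullet> w \<tau>)"
      and displacement: "(X (t + \<epsilon>) - S (t + \<epsilon> - t) x) \<bullet> \<pi>
        \<le> (t + \<epsilon> - t) * (F x \<bullet> P + K\<^sub>F * \<kappa>) + (LINT \<tau>:{t..t + \<epsilon>}|lebesgue. u \<tau> \<bullet> w \<tau>)"
      using mild_displacement_inner_perturbation_le[OF u X _ \<pi> \<kappa>(2)] adjoint_near near \<epsilon>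
      unfolding K\<^sub>F_def K\<^sub>G_def by (smt (verit))
    have "\<epsilon> * (K\<^sub>F * \<kappa> + \<kappa> / 2) \<le> \<epsilon> * \<eta>" using errors(1) \<epsilon>(1) by (intro mult_left_mono) auto
    then have "test_function \<phi> h (t + \<epsilon>, X (t + \<epsilon>)) - test_function \<phi> h (t, x)
        \<le> \<epsilon> * (uncontrolled_rate \<phi> h (t, x) + \<eta>) + (LINT \<tau>:{t..t + \<epsilon>}|lebesgue. u \<tau> \<bullet> w \<tau>)"
      using increment displacement by (simp add: uncontrolled_rate_def P_def algebra_simps)
    then show "\<exists>w. (\<forall>\<tau>\<in>{t..t + \<epsilon>}. norm (w \<tau> - adjoint (G x) P) \<le> \<eta>) \<and>
        set_integrable lebesgue {t..t + \<epsilon>} (\<lambda>\<tau>. u \<tau> \<bullet> w \<tau>) \<and>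
        test_function \<phi> h (t + \<epsilon>, X (t + \<epsilon>)) - test_function \<phi> h (t, x)
          \<le> \<epsilon> * (uncontrolled_rate \<phi> h (t, x) + \<eta>) + (LINT \<tau>:{t..t + \<epsilon>}|lebesgue. u \<tau> \<bullet> w \<tau>)"
      using w order_trans[OF _ errors(2)] by blast
  qed
  moreover have "min (min d e) \<kappa> > 0" using \<open>d > 0\<close> \<open>e > 0\<close> \<kappa>(1) by simp
  ultimately show ?thesis using that by blast
qed

end

subsection \<open>The viscosity property\<close>

context control_problem
begin

lemma v_B_tendsto:
  assumes ts: "\<And>k. ts k \<in> {0..T}" "t \<in> {0..T}" "ts \<longlonglongrightarrow> t"
    and weak: "weakly_converges xs x" and Bxs: "(\<lambda>k. B (xs k)) \<longlonglongrightarrow> B x"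
  shows "(\<lambda>k. v (ts k, xs k)) \<longlonglongrightarrow> v (t, x)"
proof -
  obtain C where C: "\<And>k. norm (xs k) \<le> C" using weakly_converges_bounded[OF weak] by blast
  define R where "R = max C (norm x)"
  have R: "norm (xs k) \<le> R" "norm x \<le> R" for k using C[of k] by (auto simp: R_def)
  obtain \<omega> where \<omega>: "is_modulus \<omega>" and modulus: "\<And>x y t s. norm x \<le> R \<Longrightarrow> norm y \<le> R \<Longrightarrow> t \<in> {0..T} \<Longrightarrow> s \<in> {0..T} \<Longrightarrow>
    \<bar>v (t, x) - v (s, y)\<bar> \<le> v_lipschitz_const * norm_m1 B (x - y) + \<omega> \<bar>t - s\<bar>"
    using v_modulus[of R] by blast
  have "(\<lambda>k. \<bar>ts k - t\<bar>) \<longlonglongrightarrow> 0" using ts(3) by (intro tendsto_rabs_zero LIM_zero)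
  then have "(\<lambda>k. \<omega> \<bar>ts k - t\<bar>) \<longlonglongrightarrow> \<omega> 0"
    using \<omega> unfolding is_modulus_def by (intro continuous_on_tendsto_compose[of "{0..}" \<omega>]) auto
  then have "(\<lambda>k. v_lipschitz_const * norm_m1 B (xs k - x) + \<omega> \<bar>ts k - t\<bar>) \<longlonglongrightarrow> v_lipschitz_const * 0 + \<omega> 0"
    by (intro tendsto_intros norm_m1_tendsto_0 psd_op_B weak Bxs)
  then have null: "(\<lambda>k. v_lipschitz_const * norm_m1 B (xs k - x) + \<omega> \<bar>ts k - t\<bar>) \<longlonglongrightarrow> 0"
    using \<omega> by (simp add: is_modulus_def)
  have "(\<lambda>k. v (ts k, xs k) - v (t, x)) \<longlonglongrightarrow> 0"
    by (rule Lim_null_comparison[OF _ null]) (use modulus[OF R ts(1,2)] in simp)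
  then show ?thesis by (rule LIM_zero_cancel)
qed

lemma v_semicontinuous:
  "B_usc B ({0<..<T} \<times> UNIV) v" "B_lsc B ({0<..<T} \<times> UNIV) v"
proof -
  have lim: "(\<lambda>k. ereal (v (ts k, xs k))) \<longlonglongrightarrow> ereal (v (t, x))"
    if "\<forall>k. (ts k, xs k) \<in> {0<..<T} \<times> UNIV" "(t, x) \<in> {0<..<T} \<times> UNIV" "ts \<longlonglongrightarrow> t"
      "weakly_converges xs x" "(\<lambda>k. B (xs k)) \<longlonglongrightarrow> B x" for ts xs t x
    by (rule tendsto_ereal, rule v_B_tendsto[OF _ _ that(3-5)]) (use that(1,2) in \<open>auto simp: less_imp_le\<close>)
  show "B_usc B ({0<..<T} \<times> UNIV) v"
    unfolding B_usc_def
    by (intro allI impI, rule order_eq_refl, rule lim_imp_Limsup[OF trivial_limit_sequentially], rule lim)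
  show "B_lsc B ({0<..<T} \<times> UNIV) v"
    unfolding B_lsc_def
    by (intro allI impI, rule order_eq_refl, rule lim_imp_Liminf[OF trivial_limit_sequentially, symmetric], rule lim)
qed

lemma v_locally_bounded: "locally_bounded_on ({0<..<T} \<times> UNIV) v"
  unfolding locally_bounded_on_def
proof (intro ballI exI[of _ UNIV] conjI)
  fix z :: "real \<times> 'a"
  show "bounded (v ` (UNIV \<inter> {0<..<T} \<times> UNIV))"
    using abs_v_le by (intro boundedI[of _ C\<gamma>]) auto
qed auto

lemma cheap_trajectory_near:
  assumes "d > 0"
  obtains \<delta> where "\<delta> > 0" "\<And>r t u X. cheap_trajectory r t x u X \<Longrightarrow> r - t < \<delta> \<Longrightarrow> norm (X r - x) < d"
proof -
  have "d / 4 > 0" "d / 2 > 0" using assms by auto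
  obtain C where C: "C \<ge> 0" "\<And>r t u X. cheap_trajectory r t x u X \<Longrightarrow> norm (X r - S (r - t) x) \<le> d / 4 + C * (r - t)"
    using cheap_trajectory_displacement_affine_bound[OF \<open>d / 4 > 0\<close>, of "norm x"] by (metis order_refl)
  obtain \<kappa> where \<kappa>: "\<kappa> > 0" "C * \<kappa> \<le> d / 4" using small_scale_exists[OF \<open>d / 4 > 0\<close>] by metis
  obtain e where e: "e > 0" "\<And>r. 0 \<le> r \<Longrightarrow> r < e \<Longrightarrow> norm (S r x - x) < d / 2"
    using S_near_id[OF \<open>d / 2 > 0\<close>] by blast
  show ?thesis
  proof (rule that[of "min \<kappa> e"])
    fix r t u X assume traj: "cheap_trajectory r t x u X" and near: "r - t < min \<kappa> e"
    have "C * (r - t) \<le> C * \<kappa>" using near C(1) by (intro mult_left_mono) auto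
    then have "norm (X r - S (r - t) x) \<le> d / 2" using C(2)[OF traj] \<kappa>(2) by linarith
    moreover have "norm (S (r - t) x - x) < d / 2" using near cheap_trajectoryD(2)[OF traj] by (intro e(2)) auto
    ultimately show "norm (X r - x) < d"
      using norm_triangle_ineq[of "X r - S (r - t) x" "S (r - t) x - x"] by simp
  qed (use \<kappa>(1) e(1) in simp)
qed

lemma test_function_constant_control:
  fixes x :: 'a
  assumes \<phi>: "test_phi domA A B T \<phi>" and h: "test_h h" and t: "t \<in> {0<..<T}" and "\<eta> > 0"
    and X: "mild T t x (\<lambda>_. u) X"
  defines "Q \<equiv> adjoint (G x) (space_grad (test_function \<phi> h) (t, x))"
  obtains \<epsilon> where "\<epsilon> > 0" "t + \<epsilon> < T"
    "test_function \<phi> h (t + \<epsilon>, X (t + \<epsilon>)) - test_function \<phi> h (t, x)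
      \<le> \<epsilon> * (uncontrolled_rate \<phi> h (t, x) + u \<bullet> Q + \<eta>)"
proof -
  obtain \<kappa> where \<kappa>: "\<kappa> > 0" "(1 + norm u) * \<kappa> \<le> \<eta>" using small_scale_exists[OF \<open>\<eta> > 0\<close>] by metis
  obtain \<delta> where \<delta>: "\<delta> > 0" and expansion: "one_step_expansion \<phi> h \<kappa> \<delta> t x"
    using one_step_expansion_exists[OF \<phi> h t \<kappa>(1)] .
  have "t \<le> T" using t by simp
  then obtain e where e: "e > 0" "\<And>s. s \<in> {t..T} \<Longrightarrow> dist s t < e \<Longrightarrow> dist (X s) (X t) < \<delta>"
    using mild_continuous[OF X] \<delta> unfolding continuous_on_iff by (metis atLeastAtMost_iff order_refl)
  define \<epsilon> where "\<epsilon> = min (min \<delta> e) (T - t) / 2"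
  have \<epsilon>: "0 < \<epsilon>" "\<epsilon> < \<delta>" "\<epsilon> < e" "t + \<epsilon> < T" using \<delta> e(1) t by (auto simp: \<epsilon>_def min_def field_simps)
  have near: "\<forall>s\<in>{t..t + \<epsilon>}. norm (X s - x) < \<delta>"
    using e(2) \<epsilon> mild_initial[OF X \<open>t \<le> T\<close>] by (simp add: dist_norm)
  have u: "set_integrable lebesgue {t..t + \<epsilon>} (\<lambda>_. u)"
    by (intro set_integrable_continuous_interval continuous_on_const)
  have X_restricted: "mild (t + \<epsilon>) t x (\<lambda>_. u) X" using mild_restrict_left[OF X] \<epsilon>(4) by simp
  obtain w where w: "\<forall>\<tau>\<in>{t..t + \<epsilon>}. norm (w \<tau> - Q) \<le> \<kappa>"
      "set_integrable lebesgue {t..t + \<epsilon>} (\<lambda>\<tau>. u \<bullet> w \<tau>)"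
    and increment: "test_function \<phi> h (t + \<epsilon>, X (t + \<epsilon>)) - test_function \<phi> h (t, x)
      \<le> \<epsilon> * (uncontrolled_rate \<phi> h (t, x) + \<kappa>) + (LINT \<tau>:{t..t + \<epsilon>}|lebesgue. u \<bullet> w \<tau>)"
    using one_step_expansionE[OF expansion \<epsilon>(1,2) u X_restricted near] unfolding Q_def .
  have "(LINT \<tau>:{t..t + \<epsilon>}|lebesgue. u \<bullet> w \<tau>) \<le> (LINT \<tau>:{t..t + \<epsilon>}|lebesgue. u \<bullet> Q + norm u * \<kappa>)"
  proof (intro set_integral_mono w set_integrable_continuous_interval continuous_on_const)
    fix \<tau> assume "\<tau> \<in> {t..t + \<epsilon>}"
    then have "u \<bullet> (w \<tau> - Q) \<le> norm u * \<kappa>"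
      using w(1) by (intro order_trans[OF norm_cauchy_schwarz] mult_left_mono) auto
    then show "u \<bullet> w \<tau> \<le> u \<bullet> Q + norm u * \<kappa>" by (simp add: inner_diff_right)
  qed
  also have "\<dots> = \<epsilon> * (u \<bullet> Q + norm u * \<kappa>)" using \<epsilon>(1) by (simp add: set_integral_const_interval)
  finally have "test_function \<phi> h (t + \<epsilon>, X (t + \<epsilon>)) - test_function \<phi> h (t, x)
      \<le> \<epsilon> * (uncontrolled_rate \<phi> h (t, x) + u \<bullet> Q + (1 + norm u) * \<kappa>)"
    using increment by (simp add: algebra_simps)
  also have "\<dots> \<le> \<epsilon> * (uncontrolled_rate \<phi> h (t, x) + u \<bullet> Q + \<eta>)"
    using \<kappa>(2) \<epsilon>(1) by (intro mult_left_mono add_left_mono) auto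
  finally show ?thesis by (rule that[OF \<epsilon>(1,4)])
qed

text \<open>The constant control \<open>\<nabla>H0(q)\<close> attains equality in Fenchel's inequality.\<close>

lemma v_supersolution_inequality:
  fixes x :: 'a
  assumes \<phi>: "test_phi domA A B T \<phi>" and h: "test_h h" and t: "t \<in> {0<..<T}"
    and minimum: "\<And>s y. s \<in> {0<..<T} \<Longrightarrow> v (t, x) + test_function \<phi> h (t, x) \<le> v (s, y) + test_function \<phi> h (s, y)"
  defines "Q \<equiv> adjoint (G x) (space_grad (test_function \<phi> h) (t, x))"
  shows "H0 \<nu> (- Q) \<le> uncontrolled_rate \<phi> h (t, x)"
proof (rule field_le_epsilon)
  fix \<eta> :: real assume "\<eta> > 0"
  define u where "u = H0_gradient (- Q)"
  define l where "l = u \<bullet> (- Q) - H0 \<nu> (- Q)"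
  have L0_u: "L0 \<nu> u = ereal l" unfolding u_def l_def by (rule L0_H0_gradient)
  have "t \<le> T" using t by simp
  then obtain X where X: "mild T t x (\<lambda>_. u) X"
    using mild_exists[OF admissible_integrable[OF admissible_const(1)[OF L0_u]]] by blast
  obtain \<epsilon> where \<epsilon>: "\<epsilon> > 0" "t + \<epsilon> < T"
    and increment: "test_function \<phi> h (t + \<epsilon>, X (t + \<epsilon>)) - test_function \<phi> h (t, x)
      \<le> \<epsilon> * (uncontrolled_rate \<phi> h (t, x) + u \<bullet> Q + \<eta>)"
    using test_function_constant_control[OF \<phi> h t \<open>\<eta> > 0\<close> X] unfolding Q_def by blast
  have "- cost (t + \<epsilon>) t (\<lambda>_. u) + v (t + \<epsilon>, X (t + \<epsilon>)) \<le> v (t, x)"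
    using \<epsilon> by (intro dynamic_programming_ge admissible_const(1)[OF L0_u] mild_restrict_left[OF X]) auto
  moreover have "cost (t + \<epsilon>) t (\<lambda>_. u) = \<epsilon> * l"
    using admissible_const(2)[OF L0_u, of t "t + \<epsilon>"] \<epsilon>(1) by simp
  ultimately have "0 \<le> \<epsilon> * l + \<epsilon> * (uncontrolled_rate \<phi> h (t, x) + u \<bullet> Q + \<eta>)"
    using increment minimum[of "t + \<epsilon>" "X (t + \<epsilon>)"] \<epsilon> t by simp
  also have "\<dots> = \<epsilon> * (uncontrolled_rate \<phi> h (t, x) + \<eta> - H0 \<nu> (- Q))"
    by (simp add: l_def algebra_simps)
  finally show "H0 \<nu> (- Q) \<le> uncontrolled_rate \<phi> h (t, x) + \<eta>"
    using \<epsilon>(1) by (simp add: zero_le_mult_iff)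
qed

lemma v_supersolution: "viscosity_supersolution domA A B \<nu> F G T v"
  unfolding viscosity_supersolution_def
proof (intro conjI v_locally_bounded v_semicontinuous allI impI)
  fix \<phi> h t x
  assume \<phi>: "test_phi domA A B T \<phi>" and h: "test_h h" and t: "t \<in> {0<..<T}"
    and minimum: "\<forall>s\<in>{0<..<T}. \<forall>y. v (t, x) + \<phi> (t, x) + h (norm x) \<le> v (s, y) + \<phi> (s, y) + h (norm y)"
  let ?P = "space_grad (test_function \<phi> h) (t, x)"
  let ?\<psi> = "\<lambda>(s, y). - \<phi> (s, y) - h (norm y)"
  obtain h' where radial: "radial_derivative h h'" using test_h_radial_derivative[OF h] .
  have \<psi>: "?\<psi> (s, y) = - test_function \<phi> h (s, y)" for s y by (simp add: test_function_def)
  have space: "space_grad ?\<psi> (t, x) = - ?P"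
    unfolding space_grad_test_function[OF \<phi> t radial]
    by (rule space_grad_eqI) (unfold \<psi>, rule GDERIV_minus[OF test_function_partials(1)[OF \<phi> t radial]])
  have time: "time_deriv ?\<psi> (t, x) = - time_deriv \<phi> (t, x)"
    by (rule time_deriv_eqI) (unfold \<psi>, rule DERIV_minus[OF test_function_partials(2)[OF \<phi> t radial]])
  have "adjoint (G x) (- ?P) = - adjoint (G x) ?P"
    using adjoint_blinfun_diff_right[of "G x" 0 ?P] adjoint_blinfun_diff_right[of "G x" 0 0] by simp
  moreover have "H0 \<nu> (- adjoint (G x) ?P) \<le> uncontrolled_rate \<phi> h (t, x)"
    using minimum by (intro v_supersolution_inequality \<phi> h t) (simp add: test_function_def add.assoc)
  ultimately show "let \<psi> = ?\<psi> in time_deriv \<psi> (t, x) + x \<bullet> adj_op domA A (space_grad \<phi> (t, x))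
      + F x \<bullet> space_grad \<psi> (t, x) + H0 \<nu> (adjoint (G x) (space_grad \<psi> (t, x))) \<le> 0"
    unfolding Let_def space time by (simp add: uncontrolled_rate_def)
qed

lemma test_function_cheap_trajectory:
  fixes x :: 'a
  assumes \<phi>: "test_phi domA A B T \<phi>" and h: "test_h h" and t: "t \<in> {0<..<T}" and "\<eta> > 0"
  defines "Q \<equiv> adjoint (G x) (space_grad (test_function \<phi> h) (t, x))"
  obtains \<epsilon> where "\<epsilon> > 0" "\<epsilon> \<le> 1" "t + \<epsilon> < T"
    "\<And>u X. cheap_trajectory (t + \<epsilon>) t x u X \<Longrightarrow>
      test_function \<phi> h (t + \<epsilon>, X (t + \<epsilon>)) - test_function \<phi> h (t, x)
        \<le> \<epsilon> * (uncontrolled_rate \<phi> h (t, x) + H0 \<nu> Q + 2 * \<eta>) + cost (t + \<epsilon>) t u"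
proof -
  obtain d where d: "d > 0" "\<And>w. dist w Q < d \<Longrightarrow> dist (H0 \<nu> w) (H0 \<nu> Q) < \<eta>"
    using isCont_H0[of Q] \<open>\<eta> > 0\<close> unfolding continuous_at_eps_delta by blast
  define \<kappa> where "\<kappa> = min \<eta> (d / 2)"
  have \<kappa>: "0 < \<kappa>" "\<kappa> \<le> \<eta>" "\<kappa> < d" using d(1) \<open>\<eta> > 0\<close> by (auto simp: \<kappa>_def)
  obtain \<delta> where \<delta>: "\<delta> > 0" and expansion: "one_step_expansion \<phi> h \<kappa> \<delta> t x"
    using one_step_expansion_exists[OF \<phi> h t \<kappa>(1)] .
  obtain e where e: "e > 0" "\<And>r t u X. cheap_trajectory r t x u X \<Longrightarrow> r - t < e \<Longrightarrow> norm (X r - x) < \<delta>"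
    using cheap_trajectory_near[OF \<delta>] by blast
  define \<epsilon> where "\<epsilon> = min (min \<delta> e) (min 1 (T - t)) / 2"
  have \<epsilon>: "0 < \<epsilon>" "\<epsilon> < \<delta>" "\<epsilon> < e" "\<epsilon> \<le> 1" "t + \<epsilon> < T"
    using \<delta> e(1) t by (auto simp: \<epsilon>_def min_def field_simps)
  show ?thesis
  proof (rule that[OF \<epsilon>(1,4,5)])
    fix u X assume traj: "cheap_trajectory (t + \<epsilon>) t x u X"
    note u = cheap_trajectoryD[OF traj]
    have near: "\<forall>s\<in>{t..t + \<epsilon>}. norm (X s - x) < \<delta>"
      using e(2)[OF cheap_trajectory_restrict[OF traj]] \<epsilon>(3) by auto
    obtain w where w: "\<forall>\<tau>\<in>{t..t + \<epsilon>}. norm (w \<tau> - Q) \<le> \<kappa>"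
        "set_integrable lebesgue {t..t + \<epsilon>} (\<lambda>\<tau>. u \<tau> \<bullet> w \<tau>)"
      and increment: "test_function \<phi> h (t + \<epsilon>, X (t + \<epsilon>)) - test_function \<phi> h (t, x)
        \<le> \<epsilon> * (uncontrolled_rate \<phi> h (t, x) + \<kappa>) + (LINT \<tau>:{t..t + \<epsilon>}|lebesgue. u \<tau> \<bullet> w \<tau>)"
      using one_step_expansionE[OF expansion \<epsilon>(1,2) u(7,6) near] unfolding Q_def .
    have "(LINT \<tau>:{t..t + \<epsilon>}|lebesgue. u \<tau> \<bullet> w \<tau>) \<le> cost (t + \<epsilon>) t u + (H0 \<nu> Q + \<eta>) * (t + \<epsilon> - t)"
    proof (rule set_integral_inner_le_cost[OF u(4,2) _ w(2)])
      show "0 \<le> H0 \<nu> Q + \<eta>" using H0_nonneg[of Q] \<open>\<eta> > 0\<close> by simp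
      fix \<tau> assume "\<tau> \<in> {t..t + \<epsilon>}"
      then show "H0 \<nu> (w \<tau>) \<le> H0 \<nu> Q + \<eta>"
        using d(2)[of "w \<tau>"] bspec[OF w(1), of \<tau>] \<kappa>(3) by (simp add: dist_norm dist_real_def abs_less_iff)
    qed
    moreover have "\<epsilon> * \<kappa> \<le> \<epsilon> * \<eta>" using \<epsilon>(1) \<kappa>(2) by (intro mult_left_mono) auto
    ultimately show "test_function \<phi> h (t + \<epsilon>, X (t + \<epsilon>)) - test_function \<phi> h (t, x)
        \<le> \<epsilon> * (uncontrolled_rate \<phi> h (t, x) + H0 \<nu> Q + 2 * \<eta>) + cost (t + \<epsilon>) t u"
      using increment by (simp add: algebra_simps)
  qed
qed

lemma v_subsolution_inequality:
  fixes x :: 'a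
  assumes \<phi>: "test_phi domA A B T \<phi>" and h: "test_h h" and t: "t \<in> {0<..<T}"
    and maximum: "\<And>s y. s \<in> {0<..<T} \<Longrightarrow> v (s, y) - test_function \<phi> h (s, y) \<le> v (t, x) - test_function \<phi> h (t, x)"
  defines "Q \<equiv> adjoint (G x) (space_grad (test_function \<phi> h) (t, x))"
  shows "0 \<le> uncontrolled_rate \<phi> h (t, x) + H0 \<nu> Q"
proof (rule field_le_epsilon)
  fix e :: real assume "e > 0"
  define \<eta> where "\<eta> = min 1 (e / 3)"
  have \<eta>: "0 < \<eta>" "\<eta> \<le> 1" "3 * \<eta> \<le> e" using \<open>e > 0\<close> by (auto simp: \<eta>_def)
  obtain \<epsilon> where \<epsilon>: "\<epsilon> > 0" "\<epsilon> \<le> 1" "t + \<epsilon> < T"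
    and increment: "\<And>u X. cheap_trajectory (t + \<epsilon>) t x u X \<Longrightarrow>
      test_function \<phi> h (t + \<epsilon>, X (t + \<epsilon>)) - test_function \<phi> h (t, x)
        \<le> \<epsilon> * (uncontrolled_rate \<phi> h (t, x) + H0 \<nu> Q + 2 * \<eta>) + cost (t + \<epsilon>) t u"
    using test_function_cheap_trajectory[OF \<phi> h t \<eta>(1)] unfolding Q_def by blast
  have "0 < \<epsilon> * \<eta>" "\<epsilon> * \<eta> \<le> 1" using \<epsilon> \<eta> by (auto intro: mult_le_one)
  then obtain u X where traj: "cheap_trajectory (t + \<epsilon>) t x u X"
    and "v (t, x) \<le> - cost (t + \<epsilon>) t u + v (t + \<epsilon>, X (t + \<epsilon>)) + \<epsilon> * \<eta>"
    using dynamic_programming_le[of t "t + \<epsilon>" "\<epsilon> * \<eta>" x] t \<epsilon> by auto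
  then have "0 \<le> \<epsilon> * \<eta> + \<epsilon> * (uncontrolled_rate \<phi> h (t, x) + H0 \<nu> Q + 2 * \<eta>)"
    using increment[OF traj] maximum[of "t + \<epsilon>" "X (t + \<epsilon>)"] \<epsilon> t by simp
  also have "\<dots> = \<epsilon> * (uncontrolled_rate \<phi> h (t, x) + H0 \<nu> Q + 3 * \<eta>)" by (simp add: algebra_simps)
  finally show "0 \<le> uncontrolled_rate \<phi> h (t, x) + H0 \<nu> Q + e"
    using \<epsilon>(1) \<eta>(3) by (simp add: zero_le_mult_iff)
qed

lemma v_subsolution: "viscosity_subsolution domA A B \<nu> F G T v"
  unfolding viscosity_subsolution_def
proof (intro conjI v_locally_bounded v_semicontinuous allI impI)
  fix \<phi> h t x
  assume \<phi>: "test_phi domA A B T \<phi>" and h: "test_h h" and t: "t \<in> {0<..<T}"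
    and maximum: "\<forall>s\<in>{0<..<T}. \<forall>y. v (s, y) - \<phi> (s, y) - h (norm y) \<le> v (t, x) - \<phi> (t, x) - h (norm x)"
  obtain h' where radial: "radial_derivative h h'" using test_h_radial_derivative[OF h] .
  have "time_deriv (test_function \<phi> h) (t, x) = time_deriv \<phi> (t, x)"
    by (rule time_deriv_eqI[OF test_function_partials(2)[OF \<phi> t radial]])
  moreover have "0 \<le> uncontrolled_rate \<phi> h (t, x) + H0 \<nu> (adjoint (G x) (space_grad (test_function \<phi> h) (t, x)))"
    using maximum by (intro v_subsolution_inequality \<phi> h t) (simp add: test_function_def diff_diff_eq)
  ultimately show "let \<psi> = \<lambda>(s, y). \<phi> (s, y) + h (norm y) in
      time_deriv \<psi> (t, x) - x \<bullet> adj_op domA A (space_grad \<phi> (t, x))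
      + F x \<bullet> space_grad \<psi> (t, x) + H0 \<nu> (adjoint (G x) (space_grad \<psi> (t, x))) \<ge> 0"
    unfolding Let_def test_function_def[symmetric] by (simp add: uncontrolled_rate_def)
qed

end

lemma Lip_b_completion:
  assumes "is_completion N J" "g \<in> Lip_b"
  obtains C L where "\<And>x. \<bar>g (J x)\<bar> \<le> C" "0 \<le> L" "\<And>x y. \<bar>g (J x) - g (J y)\<bar> \<le> L * N (x - y)"
proof -
  obtain C where C: "\<And>y. \<bar>g y\<bar> \<le> C" using assms(2) by (auto simp: Lip_b_def bounded_iff)
  obtain L where L: "L-lipschitz_on UNIV g" using assms(2) by (auto simp: Lip_b_def)
  have "\<bar>g (J x) - g (J y)\<bar> \<le> L * N (x - y)" for x y
  proof -
    have "dist (J x) (J y) = norm (J (x - y))" using assms(1) by (simp add: is_completion_def linear_diff dist_norm)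
    also have "\<dots> = N (x - y)" using assms(1) by (simp add: is_completion_def)
    finally show ?thesis using lipschitz_onD[OF L, of "J x" "J y"] by (simp add: dist_real_def)
  qed
  with C lipschitz_on_nonneg[OF L] show ?thesis by (rule that)
qed

theorem theorem4p4:
  fixes domA :: "'a::{real_inner, banach, second_countable_topology} set"
    and A :: "'a \<Rightarrow> 'a"
    and S :: "real \<Rightarrow> 'a \<Rightarrow>\<^sub>L 'a"
    and B :: "'a \<Rightarrow>\<^sub>L 'a"
    and c0 :: real
    and F :: "'a \<Rightarrow> 'a"
    and G :: "'a \<Rightarrow> 'a \<Rightarrow>\<^sub>L 'a"
    and \<nu> :: "'a measure"
    and J :: "'a \<Rightarrow> 'b::banach"
    and g :: "'b \<Rightarrow> real"
    and T M :: real
  assumes "linear_operator_on domA A"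
    and "closure domA = UNIV"
    and "maximal_monotone domA A"
    and "contraction_C0_semigroup S"
    and "generator_of S domA (\<lambda>x. - A x)"
    and "self_adjoint B"
    and "strictly_positive B"
    and "\<forall>x. B x \<in> adj_domain domA A"
    and "bounded_linear (\<lambda>x. adj_op domA A (B x))"
    and "c0 \<ge> 0"
    and "\<forall>x. (adj_op domA A (B x) + c0 *\<^sub>R B x) \<bullet> x \<ge> 0"
    and "is_completion (norm_m1 B) J"
    and "sets \<nu> = sets borel"
    and "emeasure \<nu> {0} = 0"
    and "(\<integral>\<^sup>+z. ennreal ((norm z)\<^sup>2) \<partial>\<nu>) < \<infinity>"
    and "\<forall>K>0. (\<integral>\<^sup>+z. ennreal ((norm z)\<^sup>2 * exp (K * norm z)) \<partial>\<nu>) < \<infinity>"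
    and "T > 0"
    and "M \<ge> 0"
    and "norm (F 0) \<le> M"
    and "\<forall>x y. norm (F x - F y) \<le> M * norm_m1 B (x - y)"
    and "\<forall>x y. norm (G x - G y) \<le> M * norm_m1 B (x - y)"
    and "\<forall>x. norm (G x) \<le> M"
    and "g \<in> Lip_b"
  shows "\<exists>v :: real \<times> 'a \<Rightarrow> real.
    (\<forall>t\<in>{0..T}. \<forall>x. ereal (v (t, x)) = value_function \<nu> S F G (\<lambda>y. g (J y)) T t x) \<and>
    (\<exists>D1. \<forall>R>0. \<exists>\<omega>. is_modulus \<omega> \<and>
       (\<forall>x y. norm x \<le> R \<longrightarrow> norm y \<le> R \<longrightarrow> (\<forall>t\<in>{0..T}. \<forall>s\<in>{0..T}.
          \<bar>v (t, x) - v (s, y)\<bar> \<le> D1 * norm_m1 B (x - y) + \<omega> \<bar>t - s\<bar>))) \<and>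
    viscosity_solution domA A B \<nu> F G T v \<and>
    (\<forall>x. v (T, x) = g (J x))"
proof -
  obtain C L where gJ: "\<And>x. \<bar>g (J x)\<bar> \<le> C" "0 \<le> L" "\<And>x y. \<bar>g (J x) - g (J y)\<bar> \<le> L * norm_m1 B (x - y)"
    using Lip_b_completion[OF assms(12,23)] by blast
  interpret control_problem domA A S B c0 F G M \<nu> "\<lambda>y. g (J y)" C L T
    by (intro control_problem.intro control_system.intro weak_contraction.intro generated_contraction.intro
        weak_contraction_axioms.intro control_system_axioms.intro exponential_levy.intro control_problem_axioms.intro
        assms gJ)
  show ?thesis
  proof (intro exI[of _ v] conjI)
    show "\<forall>t\<in>{0..T}. \<forall>x. ereal (v (t, x)) = value_function \<nu> S F G (\<lambda>y. g (J y)) T t x"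
      using ereal_v by simp
    show "\<exists>D1. \<forall>R>0. \<exists>\<omega>. is_modulus \<omega> \<and> (\<forall>x y. norm x \<le> R \<longrightarrow> norm y \<le> R \<longrightarrow> (\<forall>t\<in>{0..T}. \<forall>s\<in>{0..T}.
          \<bar>v (t, x) - v (s, y)\<bar> \<le> D1 * norm_m1 B (x - y) + \<omega> \<bar>t - s\<bar>))"
      using v_modulus by blast
    show "viscosity_solution domA A B \<nu> F G T v"
      using v_subsolution v_supersolution by (simp add: viscosity_solution_def)
    show "\<forall>x. v (T, x) = g (J x)" using v_terminal by simp
  qed
qed

end
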